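(* Let $\mathcal{X}$ and $\mathcal{Y}$ be infinite dimensional complex Banach spaces, and let $A\in B(\mathcal{X})$ and $B\in B(\mathcal{Y})$ be two non-algebraic operators that satisfy the generalized Browder's theorem. Set $\mathbb{S}=\sigma(A)\sigma_{BW}(B)\cup\sigma_{BW}(A)\sigma(B)$. (a) If $A\otimes B\in B(\mathcal{X}\overline{\otimes}\mathcal{Y})$ satisfies the generalized Browder's theorem, then the following statements are equivalent: (i) $\mathbb{S}\subseteq\sigma_{BW}(A\otimes B)$; (ii) $0\notin\Pi(A\otimes B)$ $(=\Pi(\tau_{AB}))$; (iii) $A\otimes B$ is invertible or $A\otimes B$ is not Drazin invertible. Furthermore, if one of these equivalent statements holds, then $\mathbb{S}=\sigma_{BW}(A\otimes B)$, while if this is not the case, then $\mathbb{S}=\sigma_{BW}(A\otimes B)\cup\{0\}$. (b) If $\tau_{AB}\in B(B(\mathcal{Y},\mathcal{X}))$ satisfies the generalized Browder's theorem, then the following statements are equivalent: (i) $\mathbb{S}\subseteq\sigma_{BW}(\tau_{AB})$; (ii) $0\notin\Pi(A\otimes B)$ $(=\Pi(\tau_{AB}))$; (iii) $\tau_{AB}$ is invertible or $\tau_{AB}$ is not Drazin invertible. Furthermore, if one of these equivalent statements holds, then $\mathbb{S}=\sigma_{BW}(\tau_{AB})$, while if this is not the case, then $\mathbb{S}=\sigma_{BW}(\tau_{AB})\cup\{0\}$.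
   Context: $B(\mathcal{Y},\mathcal{X})$ is the space of bounded linear maps from $\mathcal{Y}$ to $\mathcal{X}$, and $B(\mathcal{X})=B(\mathcal{X},\mathcal{X})$. $\mathcal{X}\overline{\otimes}\mathcal{Y}$ is the completion of the algebraic tensor product $\mathcal{X}\otimes\mathcal{Y}$ with respect to a reasonable uniform cross-norm (in particular $\|x\otimes y\|=\|x\|\,\|y\|$, and $A\otimes B$ extends to a bounded operator on the completion with $\|A\otimes B\|\le\|A\|\,\|B\|$, for all bounded $A$ on $\mathcal{X}$ and $B$ on $\mathcal{Y}$). $A\otimes B$ denotes this tensor product operator. $\tau_{AB}\in B(B(\mathcal{Y},\mathcal{X}))$ is the multiplication operator $\tau_{AB}(U)=AUB$. For subsets $K,K'$ of $\mathbb{C}$, $KK'=\{kk'\colon k\in K,\ k'\in K'\}$ (empty if either set is empty). A bounded operator $T$ is algebraic if $P(T)=0$ for some non-constant polynomial $P\in\mathbb{C}[X]$. A bounded operator $T$ on a Banach space $\mathcal{Z}$ is Drazin invertible if there are $S\in B(\mathcal{Z})$ and $m\in\mathbb{N}$ with $T^m=T^mST$, $STS=S$, $TS=ST$ (so invertible operators are Drazin invertible). $T$ is Weyl if $\dim N(T)$ and $\dim \mathcal{Z}/R(T)$ are finite and equal, where $N$ and $R$ denote null space and range. $T$ is B-Weyl if there is $n\in\mathbb{N}$ such that $R(T^n)$ is closed and the operator induced by $T$ on $R(T^n)$ is Weyl. $\sigma_{BW}(T)=\{\lambda\in\mathbb{C}\colon T-\lambda \text{ is not B-Weyl}\}$.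 The ascent (descent) of $T$ is the smallest integer $n\ge 0$ with $N(T^n)=N(T^{n+1})$ (respectively $R(T^n)=R(T^{n+1})$), or $\infty$ if there is none. $\Pi(T)$ is the set of poles of $T$: those $\lambda\in\sigma(T)$ such that the ascent and the descent of $T-\lambda$ are finite. $T$ satisfies the generalized Browder's theorem if $\sigma_{BW}(T)=\sigma(T)\setminus\Pi(T)$. *)

theory Defs
  imports
    "HOL-Analysis.Analysis"
    "HOL-Library.Extended_Nat"
    "HOL-Library.Set_Algebras"
    "HOL-Computational_Algebra.Polynomial"
begin

section \<open>Complex Banach spaces\<close>

class complex_vector = real_vector +
  fixes scaleC :: "complex \<Rightarrow> 'a \<Rightarrow> 'a" (infixr "*\<^sub>C" 75)
  assumes scaleC_add_right: "c *\<^sub>C (x + y) = c *\<^sub>C x + c *\<^sub>C y"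
    and scaleC_add_left: "(c + d) *\<^sub>C x = c *\<^sub>C x + d *\<^sub>C x"
    and scaleC_scaleC: "c *\<^sub>C d *\<^sub>C x = (c * d) *\<^sub>C x"
    and scaleC_one: "1 *\<^sub>C x = x"
    and scaleR_scaleC: "r *\<^sub>R x = complex_of_real r *\<^sub>C x"

class complex_normed_vector = complex_vector + real_normed_vector +
  assumes norm_scaleC: "norm (c *\<^sub>C x) = cmod c * norm x"

class complex_banach = complex_normed_vector + complete_space

subclass (in complex_banach) banach ..

interpretation complex_vector:
  vector_space "scaleC :: complex \<Rightarrow> 'a \<Rightarrow> 'a::complex_vector"
  by unfold_locales (simp_all add: scaleC_add_right scaleC_add_left scaleC_scaleC scaleC_one)

instantiation complex :: complex_banach
begin

definition scaleC_complex :: "complex \<Rightarrow> complex \<Rightarrow> complex"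
  where "scaleC_complex c z = c * z"

instance
  by standard (simp_all add: scaleC_complex_def algebra_simps scaleR_conv_of_real norm_mult)

end

abbreviation clinear :: "('a::complex_vector \<Rightarrow> 'b::complex_vector) \<Rightarrow> bool"
  where "clinear \<equiv> Vector_Spaces.linear scaleC scaleC"

lemma clinearI:
  assumes "\<And>x y. f (x + y) = f x + f y" and "\<And>c x. f (c *\<^sub>C x) = c *\<^sub>C f x"
  shows "clinear f"
  using assms by unfold_locales

definition fin_dim :: "'a::complex_vector set \<Rightarrow> bool"
  where "fin_dim V \<longleftrightarrow> (\<exists>C. finite C \<and> V \<subseteq> complex_vector.span C)"

section \<open>Bounded linear maps\<close>

text \<open>The elements are the real-linear bounded maps of \<^typ>\<open>('a, 'b) blinfun\<close> that are
  complex-linear; the norm is the operator norm inherited from there.\<close>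

typedef (overloaded) ('a, 'b) cblinfun =
  "{f :: 'a::complex_normed_vector \<Rightarrow>\<^sub>L 'b::complex_normed_vector.
      \<forall>c x. blinfun_apply f (c *\<^sub>C x) = c *\<^sub>C blinfun_apply f x}"
  morphisms blinfun_of_cblinfun Abs_cblinfun
  by (rule exI[of _ 0]) simp

setup_lifting type_definition_cblinfun

lift_definition capp :: "('a::complex_normed_vector, 'b::complex_normed_vector) cblinfun \<Rightarrow> 'a \<Rightarrow> 'b"
  is blinfun_apply .

lift_definition ccompose ::
  "('b::complex_normed_vector, 'c::complex_normed_vector) cblinfun \<Rightarrow>
   ('a::complex_normed_vector, 'b) cblinfun \<Rightarrow> ('a, 'c) cblinfun" (infixl "o\<^sub>C" 67)
  is blinfun_compose
  by simp

lift_definition cid :: "('a::complex_normed_vector, 'a) cblinfun" is id_blinfun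
  by simp

lemma capp_ccompose [simp]: "capp (S o\<^sub>C T) x = capp S (capp T x)"
  by transfer simp

lemma capp_cid [simp]: "capp cid x = x"
  by transfer simp

lemma cblinfun_eqI: "(\<And>x. capp S x = capp T x) \<Longrightarrow> S = T"
  by transfer (rule blinfun_eqI)

lemma capp_clinear: "clinear (capp T)"
  by (rule clinearI; transfer) (auto simp: blinfun.add_right)

lemma clinear_bounded_linear:
  fixes f :: "'a::complex_normed_vector \<Rightarrow> 'b::complex_normed_vector"
  assumes "clinear f" and "\<And>x. norm (f x) \<le> norm x * K"
  shows "bounded_linear f"
proof -
  interpret Vector_Spaces.linear scaleC scaleC f by fact
  show ?thesis
    by (rule bounded_linear_intro[OF _ _ assms(2)]) (simp_all add: add scale scaleR_scaleC)
qed

definition mk_cblinfun ::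
  "('a::complex_normed_vector \<Rightarrow> 'b::complex_normed_vector) \<Rightarrow> ('a, 'b) cblinfun"
  where "mk_cblinfun f = Abs_cblinfun (Blinfun f)"

lemma capp_mk_cblinfun:
  assumes "clinear f" and "\<And>x. norm (f x) \<le> norm x * K"
  shows "capp (mk_cblinfun f) = f"
proof -
  have "blinfun_apply (Blinfun f) = f"
    by (rule bounded_linear_Blinfun_apply[OF clinear_bounded_linear[OF assms]])
  moreover from assms(1) have "f (c *\<^sub>C x) = c *\<^sub>C f x" for c x
    unfolding Vector_Spaces.linear_iff by blast
  ultimately show ?thesis
    by (simp add: mk_cblinfun_def capp.rep_eq Abs_cblinfun_inverse)
qed

lemma norm_capp_blinfun: "norm (capp T x) \<le> norm (blinfun_of_cblinfun T) * norm x"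
  by transfer (rule norm_blinfun)

instantiation cblinfun :: (complex_normed_vector, complex_normed_vector) complex_normed_vector
begin

lift_definition zero_cblinfun :: "('a, 'b) cblinfun" is 0 by simp

lift_definition plus_cblinfun :: "('a, 'b) cblinfun \<Rightarrow> ('a, 'b) cblinfun \<Rightarrow> ('a, 'b) cblinfun"
  is "(+)" by (simp add: blinfun.add_left scaleC_add_right)

lift_definition uminus_cblinfun :: "('a, 'b) cblinfun \<Rightarrow> ('a, 'b) cblinfun"
  is uminus by (simp add: blinfun.minus_left)

lift_definition minus_cblinfun :: "('a, 'b) cblinfun \<Rightarrow> ('a, 'b) cblinfun \<Rightarrow> ('a, 'b) cblinfun"
  is "(-)" by (simp add: blinfun.diff_left complex_vector.scale_right_diff_distrib)

lift_definition scaleR_cblinfun :: "real \<Rightarrow> ('a, 'b) cblinfun \<Rightarrow> ('a, 'b) cblinfun"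
  is scaleR by (simp add: blinfun.scaleR_left scaleR_scaleC scaleC_scaleC mult.commute)

definition scaleC_cblinfun :: "complex \<Rightarrow> ('a, 'b) cblinfun \<Rightarrow> ('a, 'b) cblinfun"
  where "scaleC_cblinfun c T = mk_cblinfun (\<lambda>x. c *\<^sub>C capp T x)"

lift_definition norm_cblinfun :: "('a, 'b) cblinfun \<Rightarrow> real" is norm .

definition dist_cblinfun :: "('a, 'b) cblinfun \<Rightarrow> ('a, 'b) cblinfun \<Rightarrow> real"
  where "dist_cblinfun S T = norm (S - T)"

definition sgn_cblinfun :: "('a, 'b) cblinfun \<Rightarrow> ('a, 'b) cblinfun"
  where "sgn_cblinfun T = inverse (norm T) *\<^sub>R T"

definition uniformity_cblinfun :: "(('a, 'b) cblinfun \<times> ('a, 'b) cblinfun) filter"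
  where "uniformity_cblinfun = (INF e\<in>{0<..}. principal {(S, T). dist S T < e})"

definition open_cblinfun :: "('a, 'b) cblinfun set \<Rightarrow> bool"
  where "open_cblinfun U \<longleftrightarrow> (\<forall>S\<in>U. \<forall>\<^sub>F (S', T) in uniformity. S' = S \<longrightarrow> T \<in> U)"

lemma capp_add: "capp (S + T) x = capp S x + capp T x"
  by transfer (simp add: blinfun.add_left)

lemma capp_scaleR: "capp (r *\<^sub>R T) x = r *\<^sub>R capp T x"
  by transfer (simp add: blinfun.scaleR_left)

lemma capp_diff: "capp (S - T) x = capp S x - capp T x"
  by transfer (simp add: blinfun.diff_left)

lemma capp_scaleC: "capp (c *\<^sub>C T) x = c *\<^sub>C capp T x"
proof -
  interpret Vector_Spaces.linear scaleC scaleC "capp T" by (rule capp_clinear)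
  have "clinear (\<lambda>x. c *\<^sub>C capp T x)"
    by (rule clinearI) (simp_all add: add scale scaleC_add_right scaleC_scaleC mult.commute)
  moreover have "norm (c *\<^sub>C capp T x) \<le> norm x * (cmod c * norm (blinfun_of_cblinfun T))" for x
    using mult_left_mono[OF norm_capp_blinfun[of T x], of "cmod c"]
    by (simp add: norm_scaleC mult_ac)
  ultimately show ?thesis
    unfolding scaleC_cblinfun_def by (subst capp_mk_cblinfun) blast+
qed

lemma norm_capp: "norm (capp T x) \<le> norm T * norm x"
  by transfer (rule norm_blinfun)

lemma norm_cblinfun_bound: "0 \<le> b \<Longrightarrow> (\<And>x. norm (capp T x) \<le> b * norm x) \<Longrightarrow> norm T \<le> b"
  by transfer (rule norm_blinfun_bound)

instance
proof
  fix S T R :: "('a, 'b) cblinfun" and r s :: real and c d :: complex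
    and U :: "('a, 'b) cblinfun set"
  show "S + T + R = S + (T + R)" "S + T = T + S" "0 + S = S" "- S + S = 0" "S - T = S + - T"
    "r *\<^sub>R (S + T) = r *\<^sub>R S + r *\<^sub>R T" "(r + s) *\<^sub>R S = r *\<^sub>R S + s *\<^sub>R S"
    "r *\<^sub>R s *\<^sub>R S = (r * s) *\<^sub>R S" "1 *\<^sub>R S = S"
    by (transfer; simp add: algebra_simps)+
  show "c *\<^sub>C (S + T) = c *\<^sub>C S + c *\<^sub>C T" "(c + d) *\<^sub>C S = c *\<^sub>C S + d *\<^sub>C S"
    "c *\<^sub>C d *\<^sub>C S = (c * d) *\<^sub>C S" "1 *\<^sub>C S = S" "r *\<^sub>R S = complex_of_real r *\<^sub>C S"
    by (rule cblinfun_eqI; simp add: capp_add capp_scaleC capp_scaleR scaleC_add_right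
        scaleC_add_left scaleC_scaleC scaleC_one scaleR_scaleC)+
  show "dist S T = norm (S - T)" "sgn S = inverse (norm S) *\<^sub>R S"
    "(uniformity :: (('a, 'b) cblinfun \<times> ('a, 'b) cblinfun) filter) =
      (INF e\<in>{0<..}. principal {(S, T). dist S T < e})"
    "open U \<longleftrightarrow> (\<forall>S\<in>U. \<forall>\<^sub>F (S', T) in uniformity. S' = S \<longrightarrow> T \<in> U)"
    by (fact dist_cblinfun_def sgn_cblinfun_def uniformity_cblinfun_def open_cblinfun_def)+
  show "(norm S = 0) = (S = 0)" "norm (r *\<^sub>R S) = \<bar>r\<bar> * norm S"
    by (transfer; simp)+
  show "norm (S + T) \<le> norm S + norm T"
    by transfer (rule norm_triangle_ineq)
  have le: "norm (c *\<^sub>C S) \<le> cmod c * norm S" for c and S :: "('a, 'b) cblinfun"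
  proof (rule norm_cblinfun_bound)
    show "0 \<le> cmod c * norm S" by (simp add: norm_cblinfun.rep_eq)
    show "norm (capp (c *\<^sub>C S) x) \<le> cmod c * norm S * norm x" for x
      by (simp add: capp_scaleC norm_scaleC mult.assoc mult_left_mono norm_capp)
  qed
  show "norm (c *\<^sub>C S) = cmod c * norm S"
  proof (cases "c = 0")
    case True
    have "norm (c *\<^sub>C S) = 0"
      using le[of c S] True by (simp add: norm_cblinfun.rep_eq)
    then show ?thesis using True by simp
  next
    case False
    have "S = inverse c *\<^sub>C c *\<^sub>C S"
      using False by (intro cblinfun_eqI) (simp add: capp_scaleC scaleC_scaleC scaleC_one)
    then have "norm S \<le> inverse (cmod c) * norm (c *\<^sub>C S)"
      using le[of "inverse c" "c *\<^sub>C S"] by (simp add: norm_inverse)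
    then have "cmod c * norm S \<le> norm (c *\<^sub>C S)"
      using False by (simp add: field_simps)
    with le[of c S] show ?thesis by simp
  qed
qed

end

instance cblinfun :: (complex_normed_vector, complex_banach) complex_banach
proof
  fix X :: "nat \<Rightarrow> ('a, 'b) cblinfun"
  assume X: "Cauchy X"
  let ?r = "blinfun_of_cblinfun :: ('a, 'b) cblinfun \<Rightarrow> _"
  have dist: "dist (?r S) (?r T) = dist S T" for S T
    by (simp add: dist_norm norm_cblinfun.rep_eq minus_cblinfun.rep_eq)
  have "Cauchy (\<lambda>n. ?r (X n))"
    using X by (simp add: Cauchy_def dist)
  then obtain L where L: "(\<lambda>n. ?r (X n)) \<longlonglongrightarrow> L"
    by (auto simp: Cauchy_convergent_iff convergent_def)
  have lim: "(\<lambda>n. blinfun_apply (?r (X n)) x) \<longlonglongrightarrow> blinfun_apply L x" for x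
    using L by (intro tendsto_intros)
  have "blinfun_apply L (c *\<^sub>C x) = c *\<^sub>C blinfun_apply L x" for c x
  proof -
    have "(\<lambda>n. c *\<^sub>C (blinfun_apply (?r (X n)) x)) \<longlonglongrightarrow> c *\<^sub>C blinfun_apply L x"
    proof -
      have bl: "bounded_linear (\<lambda>y::'b. c *\<^sub>C y)"
        by (rule bounded_linear_intro[where K = "cmod c"])
           (simp_all add: scaleC_add_right scaleR_scaleC scaleC_scaleC norm_scaleC mult.commute)
      show ?thesis by (rule bounded_linear.tendsto[OF bl lim])
    qed
    moreover have "(\<lambda>n. c *\<^sub>C (blinfun_apply (?r (X n)) x))
        = (\<lambda>n. blinfun_apply (?r (X n)) (c *\<^sub>C x))"
      using blinfun_of_cblinfun by (intro ext) (simp add: blinfun_of_cblinfun[simplified])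
    ultimately show ?thesis using lim[of "c *\<^sub>C x"] LIMSEQ_unique by metis
  qed
  then have "L = ?r (Abs_cblinfun L)"
    by (simp add: Abs_cblinfun_inverse)
  with L have "X \<longlonglongrightarrow> Abs_cblinfun L"
    by (simp add: tendsto_iff flip: dist)
  then show "convergent X" by (auto simp: convergent_def)
qed

section \<open>Spectral notions for a bounded operator\<close>

primrec cpower :: "('a::complex_normed_vector, 'a) cblinfun \<Rightarrow> nat \<Rightarrow> ('a, 'a) cblinfun"
  (infixr "^\<^sub>C" 80)
  where
    "T ^\<^sub>C 0 = cid"
  | "T ^\<^sub>C Suc n = T o\<^sub>C T ^\<^sub>C n"

definition null_space :: "('a::complex_normed_vector, 'b::complex_normed_vector) cblinfun \<Rightarrow> 'a set"
  where "null_space T = {x. capp T x = 0}"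

definition poly_op :: "complex poly \<Rightarrow> ('a::complex_normed_vector, 'a) cblinfun \<Rightarrow> ('a, 'a) cblinfun"
  where "poly_op P T = (\<Sum>i\<le>degree P. coeff P i *\<^sub>C T ^\<^sub>C i)"

definition algebraic_op :: "('a::complex_normed_vector, 'a) cblinfun \<Rightarrow> bool"
  where "algebraic_op T \<longleftrightarrow> (\<exists>P. degree P > 0 \<and> poly_op P T = 0)"

definition invertible_op :: "('a::complex_normed_vector, 'a) cblinfun \<Rightarrow> bool"
  where "invertible_op T \<longleftrightarrow> (\<exists>S. S o\<^sub>C T = cid \<and> T o\<^sub>C S = cid)"

definition drazin_invertible :: "('a::complex_normed_vector, 'a) cblinfun \<Rightarrow> bool"
  where "drazin_invertible T \<longleftrightarrow>
    (\<exists>S m. T ^\<^sub>C m = T ^\<^sub>C m o\<^sub>C S o\<^sub>C T \<and> S o\<^sub>C T o\<^sub>C S = S \<and> T o\<^sub>C S = S o\<^sub>C T)"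

definition spectrum :: "('a::complex_normed_vector, 'a) cblinfun \<Rightarrow> complex set"
  where "spectrum T = {c. \<not> invertible_op (T - c *\<^sub>C cid)}"

text \<open>For a subspace \<open>W\<close> of \<open>V\<close>: the cosets of the elements of \<open>C\<close> form a basis of the
  quotient of \<open>V\<close> by \<open>W\<close>. The quotient depends on sets and so is not available as a type.\<close>

definition quotient_has_dim :: "'a::complex_vector set \<Rightarrow> 'a set \<Rightarrow> nat \<Rightarrow> bool"
  where "quotient_has_dim V W n \<longleftrightarrow>
    (\<exists>C. finite C \<and> card C = n \<and> C \<subseteq> V \<and>
      (\<forall>u. (\<Sum>x\<in>C. u x *\<^sub>C x) \<in> W \<longrightarrow> (\<forall>x\<in>C. u x = 0)) \<and>
      (\<forall>v\<in>V. \<exists>u. v - (\<Sum>x\<in>C. u x *\<^sub>C x) \<in> W))"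

text \<open>For a subspace \<open>V\<close> that is invariant under \<open>T\<close>: the operator induced by \<open>T\<close> on \<open>V\<close>
  is Weyl.\<close>

definition weyl_on :: "('a::complex_normed_vector, 'a) cblinfun \<Rightarrow> 'a set \<Rightarrow> bool"
  where "weyl_on T V \<longleftrightarrow>
    fin_dim (V \<inter> null_space T) \<and>
    quotient_has_dim V (capp T ` V) (complex_vector.dim (V \<inter> null_space T))"

definition b_weyl :: "('a::complex_normed_vector, 'a) cblinfun \<Rightarrow> bool"
  where "b_weyl T \<longleftrightarrow>
    (\<exists>n. closed (range (capp (T ^\<^sub>C n))) \<and> weyl_on T (range (capp (T ^\<^sub>C n))))"

definition b_weyl_spectrum :: "('a::complex_normed_vector, 'a) cblinfun \<Rightarrow> complex set"
  where "b_weyl_spectrum T = {c. \<not> b_weyl (T - c *\<^sub>C cid)}"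

text \<open>The infimum of the empty set in \<^typ>\<open>enat\<close> is \<open>\<infinity>\<close>.\<close>

definition ascent :: "('a::complex_normed_vector, 'a) cblinfun \<Rightarrow> enat"
  where "ascent T = (INF n\<in>{n. null_space (T ^\<^sub>C n) = null_space (T ^\<^sub>C Suc n)}. enat n)"

definition descent :: "('a::complex_normed_vector, 'a) cblinfun \<Rightarrow> enat"
  where "descent T = (INF n\<in>{n. range (capp (T ^\<^sub>C n)) = range (capp (T ^\<^sub>C Suc n))}. enat n)"

definition poles :: "('a::complex_normed_vector, 'a) cblinfun \<Rightarrow> complex set"
  where "poles T =
    {c \<in> spectrum T. ascent (T - c *\<^sub>C cid) < \<infinity> \<and> descent (T - c *\<^sub>C cid) < \<infinity>}"

definition generalized_browder :: "('a::complex_normed_vector, 'a) cblinfun \<Rightarrow> bool"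
  where "generalized_browder T \<longleftrightarrow> b_weyl_spectrum T = spectrum T - poles T"

section \<open>The multiplication operator\<close>

definition mult_op ::
  "('a::complex_normed_vector, 'a) cblinfun \<Rightarrow> ('b::complex_normed_vector, 'b) cblinfun \<Rightarrow>
   (('b, 'a) cblinfun, ('b, 'a) cblinfun) cblinfun"
  where "mult_op A B = mk_cblinfun (\<lambda>U. A o\<^sub>C U o\<^sub>C B)"

lemma norm_ccompose: "norm (S o\<^sub>C T) \<le> norm S * norm T"
  by transfer (rule norm_blinfun_compose)

lemma capp_mult_op: "capp (mult_op A B) U = A o\<^sub>C U o\<^sub>C B"
proof -
  interpret Vector_Spaces.linear scaleC scaleC "capp A" by (rule capp_clinear)
  have "clinear (\<lambda>U. A o\<^sub>C U o\<^sub>C B)"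
    by (rule clinearI; rule cblinfun_eqI) (simp_all add: capp_add capp_scaleC add scale)
  moreover have "norm (A o\<^sub>C U o\<^sub>C B) \<le> norm U * (norm A * norm B)" for U
  proof -
    have "norm (A o\<^sub>C U o\<^sub>C B) \<le> norm A * norm U * norm B"
      by (rule order_trans[OF norm_ccompose mult_right_mono[OF norm_ccompose norm_ge_zero]])
    then show ?thesis by (simp add: mult_ac)
  qed
  ultimately show ?thesis
    unfolding mult_op_def by (subst capp_mk_cblinfun) blast+
qed

section \<open>Tensor products\<close>

text \<open>The algebraic tensor product, as the space of linear functionals on the vector space of all
  bilinear forms that is spanned by the evaluations \<open>x \<otimes> y\<close> at pairs \<open>(x, y)\<close>. (Scalar
  coefficients can be absorbed into the vectors.) Functionals are extended by 0 to functions
  that are not bilinear forms.\<close>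

definition cbilinear :: "('a::complex_vector \<Rightarrow> 'b::complex_vector \<Rightarrow> complex) \<Rightarrow> bool"
  where "cbilinear \<beta> \<longleftrightarrow> (\<forall>x. clinear (\<beta> x)) \<and> (\<forall>y. clinear (\<lambda>x. \<beta> x y))"

definition eval_forms ::
  "('a::complex_vector \<times> 'b::complex_vector) list \<Rightarrow> ('a \<Rightarrow> 'b \<Rightarrow> complex) \<Rightarrow> complex"
  where "eval_forms ps \<beta> = (if cbilinear \<beta> then \<Sum>(x, y)\<leftarrow>ps. \<beta> x y else 0)"

typedef (overloaded) ('a, 'b) atensor =
  "range (eval_forms :: ('a::complex_vector \<times> 'b::complex_vector) list \<Rightarrow> _)"
  morphisms tensor_eval Abs_atensor
  by blast

setup_lifting type_definition_atensor

lemma cbilinear_simps: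
  assumes "cbilinear \<beta>"
  shows "\<beta> (x + x') y = \<beta> x y + \<beta> x' y" "\<beta> x (y + y') = \<beta> x y + \<beta> x y'"
    "\<beta> (c *\<^sub>C x) y = c * \<beta> x y" "\<beta> x (c *\<^sub>C y) = c * \<beta> x y"
  using assms unfolding cbilinear_def Vector_Spaces.linear_iff scaleC_complex_def by blast+

lemma eval_forms_append: "eval_forms (ps @ qs) = (\<lambda>\<beta>. eval_forms ps \<beta> + eval_forms qs \<beta>)"
  by (auto simp: eval_forms_def fun_eq_iff)

lemma eval_forms_scale:
  "eval_forms (map (\<lambda>(x, y). (c *\<^sub>C x, y)) ps) = (\<lambda>\<beta>. c * eval_forms ps \<beta>)"
proof
  fix \<beta> :: "'a \<Rightarrow> 'b \<Rightarrow> complex"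
  show "eval_forms (map (\<lambda>(x, y). (c *\<^sub>C x, y)) ps) \<beta> = c * eval_forms ps \<beta>"
  proof (cases "cbilinear \<beta>")
    case True
    then show ?thesis
      by (induction ps) (auto simp: eval_forms_def cbilinear_simps distrib_left)
  qed (simp add: eval_forms_def)
qed

lemma scale_in_range_eval_forms:
  "(\<lambda>\<beta>. c * eval_forms ps \<beta>) \<in> range eval_forms"
  unfolding eval_forms_scale[symmetric] by (rule rangeI)

lemma plus_in_range_eval_forms:
  "(\<lambda>\<beta>. eval_forms ps \<beta> + eval_forms qs \<beta>) \<in> range eval_forms"
  unfolding eval_forms_append[symmetric] by (rule rangeI)

instantiation atensor :: (complex_vector, complex_vector) complex_vector
begin

lift_definition zero_atensor :: "('a, 'b) atensor" is "\<lambda>\<beta>. 0"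
  by (rule range_eqI[of _ _ "[]"]) (simp add: eval_forms_def fun_eq_iff)

lift_definition plus_atensor :: "('a, 'b) atensor \<Rightarrow> ('a, 'b) atensor \<Rightarrow> ('a, 'b) atensor"
  is "\<lambda>u v \<beta>. u \<beta> + v \<beta>"
  using plus_in_range_eval_forms by auto

lift_definition uminus_atensor :: "('a, 'b) atensor \<Rightarrow> ('a, 'b) atensor"
  is "\<lambda>u \<beta>. - u \<beta>"
  using scale_in_range_eval_forms[of "-1"] by auto

definition minus_atensor :: "('a, 'b) atensor \<Rightarrow> ('a, 'b) atensor \<Rightarrow> ('a, 'b) atensor"
  where "minus_atensor u v = u + - v"

lift_definition scaleC_atensor :: "complex \<Rightarrow> ('a, 'b) atensor \<Rightarrow> ('a, 'b) atensor"
  is "\<lambda>c u \<beta>. c * u \<beta>"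
  using scale_in_range_eval_forms by auto

definition scaleR_atensor :: "real \<Rightarrow> ('a, 'b) atensor \<Rightarrow> ('a, 'b) atensor"
  where "scaleR_atensor r u = complex_of_real r *\<^sub>C u"

instance
proof
  fix u v w :: "('a, 'b) atensor" and r s :: real and c d :: complex
  show "u + v + w = u + (v + w)" "u + v = v + u" "0 + u = u" "- u + u = 0"
    by (transfer; simp add: fun_eq_iff algebra_simps)+
  show "u - v = u + - v"
    by (fact minus_atensor_def)
  show "c *\<^sub>C (u + v) = c *\<^sub>C u + c *\<^sub>C v" "(c + d) *\<^sub>C u = c *\<^sub>C u + d *\<^sub>C u"
    "c *\<^sub>C d *\<^sub>C u = (c * d) *\<^sub>C u" "1 *\<^sub>C u = u"
    by (transfer; simp add: fun_eq_iff algebra_simps)+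
  show "r *\<^sub>R (u + v) = r *\<^sub>R u + r *\<^sub>R v" "(r + s) *\<^sub>R u = r *\<^sub>R u + s *\<^sub>R u"
    "r *\<^sub>R s *\<^sub>R u = (r * s) *\<^sub>R u" "1 *\<^sub>R u = u"
    unfolding scaleR_atensor_def by (transfer; simp add: fun_eq_iff algebra_simps)+
  show "r *\<^sub>R u = complex_of_real r *\<^sub>C u"
    by (fact scaleR_atensor_def)
qed

end

lift_definition pure_tensor :: "'a::complex_vector \<Rightarrow> 'b::complex_vector \<Rightarrow> ('a, 'b) atensor"
  (infixr "\<otimes>\<^sub>t" 70)
  is "\<lambda>x y. eval_forms [(x, y)]"
  by simp

lemma cbilinear_capp:
  assumes "cbilinear \<beta>"
  shows "cbilinear (\<lambda>x y. \<beta> (capp A x) (capp B y))"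
proof -
  interpret A: Vector_Spaces.linear scaleC scaleC "capp A" by (rule capp_clinear)
  interpret B: Vector_Spaces.linear scaleC scaleC "capp B" by (rule capp_clinear)
  show ?thesis
    unfolding cbilinear_def
    by (intro conjI allI clinearI)
      (simp_all add: A.add A.scale B.add B.scale cbilinear_simps[OF assms] scaleC_complex_def)
qed

lemma eval_forms_map_capp:
  "eval_forms (map (\<lambda>(x, y). (capp A x, capp B y)) ps) =
    (\<lambda>\<beta>. if cbilinear \<beta> then eval_forms ps (\<lambda>x y. \<beta> (capp A x) (capp B y)) else 0)"
  by (auto simp: eval_forms_def cbilinear_capp fun_eq_iff o_def case_prod_unfold)

text \<open>\<open>A \<otimes> B\<close> on the algebraic tensor product.\<close>

lift_definition tensor_map ::
  "('a::complex_normed_vector, 'a) cblinfun \<Rightarrow> ('b::complex_normed_vector, 'b) cblinfun \<Rightarrow>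
   ('a, 'b) atensor \<Rightarrow> ('a, 'b) atensor"
  is "\<lambda>A B u \<beta>. if cbilinear \<beta> then u (\<lambda>x y. \<beta> (capp A x) (capp B y)) else 0"
proof -
  fix A :: "('a, 'a) cblinfun" and B :: "('b, 'b) cblinfun"
    and u :: "('a \<Rightarrow> 'b \<Rightarrow> complex) \<Rightarrow> complex"
  assume "u \<in> range eval_forms"
  then obtain ps where "u = eval_forms ps" by blast
  then show "(\<lambda>\<beta>. if cbilinear \<beta> then u (\<lambda>x y. \<beta> (capp A x) (capp B y)) else 0)
      \<in> range eval_forms"
    by (simp only: eval_forms_map_capp[symmetric] rangeI)
qed

lemma tensor_map_pure: "tensor_map A B (x \<otimes>\<^sub>t y) = capp A x \<otimes>\<^sub>t capp B y"
proof -
  have "tensor_eval (tensor_map A B (x \<otimes>\<^sub>t y)) = tensor_eval (capp A x \<otimes>\<^sub>t capp B y)"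
    unfolding tensor_map.rep_eq pure_tensor.rep_eq
    using eval_forms_map_capp[of A B "[(x, y)]"] by simp
  then show ?thesis by (simp add: tensor_eval_inject)
qed

lemma tensor_map_clinear: "clinear (tensor_map A B)"
  by (rule clinearI; unfold tensor_eval_inject[symmetric] tensor_map.rep_eq plus_atensor.rep_eq
      scaleC_atensor.rep_eq) (simp_all add: fun_eq_iff)

text \<open>The functional \<open>\<phi> \<otimes> \<psi>\<close> with \<open>(\<phi> \<otimes> \<psi>) (x \<otimes> y) = \<phi> x * \<psi> y\<close>.\<close>

definition tensor_functional ::
  "('a::complex_normed_vector, complex) cblinfun \<Rightarrow> ('b::complex_normed_vector, complex) cblinfun \<Rightarrow>
   ('a, 'b) atensor \<Rightarrow> complex"
  where "tensor_functional \<phi> \<psi> u = tensor_eval u (\<lambda>x y. capp \<phi> x * capp \<psi> y)"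

lemma tensor_functional_pure: "tensor_functional \<phi> \<psi> (x \<otimes>\<^sub>t y) = capp \<phi> x * capp \<psi> y"
proof -
  interpret F: Vector_Spaces.linear scaleC scaleC "capp \<phi>" by (rule capp_clinear)
  interpret G: Vector_Spaces.linear scaleC scaleC "capp \<psi>" by (rule capp_clinear)
  have "cbilinear (\<lambda>x y. capp \<phi> x * capp \<psi> y)"
    unfolding cbilinear_def
    by (intro conjI allI clinearI)
      (simp_all add: F.add F.scale G.add G.scale scaleC_complex_def algebra_simps)
  then show ?thesis
    by (simp add: tensor_functional_def pure_tensor.rep_eq eval_forms_def)
qed

text \<open>The first three conditions say that \<open>\<alpha>\<close> is a norm; then follow the cross-norm
  property, reasonableness, and uniformity on the given pair of spaces.\<close>

definition reasonable_uniform_crossnorm ::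
  "(('a::complex_normed_vector, 'b::complex_normed_vector) atensor \<Rightarrow> real) \<Rightarrow> bool"
  where "reasonable_uniform_crossnorm \<alpha> \<longleftrightarrow>
    (\<forall>u. \<alpha> u = 0 \<longleftrightarrow> u = 0) \<and>
    (\<forall>u v. \<alpha> (u + v) \<le> \<alpha> u + \<alpha> v) \<and>
    (\<forall>c u. \<alpha> (c *\<^sub>C u) = cmod c * \<alpha> u) \<and>
    (\<forall>x y. \<alpha> (x \<otimes>\<^sub>t y) = norm x * norm y) \<and>
    (\<forall>\<phi> \<psi> u. cmod (tensor_functional \<phi> \<psi> u) \<le> norm \<phi> * norm \<psi> * \<alpha> u) \<and>
    (\<forall>A B u. \<alpha> (tensor_map A B u) \<le> norm A * norm B * \<alpha> u)"

text \<open>The Banach space \<^typ>\<open>'c\<close>, with the embedding \<open>\<iota>\<close>, is the completion of the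
  algebraic tensor product with respect to \<open>\<alpha>\<close>.\<close>

definition tensor_completion ::
  "(('a::complex_vector, 'b::complex_vector) atensor \<Rightarrow> real) \<Rightarrow>
   (('a, 'b) atensor \<Rightarrow> 'c::complex_banach) \<Rightarrow> bool"
  where "tensor_completion \<alpha> \<iota> \<longleftrightarrow>
    clinear \<iota> \<and> (\<forall>u. norm (\<iota> u) = \<alpha> u) \<and> closure (range \<iota>) = UNIV"

text \<open>The bounded extension of \<open>A \<otimes> B\<close> to the completion.\<close>

definition tensor_op ::
  "(('a::complex_normed_vector, 'b::complex_normed_vector) atensor \<Rightarrow> 'c::complex_banach) \<Rightarrow>
   ('a, 'a) cblinfun \<Rightarrow> ('b, 'b) cblinfun \<Rightarrow> ('c, 'c) cblinfun"
  where "tensor_op \<iota> A B = (THE T. \<forall>u. capp T (\<iota> u) = \<iota> (tensor_map A B u))"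

lemma continuous_on_capp: "continuous_on UNIV (capp T)"
  by transfer (intro continuous_intros)

lemma tensor_op_ex1:
  assumes \<alpha>: "reasonable_uniform_crossnorm \<alpha>" and \<iota>: "tensor_completion \<alpha> \<iota>"
  shows "\<exists>!T. \<forall>u. capp T (\<iota> u) = \<iota> (tensor_map A B u)"
proof -
  interpret \<iota>: Vector_Spaces.linear scaleC scaleC \<iota>
    using \<iota> by (simp add: tensor_completion_def)
  interpret M: Vector_Spaces.linear scaleC scaleC "tensor_map A B"
    by (rule tensor_map_clinear)
  have norm_\<iota>: "norm (\<iota> u) = \<alpha> u" and dense: "closure (range \<iota>) = UNIV" for u
    using \<iota> by (simp_all add: tensor_completion_def)
  have unif: "\<alpha> (tensor_map A B u) \<le> norm A * norm B * \<alpha> u" for u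
    using \<alpha> by (simp add: reasonable_uniform_crossnorm_def)
  have inj: "inj \<iota>"
  proof (rule injI)
    fix u v assume "\<iota> u = \<iota> v"
    then have "\<alpha> (u - v) = 0" by (simp flip: norm_\<iota> add: \<iota>.diff)
    then show "u = v" using \<alpha> by (simp add: reasonable_uniform_crossnorm_def)
  qed
  define f where "f z = \<iota> (tensor_map A B (inv \<iota> z))" for z
  have f_\<iota>: "f (\<iota> u) = \<iota> (tensor_map A B u)" for u
    by (simp add: f_def inv_f_f[OF inj])
  have "(norm A * norm B)-lipschitz_on (range \<iota>) f"
  proof (rule lipschitz_onI)
    fix z w assume "z \<in> range \<iota>" "w \<in> range \<iota>"
    then obtain u v where uv: "z = \<iota> u" "w = \<iota> v" by blast
    have "dist (f z) (f w) = \<alpha> (tensor_map A B (u - v))"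
      by (simp add: uv f_\<iota> dist_norm M.diff \<iota>.diff flip: norm_\<iota>)
    also have "\<dots> \<le> norm A * norm B * dist z w"
      using unif[of "u - v"] by (simp add: uv dist_norm \<iota>.diff flip: norm_\<iota>)
    finally show "dist (f z) (f w) \<le> norm A * norm B * dist z w" .
  qed simp
  then obtain g where lip: "(norm A * norm B)-lipschitz_on UNIV g"
    and g_\<iota>: "\<And>u. g (\<iota> u) = \<iota> (tensor_map A B u)"
    using lipschitz_extend_closure[of _ "range \<iota>" f] by (auto simp: dense f_\<iota>)
  have cont_UNIV: "continuous_on UNIV g" by (rule lipschitz_on_continuous_on[OF lip])
  have cont: "continuous_on UNIV (\<lambda>z. g (h z))" if "continuous_on UNIV h"
    for h :: "'c \<Rightarrow> 'c"
    using continuous_on_compose2[OF cont_UNIV that] by simp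
  have scaleC_cont: "continuous_on UNIV (\<lambda>z. c *\<^sub>C h z)" if "continuous_on UNIV h"
    for c and h :: "'c \<Rightarrow> 'c"
  proof -
    have "bounded_linear (\<lambda>z::'c. c *\<^sub>C z)"
      by (rule bounded_linear_intro[where K = "cmod c"])
        (simp_all add: scaleC_add_right scaleR_scaleC scaleC_scaleC norm_scaleC mult.commute)
    then show ?thesis by (rule bounded_linear.continuous_on) (rule that)
  qed
  have dense_eq: "p z = q z"
    if "continuous_on UNIV p" "continuous_on UNIV q" "\<And>u. p (\<iota> u) = q (\<iota> u)"
    for p q :: "'c \<Rightarrow> 'c" and z
  proof -
    have "closed {z. p z = q z}" by (rule closed_Collect_eq) fact+
    then have "closure (range \<iota>) \<subseteq> {z. p z = q z}"
      by (rule closure_minimal[rotated]) (auto simp: that(3))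
    then show ?thesis by (auto simp: dense)
  qed
  have add1: "g (\<iota> u + w) = g (\<iota> u) + g w" for u w
  proof (rule dense_eq[of "\<lambda>w. g (\<iota> u + w)" "\<lambda>w. g (\<iota> u) + g w"])
    show "continuous_on UNIV (\<lambda>w. g (\<iota> u + w))" "continuous_on UNIV (\<lambda>w. g (\<iota> u) + g w)"
      by (intro cont cont_UNIV continuous_intros)+
    show "g (\<iota> u + \<iota> v) = g (\<iota> u) + g (\<iota> v)" for v
      using g_\<iota>[of "u + v"] by (simp add: g_\<iota> M.add \<iota>.add)
  qed
  have add: "g (z + w) = g z + g w" for z w
  proof (rule dense_eq[of "\<lambda>z. g (z + w)" "\<lambda>z. g z + g w"])
    show "continuous_on UNIV (\<lambda>z. g (z + w))" "continuous_on UNIV (\<lambda>z. g z + g w)"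
      by (intro cont cont_UNIV continuous_intros)+
  qed (rule add1)
  have scale: "g (c *\<^sub>C z) = c *\<^sub>C g z" for c z
  proof (rule dense_eq[of "\<lambda>z. g (c *\<^sub>C z)" "\<lambda>z. c *\<^sub>C g z"])
    show "continuous_on UNIV (\<lambda>z. g (c *\<^sub>C z))" "continuous_on UNIV (\<lambda>z. c *\<^sub>C g z)"
      by (intro cont cont_UNIV scaleC_cont continuous_on_id)+
    show "g (c *\<^sub>C \<iota> v) = c *\<^sub>C g (\<iota> v)" for v
      using g_\<iota>[of "c *\<^sub>C v"] by (simp add: g_\<iota> M.scale \<iota>.scale)
  qed
  have "g 0 = 0" using add[of 0 0] by simp
  then have "norm (g z) \<le> norm z * (norm A * norm B)" for z
    using lipschitz_onD[OF lip, of z 0] by (simp add: mult.commute)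
  then have capp_g: "capp (mk_cblinfun g) = g"
    by (intro capp_mk_cblinfun clinearI add scale)
  show ?thesis
  proof (rule ex1I)
    show "\<forall>u. capp (mk_cblinfun g) (\<iota> u) = \<iota> (tensor_map A B u)"
      by (simp add: capp_g g_\<iota>)
  next
    fix T assume T: "\<forall>u. capp T (\<iota> u) = \<iota> (tensor_map A B u)"
    have "capp T z = g z" for z
      by (rule dense_eq[OF continuous_on_capp cont_UNIV]) (simp add: T g_\<iota>)
    then show "T = mk_cblinfun g"
      by (intro cblinfun_eqI) (simp add: capp_g)
  qed
qed

lemma capp_tensor_op:
  assumes "reasonable_uniform_crossnorm \<alpha>" and "tensor_completion \<alpha> \<iota>"
  shows "capp (tensor_op \<iota> A B) (\<iota> (x \<otimes>\<^sub>t y)) = \<iota> (capp A x \<otimes>\<^sub>t capp B y)"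
  using theI'[OF tensor_op_ex1[OF assms, of A B]]
  by (simp add: tensor_op_def tensor_map_pure)

end

theory Submission
  imports Defs "HOL-Complex_Analysis.Complex_Analysis"
begin

text \<open>For an operator \<open>V\<close>, finite ascent and descent, Drazin invertibility, and the pair of
  bounds \<open>\<parallel>V\<^sup>mx\<parallel> \<le> C \<parallel>V\<^sup>m\<^sup>+\<^sup>1x\<parallel>\<close> for \<open>V\<close> and for its adjoint are equivalent. Since \<open>A\<close> and \<open>B\<close>
  satisfy the generalized Browder's theorem, everything reduces to computing \<open>\<sigma>(T)\<close> and \<open>\<Pi>(T)\<close>
  for \<open>T = A \<otimes> B\<close> and \<open>T = \<tau>\<^sub>A\<^sub>B\<close>: one has \<open>\<sigma>(T) = \<sigma>(A)\<sigma>(B)\<close>, a point \<open>c \<noteq> 0\<close> of \<open>\<sigma>(T)\<close> is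
  a pole iff all its factorizations in \<open>\<sigma>(A)\<sigma>(B)\<close> consist of poles, and \<open>T\<close> is Drazin
  invertible iff \<open>A\<close> and \<open>B\<close> are.

  Upper estimates come from \<open>T\<close> being a product of two commuting operators: in a commutative
  algebra containing them, a proper ideal can be enlarged by some \<open>a - \<alpha>\<close> (by Liouville's theorem),
  and suitable ideals give the inclusion of spectra, the Drazin invertibility of \<open>T - c\<close>, and a
  spectral value that is not a pole for each non-algebraic operator. Lower estimates come from
  testing \<open>T - ab\<close> and its adjoint on elementary tensors \<open>x \<otimes> y\<close> with \<open>y\<close> an approximate
  eigenvector of \<open>B\<close> for \<open>b\<close>; these exist, for \<open>B\<close> and its adjoint, at boundary points of the
  spectrum.\<close>

section \<open>The Hahn-Banach theorem\<close>

text \<open>The point 0 is special because it factors as \<open>0 * b\<close> with \<open>b\<close>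
  arbitrary. A non-algebraic operator has a spectral value that is not a pole, so 0 lies in
  \<open>S\<close> as soon as it lies in the spectrum of the product, even when 0 is a pole of the
  product. At nonzero points \<open>S\<close> and the B-Weyl spectrum agree, so the two sets can
  differ only by 0, and they do so exactly when 0 is a pole. The lower estimates need approximate
  eigenvectors of one factor and of its adjoint at the same value; in the interior of the spectrum
  one of the two may be missing. A nonzero pole is isolated, which keeps the entries of its
  factorizations out of the interiors. Norm inequalities are used instead of kernels and ranges
  because they survive the limit along approximate eigenvectors; the adjoint turns statements about
  ranges into such inequalities.\<close>

definition sublinear :: "('a::real_vector \<Rightarrow> real) \<Rightarrow> bool"
  where "sublinear p \<longleftrightarrow>
    (\<forall>x y. p (x + y) \<le> p x + p y) \<and> (\<forall>r>0. \<forall>x. p (r *\<^sub>R x) = r * p x)"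

lemma sublinear_add: "sublinear p \<Longrightarrow> p (x + y) \<le> p x + p y"
  and sublinear_scale: "sublinear p \<Longrightarrow> 0 < r \<Longrightarrow> p (r *\<^sub>R x) = r * p x"
  by (simp_all add: sublinear_def)

lemma sublinear_zero: "sublinear p \<Longrightarrow> p 0 = 0"
  using sublinear_scale[of p 2 0] by simp

lemma sublinear_scale_nonneg: "sublinear p \<Longrightarrow> 0 \<le> r \<Longrightarrow> p (r *\<^sub>R x) = r * p x"
  by (cases "r = 0") (auto simp: sublinear_zero sublinear_scale)

lemma sublinear_ge: "sublinear p \<Longrightarrow> - p (- x) \<le> p x"
  using sublinear_add[of p x "- x"] by (simp add: sublinear_zero)

text \<open>Applying the inequality to \<open>inverse r\<close> gives the reverse one, so scaling is
  checked in one direction only.\<close>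

lemma sublinear_scaleI:
  fixes p :: "'a::real_vector \<Rightarrow> real"
  assumes "\<And>r x. 0 < r \<Longrightarrow> r * p x \<le> p (r *\<^sub>R x)" and "0 < r"
  shows "p (r *\<^sub>R x) = r * p x"
proof (rule antisym)
  have "inverse r * p (r *\<^sub>R x) \<le> p x"
    using assms(1)[of "inverse r" "r *\<^sub>R x"] assms(2) by simp
  then show "p (r *\<^sub>R x) \<le> r * p x"
    using assms(2) by (simp add: field_simps)
qed (use assms in blast)

text \<open>Lowers \<open>q\<close> in the direction \<open>y\<close>. The third property makes a
  minimal \<open>q\<close> additive, and at \<open>x = - y\<close> it forces every linear functional
  below \<open>q'\<close> to be at least \<open>q y\<close> at \<open>y\<close>.\<close>

lemma sublinear_descent:
  assumes q: "sublinear q"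
  obtains q' where "sublinear q'" "\<And>x. q' x \<le> q x" "\<And>x. q' x \<le> q (x + y) - q y"
proof -
  define S where "S x = (\<lambda>t. q (x + t *\<^sub>R y) - t * q y) ` {0..}" for x
  define q' where "q' x = Inf (S x)" for x
  have lower: "- q (- x) \<le> q (x + t *\<^sub>R y) - t * q y" if "0 \<le> t" for x t
    using sublinear_add[OF q, of "x + t *\<^sub>R y" "- x"] sublinear_scale_nonneg[OF q that, of y]
    by simp
  have bdd: "bdd_below (S x)" for x
    unfolding S_def bdd_below_def using lower by blast
  have le: "q' x \<le> q (x + t *\<^sub>R y) - t * q y" if "0 \<le> t" for x t
    unfolding q'_def by (rule cInf_lower[OF _ bdd]) (use that in \<open>auto simp: S_def\<close>)
  have ge: "c \<le> q' x" if "\<And>t. 0 \<le> t \<Longrightarrow> c \<le> q (x + t *\<^sub>R y) - t * q y" for c x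
    unfolding q'_def by (rule cInf_greatest) (use that in \<open>auto simp: S_def\<close>)
  have add: "q' (x + x') \<le> q' x + q' x'" for x x'
  proof -
    have "q' (x + x') - (q (x' + s *\<^sub>R y) - s * q y) \<le> q' x" if s: "0 \<le> s" for s
    proof (rule ge)
      fix t :: real assume t: "0 \<le> t"
      have "q' (x + x') \<le> q ((x + x') + (t + s) *\<^sub>R y) - (t + s) * q y"
        using s t by (intro le) simp
      also have "(x + x') + (t + s) *\<^sub>R y = (x + t *\<^sub>R y) + (x' + s *\<^sub>R y)"
        by (simp add: algebra_simps)
      also have "q \<dots> - (t + s) * q y
          \<le> (q (x + t *\<^sub>R y) - t * q y) + (q (x' + s *\<^sub>R y) - s * q y)"
        using sublinear_add[OF q, of "x + t *\<^sub>R y" "x' + s *\<^sub>R y"] by (simp add: algebra_simps)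
      finally show "q' (x + x') - (q (x' + s *\<^sub>R y) - s * q y) \<le> q (x + t *\<^sub>R y) - t * q y"
        by simp
    qed
    then have "q' (x + x') - q' x \<le> q' x'"
      by (intro ge) (simp add: algebra_simps)
    then show ?thesis by simp
  qed
  have "r * q' x \<le> q' (r *\<^sub>R x)" if r: "0 < r" for r x
  proof (rule ge)
    fix t :: real assume t: "0 \<le> t"
    have "q' x \<le> q (x + (t / r) *\<^sub>R y) - (t / r) * q y"
      using r t by (intro le) simp
    then have "r * q' x \<le> r * q (x + (t / r) *\<^sub>R y) - t * q y"
      using r by (simp add: field_simps)
    also have "r * q (x + (t / r) *\<^sub>R y) = q (r *\<^sub>R x + t *\<^sub>R y)"
      using r by (simp add: sublinear_scale[OF q r, symmetric] scaleR_add_right)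
    finally show "r * q' x \<le> q (r *\<^sub>R x + t *\<^sub>R y) - t * q y" .
  qed
  then have "q' (r *\<^sub>R x) = r * q' x" if "0 < r" for r x
    using that by (rule sublinear_scaleI)
  with add have "sublinear q'"
    by (auto simp: sublinear_def)
  then show ?thesis
    using le[of 0] le[of 1] by (intro that[of q']) auto
qed

text \<open>The pointwise infimum works: \<open>- p (- x)\<close> bounds it from below, and two
  members of a chain have a common lower member, so infima taken separately at \<open>x\<close> and
  \<open>y\<close> can be combined for subadditivity.\<close>

lemma sublinear_chain_lower_bound:
  assumes C: "C \<noteq> {}" "\<And>q. q \<in> C \<Longrightarrow> sublinear q" "\<And>q x. q \<in> C \<Longrightarrow> q x \<le> p x"
    and chain: "\<And>q q'. q \<in> C \<Longrightarrow> q' \<in> C \<Longrightarrow> q \<le> q' \<or> q' \<le> q"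
  obtains u where "sublinear u" "\<And>q. q \<in> C \<Longrightarrow> u \<le> q"
proof -
  define u where "u x = (INF q\<in>C. q x)" for x
  have lower: "- p (- x) \<le> q x" if "q \<in> C" for q x
    using sublinear_ge[OF C(2)[OF that], of x] C(3)[OF that, of "- x"] by simp
  have bdd: "bdd_below ((\<lambda>q. q x) ` C)" for x
    unfolding bdd_below_def using lower by blast
  have le: "u x \<le> q x" if "q \<in> C" for q x
    unfolding u_def by (rule cINF_lower[OF bdd that])
  have ge: "c \<le> u x" if "\<And>q. q \<in> C \<Longrightarrow> c \<le> q x" for c x
    unfolding u_def by (rule cINF_greatest[OF C(1) that])
  have add: "u (x + y) \<le> u x + u y" for x y
  proof -
    have "u (x + y) - q x \<le> u y" if q: "q \<in> C" for q
    proof (rule ge)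
      fix q' assume q': "q' \<in> C"
      obtain r where r: "r \<in> C" "r \<le> q" "r \<le> q'"
        using chain[OF q q'] q q' by auto
      have "u (x + y) \<le> r x + r y"
        using le[OF r(1), of "x + y"] sublinear_add[OF C(2)[OF r(1)], of x y] by simp
      also have "\<dots> \<le> q x + q' y"
        using r by (intro add_mono) (auto simp: le_fun_def)
      finally show "u (x + y) - q x \<le> q' y" by simp
    qed
    then have "u (x + y) - u y \<le> u x"
      by (intro ge) (simp add: algebra_simps)
    then show ?thesis by simp
  qed
  have "r * u x \<le> u (r *\<^sub>R x)" if r: "0 < r" for r x
    using le r by (intro ge) (simp add: sublinear_scale[OF C(2) r])
  then have "u (r *\<^sub>R x) = r * u x" if "0 < r" for r x
    using that by (rule sublinear_scaleI)
  with add have "sublinear u"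
    by (auto simp: sublinear_def)
  then show ?thesis
    using le by (intro that[of u]) (auto simp: le_fun_def)
qed

text \<open>A sublinear functional that is minimal is linear; minimal ones exist by Zorn's lemma.\<close>

lemma exists_linear_below_sublinear:
  assumes p: "sublinear p"
  obtains f where "linear f" "\<And>x. f x \<le> p x"
proof -
  let ?A = "{q. sublinear q \<and> q \<le> p}"
  have "\<exists>m\<in>?A. \<forall>a\<in>?A. a \<le> m \<longrightarrow> a = m"
  proof (rule predicate_Zorn)
    show "partial_order_on ?A (relation_of (\<lambda>x y. y \<le> x) ?A)"
      by (rule partial_order_on_relation_ofI) auto
    fix C assume C: "C \<in> Chains (relation_of (\<lambda>x y. y \<le> x) ?A)"
    then have CA: "C \<subseteq> ?A" and chain: "\<And>q q'. q \<in> C \<Longrightarrow> q' \<in> C \<Longrightarrow> q \<le> q' \<or> q' \<le> q"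
      by (auto simp: Chains_def relation_of_def)
    show "\<exists>u\<in>?A. \<forall>a\<in>C. u \<le> a"
    proof (cases "C = {}")
      case True
      then show ?thesis using p by auto
    next
      case False
      then obtain u where u: "sublinear u" "\<And>q. q \<in> C \<Longrightarrow> u \<le> q"
        using CA chain by (elim sublinear_chain_lower_bound[of C p]) (auto simp: le_fun_def)
      with False CA have "u \<le> p"
        using order_trans by blast
      with u show ?thesis by auto
    qed
  qed
  then obtain q where q: "sublinear q" "q \<le> p"
    and minimal: "\<And>q'. sublinear q' \<Longrightarrow> q' \<le> q \<Longrightarrow> q' = q"
    by (smt (verit, best) mem_Collect_eq order_trans)
  have add: "q (x + y) = q x + q y" for x y
  proof (rule antisym)
    obtain q' where q': "sublinear q'" "\<And>x. q' x \<le> q x" "\<And>x. q' x \<le> q (x + y) - q y"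
      using sublinear_descent[OF q(1), of y] by blast
    have "q' = q" by (rule minimal) (use q' in \<open>auto simp: le_fun_def\<close>)
    then show "q x + q y \<le> q (x + y)" using q'(3)[of x] by simp
  qed (rule sublinear_add[OF q(1)])
  have neg: "q (- x) = - q x" for x
    using add[of x "- x"] sublinear_zero[OF q(1)] by simp
  have "q (r *\<^sub>R x) = r *\<^sub>R q x" for r x
  proof (cases "0 \<le> r")
    case True
    then show ?thesis by (simp add: sublinear_scale_nonneg[OF q(1)])
  next
    case False
    then have "q ((- r) *\<^sub>R x) = (- r) * q x"
      by (intro sublinear_scale_nonneg[OF q(1)]) simp
    then show ?thesis by (simp add: neg)
  qed
  then have "linear q" by (intro linearI add)
  then show ?thesis using q by (intro that[of q]) (auto simp: le_fun_def)
qed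

section \<open>Functionals that separate a vector from a subspace\<close>

lemma capp_zero [simp]: "capp T 0 = 0"
  and capp_add_right: "capp T (x + y) = capp T x + capp T y"
  and capp_diff_right: "capp T (x - y) = capp T x - capp T y"
  and capp_minus_right: "capp T (- x) = - capp T x"
  and capp_scaleC_right: "capp T (c *\<^sub>C x) = c *\<^sub>C capp T x"
proof -
  interpret Vector_Spaces.linear scaleC scaleC "capp T" by (rule capp_clinear)
  show "capp T 0 = 0" "capp T (x + y) = capp T x + capp T y" "capp T (x - y) = capp T x - capp T y"
    "capp T (- x) = - capp T x" "capp T (c *\<^sub>C x) = c *\<^sub>C capp T x"
    by (rule zero add diff neg scale)+
qed

lemma capp_zero_left [simp]: "capp 0 x = 0"
  by transfer simp

lemma capp_minus_left: "capp (- T) x = - capp T x"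
  by transfer (simp add: blinfun.minus_left)

text \<open>Here \<open>p\<close> is the distance to \<open>J\<close>, so a functional dominated by
  \<open>p\<close> vanishes on \<open>J\<close> and has norm at most 1. A real-linear one with value
  at least \<open>d\<close> at \<open>x\<^sub>0\<close> is made complex and divided by its value
  there, which accounts for \<open>1 / d\<close>.\<close>

theorem hahn_banach_separation:
  fixes x\<^sub>0 :: "'a::complex_normed_vector"
  assumes J: "complex_vector.subspace J" and "0 < d" and d: "\<And>y. y \<in> J \<Longrightarrow> d \<le> norm (x\<^sub>0 - y)"
  obtains \<phi> :: "('a, complex) cblinfun"
  where "\<And>y. y \<in> J \<Longrightarrow> capp \<phi> y = 0" "capp \<phi> x\<^sub>0 = 1" "norm \<phi> \<le> 1 / d"
proof -
  have J0: "0 \<in> J" using J by (rule complex_vector.subspace_0)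
  define p where "p x = (INF y\<in>J. norm (x - y))" for x
  have le: "p x \<le> norm (x - y)" if "y \<in> J" for x y
    unfolding p_def by (rule cINF_lower[OF _ that]) (auto intro: bdd_belowI[of _ 0])
  have ge: "c \<le> p x" if "\<And>y. y \<in> J \<Longrightarrow> c \<le> norm (x - y)" for c x
    unfolding p_def by (rule cINF_greatest) (use that J0 in auto)
  have add: "p (x + x') \<le> p x + p x'" for x x'
  proof -
    have "p (x + x') - norm (x' - y') \<le> p x" if y': "y' \<in> J" for y'
    proof (rule ge)
      fix y assume y: "y \<in> J"
      have "p (x + x') \<le> norm ((x + x') - (y + y'))"
        by (intro le complex_vector.subspace_add[OF J] y y')
      also have "\<dots> \<le> norm (x - y) + norm (x' - y')"
        using norm_triangle_ineq[of "x - y" "x' - y'"] by (simp add: algebra_simps)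
      finally show "p (x + x') - norm (x' - y') \<le> norm (x - y)" by simp
    qed
    then have "p (x + x') - p x \<le> p x'"
      by (intro ge) (simp add: algebra_simps)
    then show ?thesis by simp
  qed
  have scale_ge: "cmod c * p x \<le> p (c *\<^sub>C x)" if "c \<noteq> 0" for c x
  proof (rule ge)
    fix y assume "y \<in> J"
    then have "inverse c *\<^sub>C y \<in> J" by (rule complex_vector.subspace_scale[OF J])
    then have "cmod c * p x \<le> cmod c * norm (x - inverse c *\<^sub>C y)"
      by (intro mult_left_mono le) auto
    also have "\<dots> = norm (c *\<^sub>C x - y)"
      using that by (simp add: norm_scaleC[symmetric] complex_vector.scale_right_diff_distrib)
    finally show "cmod c * p x \<le> norm (c *\<^sub>C x - y)" .
  qed
  have rot: "p (c *\<^sub>C x) \<le> p x" if c: "cmod c = 1" for c x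
  proof -
    have "c \<noteq> 0" using c by auto
    then show ?thesis
      using scale_ge[of "inverse c" "c *\<^sub>C x"] c by (simp add: norm_inverse)
  qed
  have "sublinear p"
    unfolding sublinear_def
  proof (intro conjI allI impI)
    fix r :: real and x :: 'a assume "0 < r"
    show "p (r *\<^sub>R x) = r * p x"
    proof (rule sublinear_scaleI[OF _ \<open>0 < r\<close>])
      fix s :: real and z :: 'a assume "0 < s"
      then show "s * p z \<le> p (s *\<^sub>R z)"
        using scale_ge[of "complex_of_real s" z] by (simp add: scaleR_scaleC)
    qed
  qed (rule add)
  \<comment> \<open>Lowering \<open>p\<close> in the direction \<open>x\<^sub>0\<close> before
    choosing \<open>f\<close> ensures that \<open>f x\<^sub>0\<close> is at least
    \<open>p x\<^sub>0\<close>.\<close>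
  then obtain q where q: "sublinear q" "\<And>x. q x \<le> p x" "\<And>x. q x \<le> p (x + x\<^sub>0) - p x\<^sub>0"
    using sublinear_descent[of p x\<^sub>0] by blast
  obtain f where f: "linear f" "\<And>x. f x \<le> q x"
    using exists_linear_below_sublinear[OF q(1)] by blast
  interpret f: linear f by fact
  have fp: "f x \<le> p x" for x
    using f(2)[of x] q(2)[of x] by simp
  have "p 0 \<le> 0" using le[of 0 0] J0 by simp
  then have "f (- x\<^sub>0) \<le> - p x\<^sub>0"
    using f(2)[of "- x\<^sub>0"] q(3)[of "- x\<^sub>0"] by simp
  moreover have "d \<le> p x\<^sub>0" by (rule ge) (rule d)
  ultimately have fx0: "d \<le> f x\<^sub>0" by (simp add: f.neg)
  \<comment> \<open>The complex-linear functional whose real part is \<open>f\<close>.\<close>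
  define \<psi> where "\<psi> x = Complex (f x) (- f (\<i> *\<^sub>C x))" for x
  have psi_add: "\<psi> (x + y) = \<psi> x + \<psi> y" for x y
    by (simp add: \<psi>_def scaleC_add_right f.add complex_eq_iff)
  have fre: "f (complex_of_real r *\<^sub>C x) = r * f x" for r x
    using f.scale[of r x] by (simp add: scaleR_scaleC)
  have psi_i: "\<psi> (\<i> *\<^sub>C x) = \<i> * \<psi> x" for x
    using f.neg[of x] by (simp add: \<psi>_def scaleC_scaleC complex_eq_iff)
  have psi_re: "\<psi> (complex_of_real r *\<^sub>C x) = r * \<psi> x" for r x
    using fre[of r "\<i> *\<^sub>C x"]
    by (simp add: \<psi>_def fre scaleC_scaleC complex_eq_iff mult.commute)
  have psi_scale: "\<psi> (c *\<^sub>C x) = c * \<psi> x" for c x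
  proof -
    have "c *\<^sub>C x = complex_of_real (Re c) *\<^sub>C x + complex_of_real (Im c) *\<^sub>C \<i> *\<^sub>C x"
      by (simp add: scaleC_scaleC flip: scaleC_add_left)
         (simp add: complex_eq mult.commute)
    then have "\<psi> (c *\<^sub>C x) = (Re c + \<i> * Im c) * \<psi> x"
      by (simp only: psi_add psi_re psi_i) (simp add: algebra_simps)
    then show ?thesis by (simp add: complex_eq[symmetric])
  qed
  have psi_p: "cmod (\<psi> x) \<le> p x" for x
  proof (cases "\<psi> x = 0")
    case True
    then show ?thesis using fp[of x] fp[of "- x"] rot[of "-1" x] f.neg[of x] by (simp add: \<psi>_def)
  next
    case False
    \<comment> \<open>Rotating by \<open>c\<close> makes the value of \<open>\<psi>\<close> real and
      positive, hence equal to the value of \<open>f\<close>, which \<open>p\<close> bounds.\<close>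
    define c where "c = cmod (\<psi> x) / \<psi> x"
    have c: "cmod c = 1" using False by (simp add: c_def norm_divide)
    have "\<psi> (c *\<^sub>C x) = cmod (\<psi> x)"
      using False by (simp add: psi_scale c_def)
    then have "f (c *\<^sub>C x) = cmod (\<psi> x)"
      by (simp add: \<psi>_def complex_eq_iff)
    then show ?thesis
      using fp[of "c *\<^sub>C x"] rot[OF c, of x] by simp
  qed
  have "f x\<^sub>0 \<le> cmod (\<psi> x\<^sub>0)"
    using complex_Re_le_cmod[of "\<psi> x\<^sub>0"] by (simp add: \<psi>_def)
  with fx0 have d_le: "d \<le> cmod (\<psi> x\<^sub>0)" by simp
  define \<phi> where "\<phi> x = \<psi> x / \<psi> x\<^sub>0" for x
  have cl: "clinear \<phi>"
    by (rule clinearI) (simp_all add: \<phi>_def psi_add psi_scale add_divide_distrib scaleC_complex_def)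
  have bound: "norm (\<phi> x) \<le> norm x * (1 / d)" for x
  proof -
    have "cmod (\<psi> x) \<le> norm x" using psi_p[of x] le[OF J0, of x] by simp
    then have "cmod (\<psi> x) / cmod (\<psi> x\<^sub>0) \<le> norm x / d"
      using d_le \<open>0 < d\<close> by (intro frac_le) auto
    then show ?thesis by (simp add: \<phi>_def norm_divide)
  qed
  have app: "capp (mk_cblinfun \<phi>) = \<phi>"
    by (rule capp_mk_cblinfun[OF cl bound])
  show ?thesis
  proof (rule that)
    show "capp (mk_cblinfun \<phi>) y = 0" if "y \<in> J" for y
      using order_trans[OF psi_p[of y] le[OF that, of y]] by (simp add: app \<phi>_def)
    show "capp (mk_cblinfun \<phi>) x\<^sub>0 = 1"
      using d_le \<open>0 < d\<close> by (auto simp: app \<phi>_def)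
    show "norm (mk_cblinfun \<phi>) \<le> 1 / d"
      using bound \<open>0 < d\<close> by (intro norm_cblinfun_bound) (auto simp: app mult.commute)
  qed
qed

corollary exists_functional_norming:
  fixes x :: "'a::complex_normed_vector"
  assumes "x \<noteq> 0"
  obtains \<phi> :: "('a, complex) cblinfun" where "capp \<phi> x = 1" "norm \<phi> \<le> 1 / norm x"
  using hahn_banach_separation[of "{0}" "norm x" x] assms by auto

corollary exists_functional_closed_subspace:
  fixes x :: "'a::complex_normed_vector"
  assumes J: "complex_vector.subspace J" and "x \<notin> closure J"
  obtains \<phi> :: "('a, complex) cblinfun" where "\<And>y. y \<in> J \<Longrightarrow> capp \<phi> y = 0" "capp \<phi> x = 1"
proof -
  obtain d where "0 < d" "\<And>y. y \<in> J \<Longrightarrow> \<not> dist y x < d"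
    using assms(2) by (auto simp: closure_approachable)
  then show ?thesis
    using that hahn_banach_separation[OF J, of d x]
    by (metis dist_commute dist_norm linorder_not_less)
qed

section \<open>Drazin invertibility through lower bounds\<close>

lemma capp_cpower: "capp (V ^\<^sub>C n) x = (capp V ^^ n) x"
  by (induction n) simp_all

lemma
  fixes V :: "('a::complex_normed_vector, 'a) cblinfun"
  shows funpow_capp_add: "(capp V ^^ n) (x + y) = (capp V ^^ n) x + (capp V ^^ n) y"
  and funpow_capp_diff: "(capp V ^^ n) (x - y) = (capp V ^^ n) x - (capp V ^^ n) y"
  and funpow_capp_scaleC: "(capp V ^^ n) (c *\<^sub>C x) = c *\<^sub>C (capp V ^^ n) x"
  by (induction n) (simp_all add: capp_add_right capp_diff_right capp_scaleC_right)

lemma funpow_capp_zero: "(capp V ^^ n) (0::'a::complex_normed_vector) = (0::'a)"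
  by (induction n) simp_all

lemma tendsto_capp [tendsto_intros]:
  "(f \<longlongrightarrow> l) F \<Longrightarrow> ((\<lambda>x. capp T (f x)) \<longlongrightarrow> capp T l) F"
  by transfer (intro tendsto_intros)

text \<open>The adjoint of \<open>T\<close>: the dual space is the space of operators into the
  complex numbers, on which the adjoint is a one-sided multiplication.\<close>

definition dual_op :: "('a::complex_normed_vector, 'a) cblinfun \<Rightarrow>
    (('a, complex) cblinfun, ('a, complex) cblinfun) cblinfun"
  where "dual_op T = mult_op cid T"

lemma capp_dual_op: "capp (dual_op T) \<phi> = \<phi> o\<^sub>C T"
  by (rule cblinfun_eqI) (simp add: dual_op_def capp_mult_op)

lemma capp_funpow_dual_op: "capp ((capp (dual_op T) ^^ n) \<phi>) x = capp \<phi> ((capp T ^^ n) x)"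
  by (induction n arbitrary: x) (simp_all add: capp_dual_op flip: funpow_swap1)

text \<open>\<open>V\<close> is bounded below on the range of \<open>V^m\<close>, a quantitative
  form of having ascent at most \<open>m\<close>; for \<open>m = 0\<close>, \<open>V\<close> itself
  is bounded below.\<close>

definition ascent_bound :: "nat \<Rightarrow> ('a::complex_normed_vector, 'a) cblinfun \<Rightarrow> bool"
  where "ascent_bound m V \<longleftrightarrow>
    (\<exists>C. \<forall>x. norm ((capp V ^^ m) x) \<le> C * norm (capp V ((capp V ^^ m) x)))"

lemma ascent_boundE:
  assumes "ascent_bound m V"
  obtains C where "0 < C" "\<And>x. norm ((capp V ^^ m) x) \<le> C * norm (capp V ((capp V ^^ m) x))"
proof -
  obtain C where C: "\<And>x. norm ((capp V ^^ m) x) \<le> C * norm (capp V ((capp V ^^ m) x))"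
    using assms by (auto simp: ascent_bound_def)
  show ?thesis
  proof (rule that)
    show "0 < max C 1" by simp
    show "norm ((capp V ^^ m) x) \<le> max C 1 * norm (capp V ((capp V ^^ m) x))" for x
      by (rule order_trans[OF C]) (intro mult_right_mono, auto)
  qed
qed

lemma ascent_bound_0E:
  assumes "ascent_bound 0 V"
  obtains C where "0 < C" "\<And>x. norm x \<le> C * norm (capp V x)"
  using ascent_boundE[OF assms] by auto

lemma ascent_bound_0I: "(\<And>x. norm x \<le> C * norm (capp V x)) \<Longrightarrow> ascent_bound 0 V"
  unfolding ascent_bound_def by auto

lemma ascent_bound_mono:
  assumes "ascent_bound m V" "m \<le> n"
  shows "ascent_bound n V"
proof -
  have "(capp V ^^ n) x = (capp V ^^ m) ((capp V ^^ (n - m)) x)" for x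
    using assms(2) by (simp flip: funpow_add[THEN fun_cong, unfolded o_apply])
  then show ?thesis
    using assms(1) unfolding ascent_bound_def by metis
qed

lemma ascent_bound_null:
  assumes "ascent_bound m V" "(capp V ^^ Suc m) x = 0"
  shows "(capp V ^^ m) x = 0"
  using ascent_boundE[OF assms(1)] assms(2) by (metis funpow.simps(2) mult_zero_right norm_le_zero_iff norm_zero o_apply)

lemma subspace_range_funpow:
  fixes V :: "('a::complex_normed_vector, 'a) cblinfun"
  shows "complex_vector.subspace (range (capp V ^^ n))"
proof (rule complex_vector.subspaceI)
  show "0 \<in> range (capp V ^^ n)"
    by (rule range_eqI[of _ _ 0]) (simp add: funpow_capp_zero)
  show "x + y \<in> range (capp V ^^ n)" if "x \<in> range (capp V ^^ n)" "y \<in> range (capp V ^^ n)" for x y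
    using that by (auto simp: funpow_capp_add[symmetric])
  show "c *\<^sub>C x \<in> range (capp V ^^ n)" if "x \<in> range (capp V ^^ n)" for c x
    using that by (auto simp: funpow_capp_scaleC[symmetric])
qed

text \<open>The dual bound forces \<open>V\<close> to map the closure \<open>W\<close> of the range of \<open>V\<^sup>m\<close> onto a dense
  subspace of \<open>W\<close>, and the direct bound makes \<open>V\<close> bounded below on \<open>W\<close>; so \<open>V\<close> maps \<open>W\<close> onto
  itself.\<close>

lemma ascent_bound_range:
  fixes V :: "('a::complex_banach, 'a) cblinfun"
  assumes m: "ascent_bound m V" and m': "ascent_bound m (dual_op V)"
  shows "\<exists>y. (capp V ^^ m) x = (capp V ^^ Suc m) y"
proof -
  let ?R = "\<lambda>k. range (capp V ^^ k)"
  define W where "W = closure (?R m)"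
  obtain C where "0 < C"
    and C: "\<And>x. norm ((capp V ^^ m) x) \<le> C * norm (capp V ((capp V ^^ m) x))"
    using ascent_boundE[OF m] by blast
  have dense: "W \<subseteq> closure (?R (Suc m))"
  proof
    fix w assume w: "w \<in> W"
    show "w \<in> closure (?R (Suc m))"
    proof (rule ccontr)
      assume "w \<notin> closure (?R (Suc m))"
      then obtain \<phi> :: "('a, complex) cblinfun"
        where \<phi>: "\<And>y. y \<in> ?R (Suc m) \<Longrightarrow> capp \<phi> y = 0" "capp \<phi> w = 1"
        using exists_functional_closed_subspace[OF subspace_range_funpow] by blast
      have "(capp (dual_op V) ^^ Suc m) \<phi> = 0"
        by (rule cblinfun_eqI) (use \<phi>(1) in \<open>auto simp only: capp_funpow_dual_op capp_zero_left\<close>)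
      then have "(capp (dual_op V) ^^ m) \<phi> = 0"
        by (rule ascent_bound_null[OF m'])
      then have "capp \<phi> ((capp V ^^ m) x) = 0" for x
        by (simp flip: capp_funpow_dual_op)
      then have "?R m \<subseteq> {y. capp \<phi> y = 0}" by auto
      moreover have "closed {y. capp \<phi> y = 0}"
        by (intro closed_Collect_eq continuous_on_capp continuous_intros)
      ultimately have "W \<subseteq> {y. capp \<phi> y = 0}"
        unfolding W_def by (rule closure_minimal)
      with w \<phi>(2) show False by auto
    qed
  qed
  have onto: "closure (?R (Suc m)) \<subseteq> capp V ` W"
  proof
    fix z assume "z \<in> closure (?R (Suc m))"
    then obtain Z where Z: "\<And>n. Z n \<in> ?R (Suc m)" "Z \<longlonglongrightarrow> z"
      by (auto simp: closure_sequential)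
    from Z(1) have "\<forall>n. \<exists>u. Z n = capp V ((capp V ^^ m) u)" by fastforce
    then obtain u where u: "\<And>n. Z n = capp V ((capp V ^^ m) (u n))" by metis
    define w where "w n = (capp V ^^ m) (u n)" for n
    have dist: "dist (w i) (w j) \<le> C * dist (Z i) (Z j)" for i j
      using C[of "u i - u j"]
      by (simp add: w_def u dist_norm funpow_capp_diff capp_diff_right)
    have "Cauchy w"
    proof (rule metric_CauchyI)
      fix e :: real assume "0 < e"
      then obtain M where M: "\<And>i j. i \<ge> M \<Longrightarrow> j \<ge> M \<Longrightarrow> dist (Z i) (Z j) < e / C"
        using metric_CauchyD[OF LIMSEQ_imp_Cauchy[OF Z(2)], of "e / C"] \<open>0 < C\<close> by auto
      have "dist (w i) (w j) < e" if "i \<ge> M" "j \<ge> M" for i j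
        using M[OF that] dist[of i j] \<open>0 < C\<close> by (simp add: field_simps)
      then show "\<exists>M. \<forall>i\<ge>M. \<forall>j\<ge>M. dist (w i) (w j) < e" by blast
    qed
    then obtain l where l: "w \<longlonglongrightarrow> l"
      by (auto simp: Cauchy_convergent_iff convergent_def)
    have "l \<in> W"
      unfolding W_def closure_sequential using l by (intro exI[of _ w]) (auto simp: w_def)
    moreover have "Z \<longlonglongrightarrow> capp V l"
      using tendsto_capp[OF l, of V] by (simp add: u[abs_def] w_def)
    then have "capp V l = z" using Z(2) LIMSEQ_unique by blast
    ultimately show "z \<in> capp V ` W" by blast
  qed
  \<comment> \<open>Iterating is necessary: the instance \<open>k = Suc m\<close> yields a preimage
    of \<open>V^m x\<close> under \<open>V^(m+1)\<close>, not only under \<open>V\<close>.\<close>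
  have "W \<subseteq> (capp V ^^ k) ` W" for k
  proof (induction k)
    case (Suc k)
    then have "capp V ` W \<subseteq> capp V ` (capp V ^^ k) ` W" by blast
    with dense onto show ?case by (force simp: image_comp)
  qed simp
  moreover have "(capp V ^^ m) x \<in> W"
    unfolding W_def by (rule subsetD[OF closure_subset]) simp
  ultimately show ?thesis by blast
qed

lemma bounded_below_imp_inverse:
  fixes V :: "('a::complex_normed_vector, 'b::complex_normed_vector) cblinfun"
  assumes C: "\<And>x. norm x \<le> C * norm (capp V x)" and "surj (capp V)"
  obtains S where "S o\<^sub>C V = cid" "V o\<^sub>C S = cid" "norm S \<le> max C 0"
proof -
  have inj: "inj (capp V)"
  proof (rule injI)
    fix x y assume "capp V x = capp V y"
    then show "x = y" using C[of "x - y"] by (simp add: capp_diff_right)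
  qed
  define g where "g = inv (capp V)"
  have g: "capp V (g y) = y" "g (capp V x) = x" for x y
    using assms(2) inj by (simp_all add: g_def surj_f_inv_f inv_f_f)
  have cl: "clinear g"
    by (rule clinearI; rule injD[OF inj]) (simp_all add: g capp_add_right capp_scaleC_right)
  have "norm (g y) \<le> norm y * max C 0" for y
    using C[of "g y"] mult_left_mono[of C "max C 0" "norm y"] by (simp add: g mult.commute)
  then have bound: "norm (g y) \<le> norm y * max C 0" for y .
  have app: "capp (mk_cblinfun g) = g" by (rule capp_mk_cblinfun[OF cl bound])
  show ?thesis
  proof (rule that)
    show "mk_cblinfun g o\<^sub>C V = cid" "V o\<^sub>C mk_cblinfun g = cid"
      by (rule cblinfun_eqI, simp add: app g)+
    show "norm (mk_cblinfun g) \<le> max C 0"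
      using bound by (intro norm_cblinfun_bound) (auto simp: app mult.commute)
  qed
qed

lemma left_inverse_imp_ascent_bound:
  assumes "S o\<^sub>C V = cid"
  shows "ascent_bound 0 V"
proof (rule ascent_bound_0I)
  show "norm x \<le> norm S * norm (capp V x)" for x
    using norm_capp[of S "capp V x"] capp_ccompose[of S V x] by (simp add: assms)
qed

text \<open>The first bound gives injectivity and, jointly with the bound for the adjoint,
  surjectivity by the range lemma at \<open>m = 0\<close>. Membership in the spectrum thus becomes
  the failure of one of two inequalities.\<close>

lemma invertible_op_iff:
  fixes V :: "('a::complex_banach, 'a) cblinfun"
  shows "invertible_op V \<longleftrightarrow> ascent_bound 0 V \<and> ascent_bound 0 (dual_op V)"
proof
  assume "invertible_op V"
  then obtain S where S: "S o\<^sub>C V = cid" "V o\<^sub>C S = cid" by (auto simp: invertible_op_def)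
  have "dual_op S o\<^sub>C dual_op V = cid"
    using S(2) capp_ccompose[of V S]
    by (intro cblinfun_eqI) (simp add: capp_dual_op)
  with S(1) show "ascent_bound 0 V \<and> ascent_bound 0 (dual_op V)"
    by (blast intro: left_inverse_imp_ascent_bound)
next
  assume *: "ascent_bound 0 V \<and> ascent_bound 0 (dual_op V)"
  then obtain C where C: "\<And>x. norm x \<le> C * norm (capp V x)"
    using ascent_bound_0E by metis
  have "surj (capp V)"
    unfolding surj_def using ascent_bound_range[of 0 V] * by simp
  then show "invertible_op V"
    using bounded_below_imp_inverse[OF C] by (metis invertible_op_def)
qed

lemma ascent_finite_iff: "ascent T < \<infinity> \<longleftrightarrow> (\<exists>n. null_space (T ^\<^sub>C n) = null_space (T ^\<^sub>C Suc n))"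
  and descent_finite_iff:
    "descent T < \<infinity> \<longleftrightarrow> (\<exists>n. range (capp (T ^\<^sub>C n)) = range (capp (T ^\<^sub>C Suc n)))"
  unfolding ascent_def descent_def INF_less_iff by (simp_all del: cpower.simps add: Bex_def)

lemma ascent_bound_imp_ascent_descent:
  fixes V :: "('a::complex_banach, 'a) cblinfun"
  assumes "ascent_bound m V" "ascent_bound m (dual_op V)"
  shows "ascent V < \<infinity>" "descent V < \<infinity>"
proof -
  show "ascent V < \<infinity>"
    unfolding ascent_finite_iff null_space_def capp_cpower
    using ascent_bound_null[OF assms(1)] by (intro exI[of _ m]) auto
  have "range (capp V ^^ Suc m) \<subseteq> range (capp V ^^ m)"
    unfolding funpow_Suc_right by auto
  moreover have "range (capp V ^^ m) \<subseteq> range (capp V ^^ Suc m)"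
    using ascent_bound_range[OF assms] by fast
  ultimately show "descent V < \<infinity>"
    unfolding descent_finite_iff capp_cpower by (intro exI[of _ m]) blast
qed

text \<open>On the range of \<open>V^m\<close> the operator \<open>S\<close> is a left inverse of
  \<open>V\<close>, so \<open>norm S\<close> serves as the constant; the adjoint of \<open>S\<close>
  does the same for the adjoint of \<open>V\<close>.\<close>

lemma commuting_imp_ascent_bound:
  fixes V :: "('a::complex_normed_vector, 'a) cblinfun"
  assumes S: "V ^\<^sub>C m = V ^\<^sub>C m o\<^sub>C S o\<^sub>C V" "V o\<^sub>C S = S o\<^sub>C V"
  shows "ascent_bound m V" "ascent_bound m (dual_op V)"
proof -
  have comm: "capp V (capp S x) = capp S (capp V x)" for x
    using S(2) by (metis capp_ccompose)
  have comm_m: "(capp V ^^ m) (capp S x) = capp S ((capp V ^^ m) x)" for x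
    by (induction m) (simp_all add: comm)
  have key: "(capp V ^^ m) x = capp S (capp V ((capp V ^^ m) x))" for x
    by (metis S(1) capp_ccompose capp_cpower comm_m funpow_swap1)
  have key2: "(capp V ^^ m) (capp V (capp S x)) = (capp V ^^ m) x" for x
    by (metis comm comm_m funpow_swap1 key)
  show "ascent_bound m V"
    unfolding ascent_bound_def using norm_capp[of S] key by metis
  have "(capp (dual_op V) ^^ m) \<phi> =
      capp (dual_op S) (capp (dual_op V) ((capp (dual_op V) ^^ m) \<phi>))" for \<phi>
  proof (rule cblinfun_eqI)
    fix x
    show "capp ((capp (dual_op V) ^^ m) \<phi>) x =
      capp (capp (dual_op S) (capp (dual_op V) ((capp (dual_op V) ^^ m) \<phi>))) x"
      using key[of x] by (simp add: capp_dual_op capp_funpow_dual_op key2)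
  qed
  then show "ascent_bound m (dual_op V)"
    unfolding ascent_bound_def using norm_capp[of "dual_op S"] by metis
qed

lemma drazin_invertible_imp_ascent_bound:
  fixes V :: "('a::complex_normed_vector, 'a) cblinfun"
  assumes "drazin_invertible V"
  shows "\<exists>m. ascent_bound m V \<and> ascent_bound m (dual_op V)"
  using assms commuting_imp_ascent_bound unfolding drazin_invertible_def by metis

text \<open>Open mapping for the restriction of \<open>f\<close> to a closed subspace \<open>C\<close>, kept as a set because
  kernels are not available as types.\<close>

lemma open_mapping_approximate:
  fixes f :: "'a::banach \<Rightarrow> 'b::banach"
  assumes f: "linear f" and C: "subspace C" and onto: "f ` C = UNIV"
  obtains M where "0 \<le> M" "\<And>y. \<exists>x\<in>C. norm x \<le> M * norm y \<and> norm (y - f x) \<le> norm y / 2"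
proof -
  interpret f: linear f by fact
  define F where "F n = closure (f ` (C \<inter> cball 0 (real n)))" for n :: nat
  \<comment> \<open>Baire's theorem, since the sets \<open>F n\<close> are closed and cover the
    space.\<close>
  have "\<exists>n. interior (F n) \<noteq> {}"
  proof (rule ccontr)
    assume "\<not> (\<exists>n. interior (F n) \<noteq> {})"
    then have *: "closedin Met_TC.mtopology T \<and> Met_TC.mtopology interior_of T = {}"
      if "T \<in> range F" for T
      using that by (auto simp: F_def)
    have "Met_TC.mtopology interior_of \<Union> (range F) = {}"
      by (rule Met_TC.metric_Baire_category_alt) (use * complete_UNIV in auto)
    moreover have "\<Union> (range F) = UNIV"
    proof (rule antisym[OF subset_UNIV subsetI])
      fix y
      obtain x where x: "x \<in> C" "y = f x" using onto by blast
      obtain n :: nat where "norm x \<le> real n" using real_arch_simple by blast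
      with x have "y \<in> f ` (C \<inter> cball 0 (real n))" by auto
      then have "y \<in> F n" unfolding F_def by (rule subsetD[OF closure_subset])
      then show "y \<in> \<Union> (range F)" by blast
    qed
    ultimately show False by (simp del: Sup_eq_top_iff)
  qed
  then obtain n y\<^sub>0 r where r: "0 < r" "ball y\<^sub>0 r \<subseteq> F n"
    by (metis ex_in_conv mem_interior)
  \<comment> \<open>Both \<open>y\<^sub>0\<close> and \<open>y\<^sub>0 + y\<close> are approximated
    from the ball of radius \<open>n\<close>; subtracting approximates \<open>y\<close> and doubles
    the radius.\<close>
  have approx: "\<exists>x\<in>C. norm x \<le> 2 * real n \<and> norm (y - f x) \<le> e"
    if y: "norm y < r" and e: "0 < e" for y e
  proof -
    have "y\<^sub>0 + y \<in> F n" "y\<^sub>0 \<in> F n" using r y by (auto simp: dist_norm subset_eq)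
    moreover have "\<exists>u\<in>C. norm u \<le> real n \<and> dist (f u) z < e / 2" if z: "z \<in> F n" for z
    proof -
      obtain w where "w \<in> f ` (C \<inter> cball 0 (real n))" "dist w z < e / 2"
        using z half_gt_zero[OF e] unfolding F_def closure_approachable by blast
      then show ?thesis by auto
    qed
    ultimately obtain u v where u: "u \<in> C" "norm u \<le> real n" "dist (f u) (y\<^sub>0 + y) < e / 2"
      and v: "v \<in> C" "norm v \<le> real n" "dist (f v) y\<^sub>0 < e / 2"
      by metis
    have "y - f (u - v) = (f v - y\<^sub>0) - (f u - (y\<^sub>0 + y))" by (simp add: f.diff)
    also have "norm \<dots> \<le> e"
      using u(3) v(3) norm_triangle_ineq4[of "f v - y\<^sub>0" "f u - (y\<^sub>0 + y)"]
      unfolding dist_norm by linarith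
    finally have "norm (y - f (u - v)) \<le> e" .
    moreover have "norm (u - v) \<le> 2 * real n"
      using u(2) v(2) norm_triangle_ineq4[of u v] by simp
    ultimately show ?thesis using subspace_diff[OF C u(1) v(1)] by blast
  qed
  show ?thesis
  \<comment> \<open>\<open>y\<close> is scaled to norm \<open>r / 2\<close> and approximated to
    within \<open>r / 4\<close>, half of that norm; undoing the scaling turns
    \<open>2 * real n\<close> into \<open>4 * real n / r * norm y\<close>.\<close>
  proof (rule that[of "4 * real n / r"])
    fix y :: 'b
    show "\<exists>x\<in>C. norm x \<le> 4 * real n / r * norm y \<and> norm (y - f x) \<le> norm y / 2"
    proof (cases "y = 0")
      case True
      then show ?thesis using subspace_0[OF C] by (intro bexI[of _ 0]) (auto simp: f.zero)
    next
      case False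
      define s where "s = r / (2 * norm y)"
      have s: "0 < s" "s * norm y = r / 2" using False r by (simp_all add: s_def)
      have "norm (s *\<^sub>R y) < r" "0 < r / 4" using s r by simp_all
      then obtain x where x: "x \<in> C" "norm x \<le> 2 * real n" "norm (s *\<^sub>R y - f x) \<le> r / 4"
        using approx by blast
      have "y - f (inverse s *\<^sub>R x) = inverse s *\<^sub>R (s *\<^sub>R y - f x)"
        using s by (simp add: f.scale scaleR_diff_right)
      then have "norm (y - f (inverse s *\<^sub>R x)) = inverse s * norm (s *\<^sub>R y - f x)"
        using s by simp
      also have "\<dots> \<le> inverse s * (r / 4)" using s x by (intro mult_left_mono) auto
      also have "\<dots> = norm y / 2" using r False by (simp add: s_def)
      finally have "norm (y - f (inverse s *\<^sub>R x)) \<le> norm y / 2" .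
      moreover have "norm (inverse s *\<^sub>R x) \<le> 4 * real n / r * norm y"
        using x(2) s r False mult_left_mono[OF x(2), of "inverse s"] by (simp add: s_def field_simps)
      ultimately show ?thesis
        using subspace_scale[OF C x(1)] by blast
    qed
  qed (use r in auto)
qed

text \<open>The approximation is iterated on the remainder \<open>Y k\<close>, whose norm at least
  halves at each step. The corrections form an absolutely convergent series, whose sum stays in the
  closed set \<open>C\<close>; the geometric series gives the constant \<open>2 * M\<close>.\<close>

lemma open_mapping_bound:
  fixes f :: "'a::banach \<Rightarrow> 'b::banach"
  assumes f: "bounded_linear f" and C: "subspace C" "closed C" and onto: "f ` C = UNIV"
  obtains K where "\<And>y. \<exists>x\<in>C. f x = y \<and> norm x \<le> K * norm y"
proof -
  interpret f: bounded_linear f by fact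
  obtain M where M: "0 \<le> M" "\<And>y. \<exists>x\<in>C. norm x \<le> M * norm y \<and> norm (y - f x) \<le> norm y / 2"
    using open_mapping_approximate[OF f.linear_axioms C(1) onto] by blast
  obtain g where g: "\<And>y. g y \<in> C" "\<And>y. norm (g y) \<le> M * norm y"
    "\<And>y. norm (y - f (g y)) \<le> norm y / 2"
    using M(2) by metis
  show ?thesis
  proof (rule that)
    fix y :: 'b
    define Y where "Y k = ((\<lambda>y. y - f (g y)) ^^ k) y" for k
    have Y_Suc: "Y (Suc k) = Y k - f (g (Y k))" for k by (simp add: Y_def)
    have Y_norm: "norm (Y k) \<le> norm y * (1 / 2) ^ k" for k
    proof (induction k)
      case (Suc k)
      then show ?case using g(3)[of "Y k"] by (simp add: Y_Suc)
    qed (simp add: Y_def)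
    have gY: "norm (g (Y k)) \<le> M * norm y * (1 / 2) ^ k" for k
      using order_trans[OF g(2) mult_left_mono[OF Y_norm M(1)]] by (simp add: mult.assoc)
    have geo: "summable (\<lambda>k. M * norm y * (1 / 2) ^ k)"
      by (intro summable_mult summable_geometric) simp
    have norm_summable: "summable (\<lambda>k. norm (g (Y k)))"
      by (rule summable_comparison_test'[OF geo]) (use gY in simp)
    then have sums: "(\<lambda>k. g (Y k)) sums (\<Sum>k. g (Y k))"
      by (rule summable_sums[OF summable_norm_cancel])
    define x where "x = (\<Sum>k. g (Y k))"
    have partial: "(\<lambda>n. \<Sum>k<n. g (Y k)) \<longlonglongrightarrow> x"
      using sums by (simp add: sums_def x_def)
    have "x \<in> C"
      by (rule closed_sequentially[OF C(2) _ partial]) (intro subspace_sum C(1) g(1))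
    moreover have "f x = y"
    proof -
      have "f (\<Sum>k<n. g (Y k)) = y - Y n" for n
        by (induction n) (auto simp: f.add f.zero Y_Suc, simp add: Y_def)
      then have "(\<lambda>n. y - Y n) \<longlonglongrightarrow> f x" using f.tendsto[OF partial] by simp
      moreover have "Y \<longlonglongrightarrow> 0"
      proof (rule Lim_null_comparison)
        show "\<forall>\<^sub>F k in sequentially. norm (Y k) \<le> norm y * (1 / 2) ^ k"
          using Y_norm by simp
        show "(\<lambda>k. norm y * (1 / 2) ^ k) \<longlonglongrightarrow> 0"
          by (intro tendsto_mult_right_zero LIMSEQ_power_zero) simp
      qed
      then have "(\<lambda>n. y - Y n) \<longlonglongrightarrow> y - 0" by (intro tendsto_intros)
      ultimately show ?thesis using LIMSEQ_unique by fastforce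
    qed
    moreover have "norm x \<le> 2 * M * norm y"
    proof -
      have "norm x \<le> (\<Sum>k. norm (g (Y k)))" unfolding x_def by (rule summable_norm[OF norm_summable])
      also have "\<dots> \<le> (\<Sum>k. M * norm y * (1 / 2) ^ k)" by (rule suminf_le[OF gY norm_summable geo])
      also have "\<dots> = 2 * M * norm y" by (simp add: suminf_mult suminf_geometric)
      finally show ?thesis .
    qed
    ultimately show "\<exists>x\<in>C. f x = y \<and> norm x \<le> (2 * M) * norm y" by blast
  qed
qed

section \<open>Construction of the Drazin inverse from finite ascent and descent\<close>

lemma ascent_finiteE:
  assumes "ascent V < \<infinity>"
  obtains n where "\<And>k x. (capp V ^^ k) x = 0 \<Longrightarrow> (capp V ^^ n) x = 0"
proof -
  obtain n where "null_space (V ^\<^sub>C n) = null_space (V ^\<^sub>C Suc n)"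
    using assms ascent_finite_iff by blast
  then have n: "(capp V ^^ Suc n) x = 0 \<Longrightarrow> (capp V ^^ n) x = 0" for x
    unfolding null_space_def capp_cpower by blast
  have "(capp V ^^ (n + k)) x = 0 \<Longrightarrow> (capp V ^^ n) x = 0" for k x
  proof (induction k arbitrary: x)
    case (Suc k)
    then have "(capp V ^^ (n + k)) (capp V x) = 0" by (simp add: funpow_swap1)
    then have "(capp V ^^ n) (capp V x) = 0" by (rule Suc.IH)
    then show ?case by (intro n) (simp add: funpow_swap1)
  qed simp
  moreover have "(capp V ^^ k) x = 0 \<Longrightarrow> (capp V ^^ (n + k)) x = 0" for k x
    by (simp add: funpow_add funpow_capp_zero)
  ultimately show ?thesis using that by blast
qed

lemma descent_finiteE:
  assumes "descent V < \<infinity>"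
  obtains n where "\<And>k x. \<exists>y. (capp V ^^ n) x = (capp V ^^ k) y"
proof -
  obtain n where "range (capp (V ^\<^sub>C n)) = range (capp (V ^\<^sub>C Suc n))"
    using assms descent_finite_iff by blast
  then have n: "\<exists>y. (capp V ^^ n) x = (capp V ^^ Suc n) y" for x
    unfolding capp_cpower by blast
  have "\<exists>y. (capp V ^^ n) x = (capp V ^^ (k + n)) y" for k x
  proof (induction k arbitrary: x)
    case (Suc k)
    obtain y where "(capp V ^^ n) x = capp V ((capp V ^^ n) y)" using n[of x] by auto
    moreover obtain z where "(capp V ^^ n) y = (capp V ^^ (k + n)) z" using Suc by blast
    ultimately show ?case by (intro exI[of _ z]) simp
  qed auto
  then have "\<exists>y. (capp V ^^ n) x = (capp V ^^ k) y" for k x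
    by (metis funpow_add o_apply)
  then show ?thesis using that by blast
qed

text \<open>For large \<open>p\<close> the space is the direct sum of the kernel and the range of
  \<open>V^p\<close>. The Drazin inverse \<open>g\<close> is 0 on the kernel and inverts
  \<open>V\<close> on the range; its boundedness comes from the open mapping theorem.\<close>

lemma drazin_invertible_of_ascent_descent:
  fixes V :: "('a::complex_banach, 'a) cblinfun"
  assumes "ascent V < \<infinity>" "descent V < \<infinity>"
  shows "drazin_invertible V"
proof -
  let ?v = "capp V"
  obtain p\<^sub>1 where p\<^sub>1: "\<And>k x. (?v ^^ k) x = 0 \<Longrightarrow> (?v ^^ p\<^sub>1) x = 0"
    using ascent_finiteE[OF assms(1)] by blast
  obtain p\<^sub>2 where p\<^sub>2: "\<And>k x. \<exists>y. (?v ^^ p\<^sub>2) x = (?v ^^ k) y"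
    using descent_finiteE[OF assms(2)] by blast
  define p where "p = p\<^sub>1 + p\<^sub>2"
  have null: "(?v ^^ p) x = 0" if "(?v ^^ k) x = 0" for k x
    using p\<^sub>1[OF that] by (simp add: p_def add.commute[of p\<^sub>1] funpow_add funpow_capp_zero)
  have range: "\<exists>y. (?v ^^ p) x = (?v ^^ k) y" for k x
    using p\<^sub>2[of "(?v ^^ p\<^sub>1) x" k] by (simp add: p_def add.commute[of p\<^sub>1] funpow_add)
  \<comment> \<open>\<open>f\<close> maps the closed subspace \<open>C\<close> onto the space,
    writing \<open>y\<close> as a kernel element plus \<open>V^(p+1) z\<close>. Then
    \<open>V^p z\<close> is the value of the inverse at \<open>y\<close>, and the open mapping bound
    controls \<open>z\<close>.\<close>
  define C where "C = {(n, z::'a). (?v ^^ p) n = 0}"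
  define f where "f = (\<lambda>(n, z). n + (?v ^^ Suc p) z)"
  have C: "subspace C" "closed C"
  proof -
    have "closed {u :: 'a \<times> 'a. (?v ^^ p) (fst u) = 0}"
      unfolding capp_cpower[symmetric]
      by (intro closed_Collect_eq continuous_intros continuous_on_compose2[OF continuous_on_capp]) auto
    then show "closed C" by (simp add: C_def case_prod_unfold)
    show "subspace C"
      by (rule subspaceI) (auto simp: C_def zero_prod_def funpow_capp_zero funpow_capp_add
          funpow_capp_scaleC scaleR_scaleC)
  qed
  have f: "bounded_linear f"
  proof -
    have "bounded_linear (capp (V ^\<^sub>C Suc p))"
      unfolding capp.rep_eq by (rule blinfun.bounded_linear_right)
    then have "bounded_linear (\<lambda>u. fst u + capp (V ^\<^sub>C Suc p) (snd u))"
      by (intro bounded_linear_add bounded_linear_fst bounded_linear_compose[OF _ bounded_linear_snd])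
    then show ?thesis by (simp add: f_def case_prod_unfold capp_cpower del: cpower.simps funpow.simps)
  qed
  have onto: "f ` C = UNIV"
  proof (rule UNIV_eq_I[symmetric])
    fix y
    obtain z where "(?v ^^ p) y = (?v ^^ (p + Suc p)) z" using range by blast
    then have "(?v ^^ p) y = (?v ^^ p) ((?v ^^ Suc p) z)" by (simp only: funpow_add o_apply)
    then have "(y - (?v ^^ Suc p) z, z) \<in> C"
      by (simp add: C_def funpow_capp_diff del: funpow.simps)
    moreover have "f (y - (?v ^^ Suc p) z, z) = y" by (simp add: f_def)
    ultimately show "y \<in> f ` C" by (metis imageI)
  qed
  obtain K where K: "\<And>y. \<exists>u\<in>C. f u = y \<and> norm u \<le> K * norm y"
    using open_mapping_bound[OF f C onto] by blast
  \<comment> \<open>Characterizes \<open>r = g y\<close> independently of the chosen decomposition,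
    so linearity of \<open>g\<close> and commutation with \<open>V\<close> follow from
    uniqueness.\<close>
  define R where "R y r \<longleftrightarrow> r \<in> range (?v ^^ p) \<and> (?v ^^ p) y = (?v ^^ p) (?v r)" for y r
  have unique: "r = r'" if Ry: "R y r" "R y r'" for y r r'
  proof -
    obtain u u' where u: "r = (?v ^^ p) u" "r' = (?v ^^ p) u'"
      using Ry unfolding R_def by blast
    have "(?v ^^ p) (?v ((?v ^^ p) (u - u'))) = (?v ^^ p) (?v r) - (?v ^^ p) (?v r')"
      by (simp add: u funpow_capp_diff capp_diff_right)
    also have "\<dots> = 0" using Ry by (simp add: R_def)
    finally have "(?v ^^ (p + Suc p)) (u - u') = 0" by (simp add: funpow_add funpow_swap1)
    then have "(?v ^^ p) (u - u') = 0" by (rule null)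
    then show ?thesis by (simp add: u funpow_capp_diff)
  qed
  have exists: "\<exists>r. R y r \<and> norm r \<le> norm y * (norm (V ^\<^sub>C p) * K)" for y
  proof -
    obtain n z where nz: "(?v ^^ p) n = 0" "n + (?v ^^ Suc p) z = y" "norm (n, z) \<le> K * norm y"
      using K[of y] by (auto simp: C_def f_def)
    have "norm z \<le> K * norm y" using norm_snd_le[of z n] nz(3) by simp
    then have "norm ((?v ^^ p) z) \<le> norm (V ^\<^sub>C p) * (K * norm y)"
      using norm_capp[of "V ^\<^sub>C p" z] mult_left_mono[of "norm z" "K * norm y" "norm (V ^\<^sub>C p)"]
      by (simp add: capp_cpower)
    moreover have "R y ((?v ^^ p) z)"
      using nz(1) by (auto simp: R_def nz(2)[symmetric] funpow_capp_add)
    ultimately show ?thesis by (auto simp: mult_ac)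
  qed
  define g where "g y = (THE r. R y r)" for y
  have g: "R y r \<Longrightarrow> g y = r" for y r
    unfolding g_def by (rule the_equality) (auto intro: unique)
  have Rg: "R y (g y)" and bound: "norm (g y) \<le> norm y * (norm (V ^\<^sub>C p) * K)" for y
    using exists[of y] g by auto
  have R_add: "R (y + y') (r + r')" if "R y r" "R y' r'" for y y' r r'
    using that complex_vector.subspace_add[OF subspace_range_funpow[of p V], of r r']
    by (simp add: R_def capp_add_right funpow_capp_add)
  have R_scale: "R (c *\<^sub>C y) (c *\<^sub>C r)" if "R y r" for c y r
    using that complex_vector.subspace_scale[OF subspace_range_funpow[of p V], of r c]
    by (simp add: R_def capp_scaleC_right funpow_capp_scaleC)
  have app: "capp (mk_cblinfun g) = g"
    by (rule capp_mk_cblinfun[OF clinearI bound]) (rule g R_add R_scale Rg)+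
  have R_capp: "R (?v y) (?v r)" if "R y r" for y r
  proof -
    have "?v r \<in> range (?v ^^ p)" using that by (auto simp: R_def funpow_swap1)
    moreover have "(?v ^^ p) (?v y) = (?v ^^ p) (?v (?v r))"
      using that by (metis R_def funpow_swap1)
    ultimately show ?thesis by (simp add: R_def)
  qed
  have comm: "g (?v y) = ?v (g y)" for y by (rule g[OF R_capp[OF Rg]])
  have "V ^\<^sub>C p = V ^\<^sub>C p o\<^sub>C mk_cblinfun g o\<^sub>C V"
    using Rg by (intro cblinfun_eqI) (simp add: app comm capp_cpower R_def)
  moreover have "mk_cblinfun g o\<^sub>C V o\<^sub>C mk_cblinfun g = mk_cblinfun g"
    using Rg by (intro cblinfun_eqI) (simp add: app, intro g, simp add: R_def)
  moreover have "V o\<^sub>C mk_cblinfun g = mk_cblinfun g o\<^sub>C V"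
    by (intro cblinfun_eqI) (simp add: app comm)
  ultimately show ?thesis unfolding drazin_invertible_def by blast
qed

lemma drazin_invertible_iff_ascent_descent:
  fixes V :: "('a::complex_banach, 'a) cblinfun"
  shows "drazin_invertible V \<longleftrightarrow> ascent V < \<infinity> \<and> descent V < \<infinity>"
  using drazin_invertible_of_ascent_descent drazin_invertible_imp_ascent_bound
    ascent_bound_imp_ascent_descent by metis

lemma drazin_invertible_iff_ascent_bound:
  fixes V :: "('a::complex_banach, 'a) cblinfun"
  shows "drazin_invertible V \<longleftrightarrow> (\<exists>m. ascent_bound m V \<and> ascent_bound m (dual_op V))"
  using drazin_invertible_of_ascent_descent drazin_invertible_imp_ascent_bound
    ascent_bound_imp_ascent_descent by metis

lemma poles_eq:
  fixes T :: "('a::complex_banach, 'a) cblinfun"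
  shows "poles T = {c \<in> spectrum T. drazin_invertible (T - c *\<^sub>C cid)}"
  by (simp add: poles_def drazin_invertible_iff_ascent_descent)

section \<open>Topology of the spectrum\<close>

lemmas capp_simps = capp_add capp_diff capp_scaleC capp_minus_left
  capp_add_right capp_diff_right capp_scaleC_right capp_minus_right

lemma dual_op_diff_scaleC: "dual_op (V - c *\<^sub>C cid) = dual_op V - c *\<^sub>C cid"
  by (intro cblinfun_eqI) (simp add: capp_dual_op capp_simps)

lemma norm_dual_op: "norm (dual_op V) \<le> norm V"
  by (rule norm_cblinfun_bound) (simp_all add: capp_dual_op norm_ccompose mult.commute[of "norm V"])

lemma not_in_spectrum_iff:
  fixes V :: "('a::complex_banach, 'a) cblinfun"
  shows "c \<notin> spectrum V \<longleftrightarrow>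
    ascent_bound 0 (V - c *\<^sub>C cid) \<and> ascent_bound 0 (dual_op V - c *\<^sub>C cid)"
  by (simp add: spectrum_def invertible_op_iff dual_op_diff_scaleC)

text \<open>The shift costs at most half of \<open>norm x\<close>. The constant \<open>2 * C\<close>
  is explicit because the estimate is applied twice in succession at boundary points of the
  spectrum.\<close>

lemma bounded_below_perturb:
  assumes C: "\<And>x. norm x \<le> C * norm (capp (V - c *\<^sub>C cid) x)"
    and "0 < C" and d: "2 * C * cmod (d - c) \<le> 1"
  shows "norm x \<le> 2 * C * norm (capp (V - d *\<^sub>C cid) x)"
proof -
  have eq: "capp (V - c *\<^sub>C cid) x = capp (V - d *\<^sub>C cid) x + (d - c) *\<^sub>C x"
    by (simp add: capp_simps complex_vector.scale_left_diff_distrib)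
  have "norm x \<le> C * (norm (capp (V - d *\<^sub>C cid) x) + cmod (d - c) * norm x)"
    using C[of x] mult_left_mono[OF norm_triangle_ineq[of "capp (V - d *\<^sub>C cid) x" "(d - c) *\<^sub>C x"], of C]
      \<open>0 < C\<close> unfolding eq norm_scaleC by linarith
  also have "\<dots> = C * norm (capp (V - d *\<^sub>C cid) x) + (C * cmod (d - c)) * norm x"
    by (simp add: algebra_simps)
  also have "(C * cmod (d - c)) * norm x \<le> 1 / 2 * norm x"
    using d by (intro mult_right_mono) auto
  finally show ?thesis by simp
qed

lemma ascent_bound_0_open:
  assumes "ascent_bound 0 (V - c *\<^sub>C cid)"
  obtains e where "0 < e" "\<And>d. dist d c < e \<Longrightarrow> ascent_bound 0 (V - d *\<^sub>C cid)"
proof -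
  obtain C where C: "0 < C" "\<And>x. norm x \<le> C * norm (capp (V - c *\<^sub>C cid) x)"
    using ascent_bound_0E[OF assms] by blast
  show ?thesis
  proof (rule that)
    show "0 < 1 / (2 * C)" using C by simp
    fix d assume "dist d c < 1 / (2 * C)"
    then have "2 * C * cmod (d - c) \<le> 1"
      using C(1) by (simp add: dist_norm field_simps)
    then show "ascent_bound 0 (V - d *\<^sub>C cid)"
      by (rule ascent_bound_0I[OF bounded_below_perturb[OF C(2,1)]])
  qed
qed

lemma closed_spectrum:
  fixes V :: "('a::complex_banach, 'a) cblinfun"
  shows "closed (spectrum V)"
proof -
  have "open (- spectrum V)"
    unfolding open_dist
  proof (intro ballI)
    fix c assume "c \<in> - spectrum V"
    then have "ascent_bound 0 (V - c *\<^sub>C cid)" "ascent_bound 0 (dual_op V - c *\<^sub>C cid)"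
      by (auto simp: not_in_spectrum_iff)
    then obtain e e' where "0 < e" "\<And>d. dist d c < e \<Longrightarrow> ascent_bound 0 (V - d *\<^sub>C cid)"
      "0 < e'" "\<And>d. dist d c < e' \<Longrightarrow> ascent_bound 0 (dual_op V - d *\<^sub>C cid)"
      by (metis ascent_bound_0_open)
    then show "\<exists>e>0. \<forall>d. dist d c < e \<longrightarrow> d \<in> - spectrum V"
      by (intro exI[of _ "min e e'"]) (auto simp: not_in_spectrum_iff)
  qed
  then show ?thesis by (simp add: closed_def)
qed

lemma ascent_bound_0_large:
  assumes "norm V < cmod c"
  shows "ascent_bound 0 (V - c *\<^sub>C cid)"
proof (rule ascent_bound_0I)
  fix x
  have "cmod c * norm x \<le> norm (capp (V - c *\<^sub>C cid) x) + norm (capp V x)"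
    using norm_triangle_ineq4[of "capp V x" "capp (V - c *\<^sub>C cid) x"]
    by (simp add: capp_simps norm_scaleC)
  then have "(cmod c - norm V) * norm x \<le> norm (capp (V - c *\<^sub>C cid) x)"
    using norm_capp[of V x] by (simp add: algebra_simps)
  then show "norm x \<le> 1 / (cmod c - norm V) * norm (capp (V - c *\<^sub>C cid) x)"
    using assms by (simp add: field_simps)
qed

lemma spectrum_le_norm:
  fixes V :: "('a::complex_banach, 'a) cblinfun"
  assumes "c \<in> spectrum V"
  shows "cmod c \<le> norm V"
proof (rule ccontr)
  assume "\<not> cmod c \<le> norm V"
  then have "ascent_bound 0 (V - c *\<^sub>C cid)" "ascent_bound 0 (dual_op V - c *\<^sub>C cid)"
    using norm_dual_op[of V] by (auto intro!: ascent_bound_0_large)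
  then show False using assms not_in_spectrum_iff by blast
qed

text \<open>The constant \<open>K\<close> bounds the norm of the inverse, hence works for the
  adjoint as well. Keeping the same constant is what the perturbation argument at boundary points
  relies on.\<close>

lemma invertible_bounded_below_dual:
  assumes V: "invertible_op V" and "0 \<le> K" and K: "\<And>x. norm x \<le> K * norm (capp V x)"
  shows "norm \<phi> \<le> K * norm (capp (dual_op V) \<phi>)"
proof -
  obtain S where S: "V o\<^sub>C S = cid" using V by (auto simp: invertible_op_def)
  have "norm S \<le> K"
    using K[of "capp S _"] S \<open>0 \<le> K\<close> by (intro norm_cblinfun_bound) (auto simp flip: capp_ccompose)
  have "\<phi> = (\<phi> o\<^sub>C V) o\<^sub>C S"
    using S by (intro cblinfun_eqI) (metis capp_ccompose capp_cid)
  then have "norm \<phi> \<le> norm (\<phi> o\<^sub>C V) * norm S" by (metis norm_ccompose)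
  also have "\<dots> \<le> norm (\<phi> o\<^sub>C V) * K" using \<open>norm S \<le> K\<close> by (intro mult_left_mono) auto
  finally show ?thesis by (simp add: capp_dual_op mult.commute)
qed

text \<open>A functional that norms \<open>x\<close> turns the bound on functionals back into one on
  vectors.\<close>

lemma invertible_dual_bounded_below:
  assumes V: "invertible_op V" and K: "\<And>\<phi>. norm \<phi> \<le> K * norm (capp (dual_op V) \<phi>)"
  shows "norm x \<le> K * norm (capp V x)"
proof (cases "x = 0")
  case False
  obtain S where S: "S o\<^sub>C V = cid" using V by (auto simp: invertible_op_def)
  obtain \<phi> :: "('a, complex) cblinfun" where \<phi>: "capp \<phi> x = 1" "norm \<phi> \<le> 1 / norm x"
    using exists_functional_norming[OF False] by blast
  have "(\<phi> o\<^sub>C S) o\<^sub>C V = \<phi>"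
    using S by (intro cblinfun_eqI) (metis capp_ccompose capp_cid)
  then have *: "norm (\<phi> o\<^sub>C S) \<le> K * norm \<phi>"
    using K[of "\<phi> o\<^sub>C S"] by (simp add: capp_dual_op)
  have "norm \<phi> \<noteq> 0" using \<phi>(1) by auto
  have "0 \<le> K * norm \<phi>" using order_trans[OF norm_ge_zero *] .
  then have "0 \<le> K" using \<open>norm \<phi> \<noteq> 0\<close> by (simp add: zero_le_mult_iff)
  have "1 = cmod (capp (\<phi> o\<^sub>C S) (capp V x))"
    using \<phi>(1) S by (metis capp_ccompose capp_cid norm_one)
  also have "\<dots> \<le> norm (\<phi> o\<^sub>C S) * norm (capp V x)" by (rule norm_capp)
  also have "\<dots> \<le> K * (1 / norm x) * norm (capp V x)"
    using * mult_left_mono[OF \<phi>(2) \<open>0 \<le> K\<close>] by (intro mult_right_mono) auto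
  finally show ?thesis using False by (simp add: field_simps)
qed simp

text \<open>There are points \<open>d\<close> outside the spectrum arbitrarily near
  \<open>c\<close>. A bound at \<open>c\<close> passes to \<open>d\<close>, there by invertibility
  from the operator to its adjoint or back, and then returns to \<open>c\<close>; with both bounds
  \<open>c\<close> would not be in the spectrum.\<close>

lemma spectrum_boundary:
  fixes V :: "('a::complex_banach, 'a) cblinfun"
  assumes c: "c \<in> spectrum V" "c \<notin> interior (spectrum V)"
  shows "\<not> ascent_bound 0 (V - c *\<^sub>C cid)" "\<not> ascent_bound 0 (dual_op V - c *\<^sub>C cid)"
proof -
  \<comment> \<open>The constant doubles on the way to \<open>d\<close>, so the way back needs a
    distance of at most \<open>1 / (4 * C)\<close>.\<close>
  have near: "\<exists>d. d \<notin> spectrum V \<and> 4 * C * cmod (d - c) \<le> 1" if C: "0 < C" for C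
  proof -
    have "\<not> ball c (1 / (4 * C)) \<subseteq> spectrum V"
      using c(2) C by (auto simp: mem_interior)
    then obtain d where d: "d \<notin> spectrum V" "d \<in> ball c (1 / (4 * C))"
      by (meson subsetI)
    then have "4 * C * cmod (d - c) \<le> 1"
      using C d(2) by (simp add: dist_norm norm_minus_commute field_simps)
    with d(1) show ?thesis by blast
  qed
  show "\<not> ascent_bound 0 (V - c *\<^sub>C cid)"
  proof
    assume asm: "ascent_bound 0 (V - c *\<^sub>C cid)"
    obtain C where C: "0 < C" "\<And>x. norm x \<le> C * norm (capp (V - c *\<^sub>C cid) x)"
      using ascent_bound_0E[OF asm] by blast
    obtain d where d: "d \<notin> spectrum V" "4 * C * cmod (d - c) \<le> 1" using near[OF C(1)] by blast
    have "norm x \<le> 2 * C * norm (capp (V - d *\<^sub>C cid) x)" for x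
      by (rule bounded_below_perturb[OF C(2,1)]) (use d C(1) in auto)
    moreover have "invertible_op (V - d *\<^sub>C cid)" using d(1) by (simp add: spectrum_def)
    ultimately have "norm \<phi> \<le> 2 * C * norm (capp (dual_op V - d *\<^sub>C cid) \<phi>)" for \<phi>
      unfolding dual_op_diff_scaleC[symmetric]
      by (intro invertible_bounded_below_dual) (use C(1) in auto)
    from bounded_below_perturb[OF this, of c] have "ascent_bound 0 (dual_op V - c *\<^sub>C cid)"
      using d(2) C(1) by (intro ascent_bound_0I[of "2 * (2 * C)"]) (simp add: norm_minus_commute)
    with asm c(1) show False using not_in_spectrum_iff by blast
  qed
  show "\<not> ascent_bound 0 (dual_op V - c *\<^sub>C cid)"
  proof
    assume asm: "ascent_bound 0 (dual_op V - c *\<^sub>C cid)"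
    obtain C where C: "0 < C" "\<And>x. norm x \<le> C * norm (capp (dual_op V - c *\<^sub>C cid) x)"
      using ascent_bound_0E[OF asm] by blast
    obtain d where d: "d \<notin> spectrum V" "4 * C * cmod (d - c) \<le> 1" using near[OF C(1)] by blast
    have "norm x \<le> 2 * C * norm (capp (dual_op V - d *\<^sub>C cid) x)" for x
      by (rule bounded_below_perturb[OF C(2,1)]) (use d C(1) in auto)
    moreover have "invertible_op (V - d *\<^sub>C cid)" using d(1) by (simp add: spectrum_def)
    ultimately have "norm x \<le> 2 * C * norm (capp (V - d *\<^sub>C cid) x)" for x
      unfolding dual_op_diff_scaleC[symmetric] by (rule invertible_dual_bounded_below[rotated])
    from bounded_below_perturb[OF this, of c] have "ascent_bound 0 (V - c *\<^sub>C cid)"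
      using d(2) C(1) by (intro ascent_bound_0I[of "2 * (2 * C)"]) (simp add: norm_minus_commute)
    with asm c(1) show False using not_in_spectrum_iff by blast
  qed
qed

section \<open>Small perturbations and isolation of Drazin invertible points\<close>

lemma invertible_opI: "S o\<^sub>C V = cid \<Longrightarrow> V o\<^sub>C S' = cid \<Longrightarrow> invertible_op V"
proof -
  assume *: "S o\<^sub>C V = cid" "V o\<^sub>C S' = cid"
  have "S = S'"
    using * by (intro cblinfun_eqI) (metis capp_ccompose capp_cid)
  with * show ?thesis by (auto simp: invertible_op_def)
qed

lemma invertible_opE:
  assumes "invertible_op V"
  obtains S where "\<And>x. capp S (capp V x) = x" "\<And>x. capp V (capp S x) = x"
  using assms unfolding invertible_op_def by (metis capp_ccompose capp_cid)

text \<open>Takes the place of the Neumann series: 1 exceeds the norms of \<open>X\<close> and of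
  its adjoint, hence is not in the spectrum of \<open>X\<close>.\<close>

lemma invertible_one_minus:
  fixes X :: "('a::complex_banach, 'a) cblinfun"
  assumes "norm X \<le> 1 / 2"
  obtains U where "\<And>x. capp U (x - capp X x) = x" "\<And>x. capp U x - capp X (capp U x) = x"
    "norm U \<le> 2"
proof -
  have one: "ascent_bound 0 (Y - 1 *\<^sub>C cid)" if "norm Y \<le> 1 / 2"
    for Y :: "('b::complex_normed_vector, 'b) cblinfun"
    using that by (intro ascent_bound_0_large) simp
  have "ascent_bound 0 (X - 1 *\<^sub>C cid)" "ascent_bound 0 (dual_op X - 1 *\<^sub>C cid)"
    using assms norm_dual_op[of X] by (intro one; simp)+
  then have "invertible_op (X - 1 *\<^sub>C cid)"
    unfolding invertible_op_iff dual_op_diff_scaleC by blast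
  then obtain S where S: "\<And>x. capp S (capp (X - 1 *\<^sub>C cid) x) = x" "\<And>x. capp (X - 1 *\<^sub>C cid) (capp S x) = x"
    using invertible_opE by blast
  show ?thesis
  proof (rule that[of "- S"])
    show 1: "capp (- S) (x - capp X x) = x" for x
      using S(1)[of x] by (simp add: capp_simps scaleC_one)
    show 2: "capp (- S) x - capp X (capp (- S) x) = x" for x
      using S(2)[of x] by (simp add: capp_simps scaleC_one)
    show "norm (- S) \<le> 2"
    proof (rule norm_cblinfun_bound)
      fix x
      have "norm (capp (- S) x) \<le> norm x + norm (capp X (capp (- S) x))"
        using norm_triangle_ineq[of x "capp X (capp (- S) x)"] 2[of x] by (simp add: algebra_simps)
      also have "norm (capp X (capp (- S) x)) \<le> 1 / 2 * norm (capp (- S) x)"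
        using order_trans[OF norm_capp mult_right_mono[OF assms norm_ge_zero]] .
      finally show "norm (capp (- S) x) \<le> 2 * norm x" by simp
    qed simp
  qed
qed

lemma capp_commute:
  assumes "S o\<^sub>C T = T o\<^sub>C S"
  shows "capp S (capp T x) = capp T (capp S x)"
  using assms by (metis capp_ccompose)

text \<open>\<open>Q\<close> is the sum of \<open>w^i V^(m-1-i)\<close> over \<open>i < m\<close>;
  as a polynomial in \<open>V\<close> it commutes with everything that commutes with
  \<open>V\<close>.\<close>

lemma power_diff_factor:
  obtains Q where "\<And>x. (capp V ^^ m) x - w ^ m *\<^sub>C x = capp V (capp Q x) - w *\<^sub>C capp Q x"
    "\<And>X. X o\<^sub>C V = V o\<^sub>C X \<Longrightarrow> X o\<^sub>C Q = Q o\<^sub>C X"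
proof (induction m arbitrary: thesis)
  case 0
  show ?case by (rule 0[of 0]) (auto intro!: cblinfun_eqI simp: scaleC_one)
next
  case (Suc m)
  obtain Q where Q: "\<And>x. (capp V ^^ m) x - w ^ m *\<^sub>C x = capp V (capp Q x) - w *\<^sub>C capp Q x"
    "\<And>X. X o\<^sub>C V = V o\<^sub>C X \<Longrightarrow> X o\<^sub>C Q = Q o\<^sub>C X"
    using Suc.IH by blast
  show ?case
  proof (rule Suc.prems[of "V o\<^sub>C Q + w ^ m *\<^sub>C cid"])
    fix x
    have "(capp V ^^ Suc m) x = capp V ((w ^ m *\<^sub>C x) + (capp V (capp Q x) - w *\<^sub>C capp Q x))"
      by (simp flip: Q(1))
    then show "(capp V ^^ Suc m) x - w ^ Suc m *\<^sub>C x
      = capp V (capp (V o\<^sub>C Q + w ^ m *\<^sub>C cid) x) - w *\<^sub>C capp (V o\<^sub>C Q + w ^ m *\<^sub>C cid) x"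
      by (simp add: capp_simps scaleC_add_right scaleC_scaleC)
  next
    fix X assume X: "X o\<^sub>C V = V o\<^sub>C X"
    show "X o\<^sub>C (V o\<^sub>C Q + w ^ m *\<^sub>C cid) = (V o\<^sub>C Q + w ^ m *\<^sub>C cid) o\<^sub>C X"
      by (intro cblinfun_eqI)
        (simp add: capp_simps capp_commute[OF X] capp_commute[OF Q(2)[OF X]])
  qed
qed

text \<open>With \<open>E = cid - S V\<close> one has \<open>V^m E = 0\<close>, so
  \<open>- w^(-m) Q E\<close> solves \<open>(V - w) Y = E\<close>. Adding \<open>S\<close> to this
  solution gives \<open>X\<close> with \<open>(V - w) X = cid - w S\<close>, and the right side is
  invertible for small \<open>w\<close>.\<close>

lemma drazin_invertible_punctured:
  fixes V :: "('a::complex_banach, 'a) cblinfun"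
  assumes "drazin_invertible V"
  obtains e where "0 < e" "\<And>w. w \<noteq> 0 \<Longrightarrow> cmod w < e \<Longrightarrow> invertible_op (V - w *\<^sub>C cid)"
proof -
  obtain S m where S: "V ^\<^sub>C m = V ^\<^sub>C m o\<^sub>C S o\<^sub>C V" "V o\<^sub>C S = S o\<^sub>C V"
    using assms by (auto simp: drazin_invertible_def)
  have VS: "capp V (capp S x) = capp S (capp V x)" for x by (rule capp_commute[OF S(2)])
  have key: "(capp V ^^ m) (x - capp S (capp V x)) = 0" for x
    using arg_cong[OF S(1), of "\<lambda>T. capp T x"] by (simp add: capp_cpower funpow_capp_diff)
  show ?thesis
  \<comment> \<open>The summand 1 keeps the denominator positive for \<open>S = 0\<close>; the
    factor 2 makes the norm of \<open>w S\<close> at most 1/2.\<close>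
  proof (rule that[of "1 / (2 * (norm S + 1))"])
    show "0 < 1 / (2 * (norm S + 1))"
      by (simp add: add_nonneg_pos)
    fix w assume w: "w \<noteq> 0" "cmod w < 1 / (2 * (norm S + 1))"
    obtain Q where Q: "\<And>x. (capp V ^^ m) x - w ^ m *\<^sub>C x = capp V (capp Q x) - w *\<^sub>C capp Q x"
      "\<And>X. X o\<^sub>C V = V o\<^sub>C X \<Longrightarrow> X o\<^sub>C Q = Q o\<^sub>C X"
      using power_diff_factor[of m V w] by blast
    have VQ: "capp V (capp Q x) = capp Q (capp V x)" for x by (rule capp_commute[OF Q(2)]) simp
    have SQ: "capp S (capp Q x) = capp Q (capp S x)" for x
      by (rule capp_commute[OF Q(2)]) (rule S(2)[symmetric])
    define E where "E = cid - S o\<^sub>C V"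
    define X where "X = S - inverse (w ^ m) *\<^sub>C (Q o\<^sub>C E)"
    have E: "capp E x = x - capp S (capp V x)" for x by (simp add: E_def capp_diff)
    have QE: "capp V (capp Q (capp E x)) - w *\<^sub>C capp Q (capp E x) = - (w ^ m *\<^sub>C capp E x)" for x
      using Q(1)[of "capp E x"] key[of x] by (simp add: E)
    have VX: "capp (V - w *\<^sub>C cid) (capp X x) = x - w *\<^sub>C capp S x" for x
    proof -
      have "capp (V - w *\<^sub>C cid) (capp X x) = capp V (capp S x) - w *\<^sub>C capp S x
          - inverse (w ^ m) *\<^sub>C (capp V (capp Q (capp E x)) - w *\<^sub>C capp Q (capp E x))"
        by (simp add: X_def capp_simps complex_vector.scale_right_diff_distrib scaleC_scaleC mult.commute)
      also have "\<dots> = x - w *\<^sub>C capp S x"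
        unfolding QE using w(1) by (simp add: scaleC_scaleC scaleC_one E VS)
      finally show ?thesis .
    qed
    have XV: "capp X (capp V x) = capp V (capp X x)" for x
      by (simp add: X_def capp_simps E VS VQ)
    have "norm (w *\<^sub>C S) \<le> 1 / 2"
    proof -
      have "cmod w * norm S \<le> cmod w * (norm S + 1)" by (intro mult_left_mono) auto
      also have "\<dots> < 1 / 2"
        using w(2) norm_ge_zero[of S] by (simp add: pos_less_divide_eq) (simp add: algebra_simps)
      finally show ?thesis by (simp add: norm_scaleC)
    qed
    then obtain U where U: "\<And>x. capp U (x - capp (w *\<^sub>C S) x) = x"
      "\<And>x. capp U x - capp (w *\<^sub>C S) (capp U x) = x"
      using invertible_one_minus by blast
    show "invertible_op (V - w *\<^sub>C cid)"
    proof (rule invertible_opI)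
      show "(U o\<^sub>C X) o\<^sub>C (V - w *\<^sub>C cid) = cid"
      proof (rule cblinfun_eqI)
        fix x
        have "capp X (capp (V - w *\<^sub>C cid) x) = capp (V - w *\<^sub>C cid) (capp X x)"
          by (simp add: capp_simps XV)
        then show "capp ((U o\<^sub>C X) o\<^sub>C (V - w *\<^sub>C cid)) x = capp cid x"
          using U(1)[of x] by (simp add: VX) (simp add: capp_scaleC)
      qed
      show "(V - w *\<^sub>C cid) o\<^sub>C (X o\<^sub>C U) = cid"
        using U(2) by (intro cblinfun_eqI) (simp add: VX, simp add: capp_scaleC)
    qed
  qed
qed

lemma drazin_invertible_isolated:
  fixes V :: "('a::complex_banach, 'a) cblinfun"
  assumes "drazin_invertible (V - c *\<^sub>C cid)"
  obtains e where "0 < e" "\<And>d. d \<noteq> c \<Longrightarrow> dist d c < e \<Longrightarrow> d \<notin> spectrum V"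
proof -
  obtain e where e: "0 < e"
    "\<And>w. w \<noteq> 0 \<Longrightarrow> cmod w < e \<Longrightarrow> invertible_op (V - c *\<^sub>C cid - w *\<^sub>C cid)"
    using drazin_invertible_punctured[OF assms] by blast
  show ?thesis
  proof (rule that[OF e(1)])
    fix d assume "d \<noteq> c" "dist d c < e"
    then have "invertible_op (V - c *\<^sub>C cid - (d - c) *\<^sub>C cid)" by (intro e(2)) (auto simp: dist_norm)
    moreover have "V - c *\<^sub>C cid - (d - c) *\<^sub>C cid = V - d *\<^sub>C cid"
      by (simp add: complex_vector.scale_left_diff_distrib)
    ultimately show "d \<notin> spectrum V" by (simp add: spectrum_def)
  qed
qed

section \<open>Ideals in commutative algebras of operators\<close>

text \<open>Closure under inverses makes invertibility in the algebra the same as invertibility of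
  the operator, so proper ideals detect points of the operator's own spectrum.\<close>

locale commutative_algebra =
  fixes \<A> :: "('a::complex_banach, 'a) cblinfun set"
  assumes cid_mem: "cid \<in> \<A>"
    and add_mem: "x \<in> \<A> \<Longrightarrow> y \<in> \<A> \<Longrightarrow> x + y \<in> \<A>"
    and scaleC_mem: "x \<in> \<A> \<Longrightarrow> c *\<^sub>C x \<in> \<A>"
    and comp_mem: "x \<in> \<A> \<Longrightarrow> y \<in> \<A> \<Longrightarrow> x o\<^sub>C y \<in> \<A>"
    and commute: "x \<in> \<A> \<Longrightarrow> y \<in> \<A> \<Longrightarrow> x o\<^sub>C y = y o\<^sub>C x"
    and inverse_mem: "x \<in> \<A> \<Longrightarrow> u o\<^sub>C x = cid \<Longrightarrow> x o\<^sub>C u = cid \<Longrightarrow> u \<in> \<A>"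
begin

lemma capp_left_commute: "x \<in> \<A> \<Longrightarrow> y \<in> \<A> \<Longrightarrow> capp x (capp y v) = capp y (capp x v)"
  by (rule capp_commute[OF commute])

lemma diff_mem: "x \<in> \<A> \<Longrightarrow> y \<in> \<A> \<Longrightarrow> x - y \<in> \<A>"
  using add_mem[of x "(-1) *\<^sub>C y"] scaleC_mem[of y "-1"] by simp

lemma zero_mem: "0 \<in> \<A>"
  using scaleC_mem[OF cid_mem, of 0] by simp

lemmas mem_rules = cid_mem add_mem scaleC_mem comp_mem diff_mem zero_mem

definition ideal_of :: "('a, 'a) cblinfun set \<Rightarrow> bool"
  where "ideal_of J \<longleftrightarrow> J \<subseteq> \<A> \<and> 0 \<in> J \<and> (\<forall>x\<in>J. \<forall>y\<in>J. x + y \<in> J) \<and> (\<forall>s\<in>\<A>. \<forall>x\<in>J. s o\<^sub>C x \<in> J)"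

lemma ideal_ofD:
  assumes "ideal_of J"
  shows "x \<in> J \<Longrightarrow> x \<in> \<A>" "0 \<in> J" "x \<in> J \<Longrightarrow> y \<in> J \<Longrightarrow> x + y \<in> J"
    "s \<in> \<A> \<Longrightarrow> x \<in> J \<Longrightarrow> s o\<^sub>C x \<in> J"
  using assms by (auto simp: ideal_of_def)

lemma ideal_of_scaleC:
  assumes "ideal_of J" "x \<in> J"
  shows "c *\<^sub>C x \<in> J"
proof -
  have "(c *\<^sub>C cid) o\<^sub>C x \<in> J" using assms mem_rules by (intro ideal_ofD(4)) auto
  moreover have "(c *\<^sub>C cid) o\<^sub>C x = c *\<^sub>C x" by (intro cblinfun_eqI) (simp add: capp_simps)
  ultimately show ?thesis by simp
qed

lemma ideal_of_diff:
  assumes "ideal_of J" "x \<in> J" "y \<in> J"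
  shows "x - y \<in> J"
  using ideal_ofD(3)[OF assms(1,2) ideal_of_scaleC[OF assms(1,3), of "-1"]] by simp

lemma ideal_of_not_invertible:
  assumes J: "ideal_of J" "cid \<notin> J" and x: "x \<in> J"
  shows "\<not> invertible_op x"
proof
  assume "invertible_op x"
  then obtain u where u: "u o\<^sub>C x = cid" "x o\<^sub>C u = cid" by (auto simp: invertible_op_def)
  have "u \<in> \<A>" using ideal_ofD(1)[OF J(1) x] u by (rule inverse_mem)
  then show False using ideal_ofD(4)[OF J(1) _ x, of u] u J(2) by simp
qed

lemma ideal_of_scalar:
  assumes J: "ideal_of J" "cid \<notin> J" and "c *\<^sub>C cid \<in> J"
  shows "c = 0"
proof (rule ccontr)
  assume "c \<noteq> 0"
  then show False
    using ideal_of_scaleC[OF J(1) assms(3), of "inverse c"] J(2) by (simp add: scaleC_scaleC scaleC_one)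
qed

lemma one_minus_inverse_mem:
  assumes "x \<in> \<A>" "norm x \<le> 1 / 2"
  obtains u where "u \<in> \<A>" "\<And>v. capp u v = v + capp x (capp u v)" "norm u \<le> 2"
proof -
  obtain u where u: "\<And>v. capp u (v - capp x v) = v" "\<And>v. capp u v - capp x (capp u v) = v"
    "norm u \<le> 2"
    using invertible_one_minus[OF assms(2)] by blast
  have "u \<in> \<A>"
  proof (rule inverse_mem)
    show "cid - x \<in> \<A>" by (intro diff_mem cid_mem assms)
    show "u o\<^sub>C (cid - x) = cid" "(cid - x) o\<^sub>C u = cid"
      by (rule cblinfun_eqI; simp add: u capp_diff)+
  qed
  moreover have "capp u v = v + capp x (capp u v)" for v
    using u(2)[of v] by (simp add: algebra_simps)
  ultimately show ?thesis using that u(3) by blast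
qed

text \<open>If \<open>a - \<alpha>\<close> were invertible modulo \<open>J\<close> for every \<open>\<alpha>\<close>, then a functional vanishing on \<open>J\<close>,
  applied to these inverses, would be an entire function that tends to 0 like \<open>-1/\<alpha>\<close>,
  against Liouville's theorem. This plays the role of Gelfand theory.\<close>

lemma ideal_of_spectral_value:
  assumes J: "ideal_of J" "cid \<notin> J" and a: "a \<in> \<A>"
  shows "\<exists>\<alpha>. \<forall>s\<in>\<A>. (a - \<alpha> *\<^sub>C cid) o\<^sub>C s - cid \<notin> J"
proof (rule ccontr)
  assume "\<not> ?thesis"
  then obtain s where s: "\<And>\<alpha>. s \<alpha> \<in> \<A>" "\<And>\<alpha>. (a - \<alpha> *\<^sub>C cid) o\<^sub>C s \<alpha> - cid \<in> J"
    by metis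
  have sub: "complex_vector.subspace J"
    by (intro complex_vector.subspaceI ideal_ofD[OF J(1)] ideal_of_scaleC[OF J(1)])
  \<comment> \<open>Elements within 1/2 of \<open>cid\<close> are invertible in the algebra, so
    \<open>J\<close> keeps a positive distance from \<open>cid\<close> and Hahn-Banach applies to
    \<open>J\<close> itself.\<close>
  have dist: "1 / 2 \<le> norm (cid - x)" if x: "x \<in> J" for x
  proof (rule ccontr)
    assume "\<not> 1 / 2 \<le> norm (cid - x)"
    then obtain u where u: "u \<in> \<A>" "\<And>v. capp u v = v + capp (cid - x) (capp u v)"
      using one_minus_inverse_mem[of "cid - x"] mem_rules ideal_ofD(1)[OF J(1) x]
      by (metis linorder_le_cases)
    have "u o\<^sub>C x = cid"
      using u(2) by (intro cblinfun_eqI) (simp add: capp_left_commute[OF u(1) ideal_ofD(1)[OF J(1) x]] capp_diff)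
    then show False using ideal_ofD(4)[OF J(1) u(1) x] J(2) by simp
  qed
  have "(0::real) < 1 / 2" by simp
  then have "\<exists>\<phi> :: (('a, 'a) cblinfun, complex) cblinfun. (\<forall>x\<in>J. capp \<phi> x = 0) \<and> capp \<phi> cid = 1"
    by (rule hahn_banach_separation[OF sub _ dist]) blast+
  then obtain \<phi> :: "(('a, 'a) cblinfun, complex) cblinfun"
    where \<phi>: "\<And>x. x \<in> J \<Longrightarrow> capp \<phi> x = 0" "capp \<phi> cid = 1"
    by blast
  define f where "f \<alpha> = capp \<phi> (s \<alpha>)" for \<alpha>
  \<comment> \<open>The family \<open>s\<close> is an arbitrary choice with no continuity; but two
    inverses modulo \<open>J\<close> differ by an element of \<open>J\<close>, so \<open>f\<close>
    may be computed from any of them.\<close>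
  have f: "f \<alpha> = capp \<phi> t" if t: "t \<in> \<A>" "(a - \<alpha> *\<^sub>C cid) o\<^sub>C t - cid \<in> J" for \<alpha> t
  proof -
    have "s \<alpha> - t = t o\<^sub>C ((a - \<alpha> *\<^sub>C cid) o\<^sub>C s \<alpha> - cid) - s \<alpha> o\<^sub>C ((a - \<alpha> *\<^sub>C cid) o\<^sub>C t - cid)"
      by (intro cblinfun_eqI)
        (simp add: capp_simps a t(1) s(1) capp_left_commute)
    also have "\<dots> \<in> J"
      by (intro ideal_of_diff ideal_ofD(4) J(1) s t)
    finally have "capp \<phi> (s \<alpha> - t) = 0" by (rule \<phi>(1))
    then show ?thesis by (simp add: f_def capp_diff_right)
  qed
  have deriv: "(f has_field_derivative capp \<phi> (s \<alpha> o\<^sub>C s \<alpha>)) (at \<alpha>)" for \<alpha>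
  proof -
    let ?K = "norm \<phi> * (norm (s \<alpha> o\<^sub>C (s \<alpha> o\<^sub>C s \<alpha>)) * 2)"
    \<comment> \<open>Within this radius \<open>cid - (\<beta> - \<alpha>) s \<alpha>\<close> has an
      inverse \<open>u\<close>, and \<open>s \<alpha> o\<^sub>C u\<close> is an inverse at
      \<open>\<beta>\<close> modulo \<open>J\<close>.\<close>
    define e where "e = 1 / (2 * (norm (s \<alpha>) + 1))"
    have "0 < e" by (simp add: e_def add_nonneg_pos)
    have bound: "norm ((f \<beta> - f \<alpha>) / (\<beta> - \<alpha>) - capp \<phi> (s \<alpha> o\<^sub>C s \<alpha>)) \<le> ?K * norm (\<beta> - \<alpha>)"
      if \<beta>: "\<beta> \<noteq> \<alpha>" "dist \<beta> \<alpha> < e" for \<beta>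
    proof -
      have "norm ((\<beta> - \<alpha>) *\<^sub>C s \<alpha>) \<le> 1 / 2"
      proof -
        have "cmod (\<beta> - \<alpha>) * norm (s \<alpha>) \<le> cmod (\<beta> - \<alpha>) * (norm (s \<alpha>) + 1)"
          by (intro mult_left_mono) auto
        also have "\<dots> < 1 / 2"
          using \<beta>(2) norm_ge_zero[of "s \<alpha>"]
          by (simp add: e_def dist_norm pos_less_divide_eq) (simp add: algebra_simps)
        finally show ?thesis by (simp add: norm_scaleC)
      qed
      then obtain u where u: "u \<in> \<A>" "\<And>v. capp u v = v + capp ((\<beta> - \<alpha>) *\<^sub>C s \<alpha>) (capp u v)" "norm u \<le> 2"
        using one_minus_inverse_mem scaleC_mem[OF s(1)] by metis
      have u_eq: "(\<beta> - \<alpha>) *\<^sub>C capp (s \<alpha>) (capp u v) = capp u v - v" for v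
        using u(2)[of v, unfolded capp_scaleC] by (metis add_diff_cancel_left')
      have u_eq2: "(\<beta> - \<alpha>) *\<^sub>C capp (s \<alpha>) (capp (s \<alpha>) (capp u v)) =
          capp (s \<alpha>) (capp u v) - capp (s \<alpha>) v" for v
        using arg_cong[OF u_eq[of v], of "capp (s \<alpha>)"] by (simp only: capp_scaleC_right capp_diff_right)
      have u_eq3: "(\<beta> - \<alpha>) *\<^sub>C capp (s \<alpha>) (capp (s \<alpha>) (capp (s \<alpha>) (capp u v))) =
          capp (s \<alpha>) (capp (s \<alpha>) (capp u v)) - capp (s \<alpha>) (capp (s \<alpha>) v)" for v
        using arg_cong[OF u_eq2[of v], of "capp (s \<alpha>)"] by (simp only: capp_scaleC_right capp_diff_right)
      have "(a - \<beta> *\<^sub>C cid) o\<^sub>C (s \<alpha> o\<^sub>C u) - cid = u o\<^sub>C ((a - \<alpha> *\<^sub>C cid) o\<^sub>C s \<alpha> - cid)"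
      proof (rule cblinfun_eqI)
        fix v
        have "capp ((a - \<beta> *\<^sub>C cid) o\<^sub>C (s \<alpha> o\<^sub>C u) - cid) v
            = capp (a - \<alpha> *\<^sub>C cid) (capp (s \<alpha>) (capp u v)) - (\<beta> - \<alpha>) *\<^sub>C capp (s \<alpha>) (capp u v) - v"
          by (simp add: capp_simps complex_vector.scale_left_diff_distrib)
        then show "capp ((a - \<beta> *\<^sub>C cid) o\<^sub>C (s \<alpha> o\<^sub>C u) - cid) v
            = capp (u o\<^sub>C ((a - \<alpha> *\<^sub>C cid) o\<^sub>C s \<alpha> - cid)) v"
          unfolding u_eq by (simp add: capp_simps a u(1) s(1) capp_left_commute)
      qed
      also have "\<dots> \<in> J" by (intro ideal_ofD(4) J(1) u(1) s)
      finally have "f \<beta> = capp \<phi> (s \<alpha> o\<^sub>C u)" by (intro f comp_mem u(1) s(1))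
      moreover have "s \<alpha> o\<^sub>C u - s \<alpha> = (\<beta> - \<alpha>) *\<^sub>C ((s \<alpha> o\<^sub>C s \<alpha>) o\<^sub>C u)"
        by (intro cblinfun_eqI) (simp add: capp_diff capp_scaleC u_eq2 u_eq3)
      ultimately have "(f \<beta> - f \<alpha>) / (\<beta> - \<alpha>) = capp \<phi> ((s \<alpha> o\<^sub>C s \<alpha>) o\<^sub>C u)"
        using \<beta>(1) by (simp add: f_def capp_scaleC_right scaleC_complex_def flip: capp_diff_right)
      moreover have "(s \<alpha> o\<^sub>C s \<alpha>) o\<^sub>C u - s \<alpha> o\<^sub>C s \<alpha> = (\<beta> - \<alpha>) *\<^sub>C ((s \<alpha> o\<^sub>C (s \<alpha> o\<^sub>C s \<alpha>)) o\<^sub>C u)"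
        by (intro cblinfun_eqI) (simp add: capp_diff capp_scaleC u_eq2 u_eq3)
      ultimately have "norm ((f \<beta> - f \<alpha>) / (\<beta> - \<alpha>) - capp \<phi> (s \<alpha> o\<^sub>C s \<alpha>))
          = cmod (\<beta> - \<alpha>) * norm (capp \<phi> ((s \<alpha> o\<^sub>C (s \<alpha> o\<^sub>C s \<alpha>)) o\<^sub>C u))"
        by (simp add: capp_scaleC_right norm_scaleC flip: capp_diff_right)
      also have "\<dots> \<le> cmod (\<beta> - \<alpha>) * ?K"
      proof (rule mult_left_mono)
        have "norm (capp \<phi> ((s \<alpha> o\<^sub>C (s \<alpha> o\<^sub>C s \<alpha>)) o\<^sub>C u)) \<le> norm \<phi> * norm ((s \<alpha> o\<^sub>C (s \<alpha> o\<^sub>C s \<alpha>)) o\<^sub>C u)"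
          by (rule norm_capp)
        also have "\<dots> \<le> ?K"
          using u(3) by (intro mult_left_mono order_trans[OF norm_ccompose]) auto
        finally show "norm (capp \<phi> ((s \<alpha> o\<^sub>C (s \<alpha> o\<^sub>C s \<alpha>)) o\<^sub>C u)) \<le> ?K" .
      qed simp
      finally show ?thesis by (simp add: mult.commute)
    qed
    have "((\<lambda>\<beta>. (f \<beta> - f \<alpha>) / (\<beta> - \<alpha>) - capp \<phi> (s \<alpha> o\<^sub>C s \<alpha>)) \<longlongrightarrow> 0) (at \<alpha>)"
    proof (rule Lim_null_comparison)
      show "\<forall>\<^sub>F \<beta> in at \<alpha>. norm ((f \<beta> - f \<alpha>) / (\<beta> - \<alpha>) - capp \<phi> (s \<alpha> o\<^sub>C s \<alpha>)) \<le> ?K * norm (\<beta> - \<alpha>)"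
        unfolding eventually_at using bound \<open>0 < e\<close> by auto
      show "((\<lambda>\<beta>. ?K * norm (\<beta> - \<alpha>)) \<longlongrightarrow> 0) (at \<alpha>)"
        by (auto intro!: tendsto_eq_intros)
    qed
    then show ?thesis
      unfolding has_field_derivative_iff using Lim_null by blast
  qed
  \<comment> \<open>For these \<open>\<alpha>\<close> there is a genuine inverse,
    \<open>- u / \<alpha>\<close> with \<open>u\<close> the inverse of
    \<open>cid - a / \<alpha>\<close>.\<close>
  have large: "\<exists>u. norm u \<le> 2 \<and> f \<alpha> = - inverse \<alpha> * capp \<phi> u \<and> u = cid + inverse \<alpha> *\<^sub>C (a o\<^sub>C u)"
    if \<alpha>: "2 * norm a \<le> cmod \<alpha>" "\<alpha> \<noteq> 0" for \<alpha>
  proof -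
    have "norm (inverse \<alpha> *\<^sub>C a) \<le> 1 / 2"
      using \<alpha> by (simp add: norm_scaleC norm_divide field_simps)
    then obtain u where u: "u \<in> \<A>" "\<And>v. capp u v = v + capp (inverse \<alpha> *\<^sub>C a) (capp u v)" "norm u \<le> 2"
      using one_minus_inverse_mem scaleC_mem[OF a] by metis
    have u_eq: "inverse \<alpha> *\<^sub>C capp a (capp u v) = capp u v - v" for v
      using u(2)[of v, unfolded capp_scaleC] by (metis add_diff_cancel_left')
    have "(a - \<alpha> *\<^sub>C cid) o\<^sub>C ((- inverse \<alpha>) *\<^sub>C u) - cid = 0"
    proof (rule cblinfun_eqI)
      fix v
      have "capp ((a - \<alpha> *\<^sub>C cid) o\<^sub>C ((- inverse \<alpha>) *\<^sub>C u) - cid) v =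
          capp u v - inverse \<alpha> *\<^sub>C capp a (capp u v) - v"
        using \<alpha>(2)
        by (simp add: capp_simps complex_vector.scale_right_diff_distrib scaleC_scaleC scaleC_one)
      then show "capp ((a - \<alpha> *\<^sub>C cid) o\<^sub>C ((- inverse \<alpha>) *\<^sub>C u) - cid) v = capp 0 v"
        by (simp add: u_eq)
    qed
    then have "f \<alpha> = capp \<phi> ((- inverse \<alpha>) *\<^sub>C u)"
      using ideal_ofD(2)[OF J(1)] by (intro f scaleC_mem u(1)) simp
    moreover have "u = cid + inverse \<alpha> *\<^sub>C (a o\<^sub>C u)"
      by (intro cblinfun_eqI) (simp add: capp_simps u_eq)
    ultimately show ?thesis
      using u(3) by (intro exI[of _ u]) (simp only: capp_scaleC_right scaleC_complex_def)
  qed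
  have "(f \<longlongrightarrow> 0) at_infinity"
  proof (rule Lim_null_comparison)
    show "\<forall>\<^sub>F \<alpha> in at_infinity. norm (f \<alpha>) \<le> norm \<phi> * 2 * norm (inverse \<alpha>)"
    proof (rule eventually_at_infinityI[of "2 * norm a + 1"])
      fix \<alpha> :: complex assume "2 * norm a + 1 \<le> norm \<alpha>"
      then have "2 * norm a \<le> cmod \<alpha>" "\<alpha> \<noteq> 0"
        using norm_ge_zero[of a] by (force simp del: norm_ge_zero)+
      then obtain u where u: "norm u \<le> 2" "f \<alpha> = - inverse \<alpha> * capp \<phi> u"
        using large by blast
      have "norm (capp \<phi> u) \<le> norm \<phi> * 2"
        by (rule order_trans[OF norm_capp mult_left_mono[OF u(1) norm_ge_zero]])
      then have "cmod (inverse \<alpha>) * norm (capp \<phi> u) \<le> cmod (inverse \<alpha>) * (norm \<phi> * 2)"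
        by (intro mult_left_mono) auto
      then show "norm (f \<alpha>) \<le> norm \<phi> * 2 * norm (inverse \<alpha>)"
        by (simp add: u(2) norm_mult mult_ac)
    qed
    show "((\<lambda>\<alpha>. norm \<phi> * 2 * norm (inverse \<alpha> :: complex)) \<longlongrightarrow> 0) at_infinity"
      by (intro tendsto_mult_right_zero tendsto_norm_zero tendsto_inverse_0)
  qed
  moreover have "f holomorphic_on UNIV"
    unfolding holomorphic_on_open[OF open_UNIV] using deriv by blast
  ultimately have f0: "f \<alpha> = 0" for \<alpha> by (rule Liouville_weak_0[rotated])
  \<comment> \<open>Since \<open>f\<close> vanishes, \<open>capp \<phi> u = 0\<close>, which forces
    \<open>capp \<phi> (a o\<^sub>C u) = - \<alpha>\<close>; this \<open>\<alpha>\<close> is chosen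
    larger than the bound \<open>2 * norm \<phi> * norm a\<close> for that value.\<close>
  define \<alpha> where "\<alpha> = complex_of_real (2 * norm a + 2 * norm \<phi> * norm a + 1)"
  have cmod: "cmod \<alpha> = 2 * norm a + 2 * norm \<phi> * norm a + 1"
    unfolding \<alpha>_def norm_of_real by (intro abs_of_nonneg) simp
  have "2 * norm a \<le> cmod \<alpha>" "\<alpha> \<noteq> 0"
    using cmod norm_ge_zero[of a] mult_nonneg_nonneg[OF norm_ge_zero[of \<phi>] norm_ge_zero[of a]]
    by (auto simp del: norm_ge_zero)
  then obtain u where u: "norm u \<le> 2" "f \<alpha> = - inverse \<alpha> * capp \<phi> u"
    "u = cid + inverse \<alpha> *\<^sub>C (a o\<^sub>C u)"
    using large by blast
  have "0 = capp \<phi> u" using u(2) f0 \<open>\<alpha> \<noteq> 0\<close> by simp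
  also have "\<dots> = 1 + inverse \<alpha> * capp \<phi> (a o\<^sub>C u)"
    by (subst u(3)) (simp add: capp_add_right capp_scaleC_right \<phi>(2) scaleC_complex_def)
  finally have "capp \<phi> (a o\<^sub>C u) = - \<alpha>"
    using \<open>\<alpha> \<noteq> 0\<close> by (simp add: field_simps add_eq_0_iff)
  then have "cmod \<alpha> \<le> norm \<phi> * norm (a o\<^sub>C u)"
    using norm_capp[of \<phi> "a o\<^sub>C u"] by simp
  also have "\<dots> \<le> norm \<phi> * (norm a * 2)"
    using u(1) by (intro mult_left_mono order_trans[OF norm_ccompose]) auto
  finally show False unfolding cmod using norm_ge_zero[of a] by (simp del: norm_ge_zero)
qed

text \<open>The ideal generated by \<open>J\<close> and \<open>a - \<alpha>\<close> is proper by the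
  choice of \<open>\<alpha>\<close>. A proper ideal contains no invertible operator, so
  \<open>\<alpha>\<close> is in the spectrum.\<close>

lemma ideal_of_extend:
  assumes J: "ideal_of J" "cid \<notin> J" and a: "a \<in> \<A>"
  obtains \<alpha> J' where "ideal_of J'" "cid \<notin> J'" "J \<subseteq> J'" "a - \<alpha> *\<^sub>C cid \<in> J'" "\<alpha> \<in> spectrum a"
proof -
  obtain \<alpha> where \<alpha>: "\<And>s. s \<in> \<A> \<Longrightarrow> (a - \<alpha> *\<^sub>C cid) o\<^sub>C s - cid \<notin> J"
    using ideal_of_spectral_value[OF assms] by blast
  let ?a = "a - \<alpha> *\<^sub>C cid"
  have a': "?a \<in> \<A>" by (intro diff_mem scaleC_mem cid_mem a)
  define J' where "J' = {?a o\<^sub>C s + j | s j. s \<in> \<A> \<and> j \<in> J}"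
  have J'I: "x \<in> J'" if "x = ?a o\<^sub>C s + j" "s \<in> \<A>" "j \<in> J" for x s j
    using that by (auto simp: J'_def)
  have J': "ideal_of J'"
    unfolding ideal_of_def
  proof (intro conjI ballI)
    show "J' \<subseteq> \<A>"
      using a' mem_rules ideal_ofD(1)[OF J(1)] by (auto simp: J'_def)
    show "0 \<in> J'"
      by (rule J'I[OF _ zero_mem ideal_ofD(2)[OF J(1)]]) (intro cblinfun_eqI, simp add: capp_simps)
    fix x assume "x \<in> J'"
    then obtain s j where x: "x = ?a o\<^sub>C s + j" "s \<in> \<A>" "j \<in> J" by (auto simp: J'_def)
    show "x + y \<in> J'" if "y \<in> J'" for y
    proof -
      obtain s' j' where y: "y = ?a o\<^sub>C s' + j'" "s' \<in> \<A>" "j' \<in> J" using \<open>y \<in> J'\<close> by (auto simp: J'_def)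
      show ?thesis
      proof (rule J'I)
        show "x + y = ?a o\<^sub>C (s + s') + (j + j')"
          by (intro cblinfun_eqI) (simp add: x y capp_simps scaleC_add_right)
      qed (use x y mem_rules ideal_ofD(3)[OF J(1)] in auto)
    qed
    show "r o\<^sub>C x \<in> J'" if r: "r \<in> \<A>" for r
    proof (rule J'I)
      show "r o\<^sub>C x = ?a o\<^sub>C (r o\<^sub>C s) + r o\<^sub>C j"
        by (intro cblinfun_eqI) (simp add: x capp_simps capp_left_commute[OF r a])
    qed (use x r mem_rules ideal_ofD(4)[OF J(1)] in auto)
  qed
  have proper: "cid \<notin> J'"
  proof
    assume "cid \<in> J'"
    then obtain s j where s: "cid = ?a o\<^sub>C s + j" "s \<in> \<A>" "j \<in> J" by (auto simp: J'_def)
    have "?a o\<^sub>C s - cid = (-1) *\<^sub>C j" by (subst s(1)) simp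
    then show False using \<alpha>[OF s(2)] ideal_of_scaleC[OF J(1) s(3), of "-1"] by simp
  qed
  have "J \<subseteq> J'"
  proof
    fix j assume j: "j \<in> J"
    show "j \<in> J'"
      by (rule J'I[OF _ zero_mem j]) (intro cblinfun_eqI, simp add: capp_simps)
  qed
  have mem: "?a \<in> J'"
    by (rule J'I[OF _ cid_mem ideal_ofD(2)[OF J(1)]]) (intro cblinfun_eqI, simp add: capp_simps)
  have "\<alpha> \<in> spectrum a"
    unfolding spectrum_def using ideal_of_not_invertible[OF J' proper mem] by simp
  show ?thesis by (rule that) fact+
qed

end

section \<open>Bicommutants and Drazin inverses\<close>

definition bicommutant :: "('a::complex_normed_vector, 'a) cblinfun set \<Rightarrow> ('a, 'a) cblinfun set"
  where "bicommutant S = {X. \<forall>Y. (\<forall>M\<in>S. Y o\<^sub>C M = M o\<^sub>C Y) \<longrightarrow> Y o\<^sub>C X = X o\<^sub>C Y}"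

lemma bicommutant_superset: "M \<in> S \<Longrightarrow> M \<in> bicommutant S"
  by (simp add: bicommutant_def)

lemma bicommutantD: "X \<in> bicommutant S \<Longrightarrow> (\<And>M. M \<in> S \<Longrightarrow> Y o\<^sub>C M = M o\<^sub>C Y) \<Longrightarrow> Y o\<^sub>C X = X o\<^sub>C Y"
  by (simp add: bicommutant_def)

text \<open>This algebra is chosen because it is closed under inverses and, as shown next, under
  Drazin inverses. Its elements commute with those of \<open>S\<close>, hence are admissible test
  operators for each other, which makes it commutative.\<close>

lemma commutative_algebra_bicommutant:
  fixes S :: "('a::complex_banach, 'a) cblinfun set"
  assumes S: "\<And>M N. M \<in> S \<Longrightarrow> N \<in> S \<Longrightarrow> M o\<^sub>C N = N o\<^sub>C M"
  shows "commutative_algebra (bicommutant S)"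
proof
  fix x y u :: "('a, 'a) cblinfun" and c
  show "cid \<in> bicommutant S"
    by (auto simp: bicommutant_def intro!: cblinfun_eqI)
  assume x: "x \<in> bicommutant S"
  show "c *\<^sub>C x \<in> bicommutant S"
    using x by (auto simp: bicommutant_def capp_simps capp_commute intro!: cblinfun_eqI)
  {
    assume y: "y \<in> bicommutant S"
    show "x + y \<in> bicommutant S" "x o\<^sub>C y \<in> bicommutant S"
      using x y by (auto simp: bicommutant_def capp_simps capp_commute intro!: cblinfun_eqI)
    show "x o\<^sub>C y = y o\<^sub>C x"
    proof (rule bicommutantD[OF y])
      show "x o\<^sub>C M = M o\<^sub>C x" if "M \<in> S" for M
        using bicommutantD[OF x S[OF that]] by simp
    qed
  }
  assume u: "u o\<^sub>C x = cid" "x o\<^sub>C u = cid"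
  have ux: "capp u (capp x v) = v" "capp x (capp u v) = v" for v
    using u by (metis capp_ccompose capp_cid)+
  show "u \<in> bicommutant S"
    unfolding bicommutant_def
  proof (intro CollectI allI impI cblinfun_eqI)
    fix Y v assume "\<forall>M\<in>S. Y o\<^sub>C M = M o\<^sub>C Y"
    then have "Y o\<^sub>C x = x o\<^sub>C Y" using x by (auto simp: bicommutant_def)
    then have "capp x (capp Y (capp u v)) = capp Y (capp x (capp u v))" by (simp add: capp_commute)
    then show "capp (Y o\<^sub>C u) v = capp (u o\<^sub>C Y) v"
      using ux by (metis capp_ccompose)
  qed
qed

text \<open>An operator \<open>Y\<close> that commutes with \<open>V\<close> commutes with the idempotent \<open>F = SV\<close>, because \<open>F\<close>
  equals \<open>S\<^sup>mV\<^sup>m\<close> and \<open>V\<^sup>mS\<^sup>m\<close>; hence \<open>SY = SYF = SYVS = FYS = YS\<close>.\<close>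

lemma drazin_inverse_bicommutant:
  assumes V: "V \<in> bicommutant \<S>" and S: "V ^\<^sub>C m = V ^\<^sub>C m o\<^sub>C S o\<^sub>C V" "S o\<^sub>C V o\<^sub>C S = S" "V o\<^sub>C S = S o\<^sub>C V"
  shows "S \<in> bicommutant \<S>"
  unfolding bicommutant_def
proof (intro CollectI allI impI cblinfun_eqI)
  fix Y x assume "\<forall>M\<in>\<S>. Y o\<^sub>C M = M o\<^sub>C Y"
  then have YV: "capp Y (capp V x) = capp V (capp Y x)" for x
    using V by (auto simp: bicommutant_def intro: capp_commute)
  have VS: "capp V (capp S x) = capp S (capp V x)" for x by (rule capp_commute[OF S(3)])
  have SSV: "capp S (capp S (capp V x)) = capp S x" for x by (metis S(2) VS capp_ccompose)
  define F where "F x = capp S (capp V x)" for x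
  \<comment> \<open>Stated for \<open>Suc n\<close>, since at exponent 0 the left side is
    \<open>x\<close> instead of \<open>F x\<close>.\<close>
  have Fn: "(capp S ^^ Suc n) ((capp V ^^ Suc n) x) = F x" for n x
  proof (induction n arbitrary: x)
    case (Suc n)
    have "(capp S ^^ Suc (Suc n)) ((capp V ^^ Suc (Suc n)) x)
        = capp S ((capp S ^^ Suc n) ((capp V ^^ Suc n) (capp V x)))"
      by (simp only: funpow.simps(2)[of "Suc n" "capp S"] funpow_Suc_right[of "Suc n" "capp V"] o_apply)
    also have "\<dots> = F x" unfolding Suc by (simp add: F_def SSV)
    finally show ?case .
  qed (simp add: F_def)
  have Sn: "(capp S ^^ n) (capp V x) = capp V ((capp S ^^ n) x)" for n x
    by (induction n) (simp_all add: VS)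
  have SV_n: "(capp S ^^ n) ((capp V ^^ k) x) = (capp V ^^ k) ((capp S ^^ n) x)" for n k x
    by (induction k) (simp_all add: Sn)
  have VmF: "(capp V ^^ Suc m) (F x) = (capp V ^^ Suc m) x" for x
    using arg_cong[OF S(1), of "\<lambda>T. capp T x"] by (simp add: F_def capp_cpower)
  have YVn: "capp Y ((capp V ^^ n) x) = (capp V ^^ n) (capp Y x)" for n x
    by (induction n) (simp_all add: YV)
  let ?s = "capp S ^^ Suc m" and ?v = "capp V ^^ Suc m"
  have F1: "F x = ?s (?v x)" and F2: "F x = ?v (?s x)" for x
    using Fn[of m x] SV_n[of "Suc m" "Suc m" x] by (simp_all only:)
  have FV: "F (capp V x) = capp V (F x)" for x by (simp add: F_def VS)
  have FVn: "F ((capp V ^^ n) x) = (capp V ^^ n) (F x)" for n x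
    by (induction n) (simp_all add: FV)
  have FY: "F (capp Y x) = F (capp Y (F x))" for x
  proof -
    have "F (capp Y (F x)) = ?s (capp Y (?v (F x)))" unfolding F1[of "capp Y _"] YVn ..
    also have "\<dots> = F (capp Y x)" unfolding VmF F1[of "capp Y x"] YVn ..
    finally show ?thesis ..
  qed
  have YF: "capp Y (F x) = F (capp Y (F x))" for x
  proof -
    have "capp Y (F x) = ?v (capp Y (?s x))" unfolding F2[of x] YVn ..
    then have "F (capp Y (F x)) = F (?v (capp Y (?s x)))" by simp
    also have "\<dots> = ?v (capp Y (?s x))" unfolding FVn by (rule VmF)
    finally show ?thesis using \<open>capp Y (F x) = _\<close> by simp
  qed
  have comm: "capp Y (F x) = F (capp Y x)" for x using FY YF by metis
  have "capp S (capp Y x) = capp S (F (capp Y x))" by (simp add: F_def SSV)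
  also have "\<dots> = capp S (capp Y (capp V (capp S x)))" unfolding comm[symmetric] by (simp add: F_def VS)
  also have "\<dots> = F (capp Y (capp S x))" unfolding YV F_def ..
  also have "\<dots> = capp Y (capp S x)" unfolding comm[symmetric] by (simp add: F_def VS SSV)
  finally show "capp (Y o\<^sub>C S) x = capp (S o\<^sub>C Y) x" by simp
qed

section \<open>Products of commuting operators\<close>

lemma funpow_ccompose:
  assumes "L o\<^sub>C R = R o\<^sub>C L"
  shows "(capp (L o\<^sub>C R) ^^ n) x = (capp L ^^ n) ((capp R ^^ n) x)"
proof -
  have comm: "capp R ((capp L ^^ k) y) = (capp L ^^ k) (capp R y)" for k y
    by (induction k) (simp_all add: capp_commute[OF assms[symmetric]])
  show ?thesis by (induction n) (simp_all add: comm)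
qed

lemma ascent_bound_ccompose:
  assumes comm: "L o\<^sub>C R = R o\<^sub>C L" and L: "ascent_bound m L" and R: "ascent_bound m R"
  shows "ascent_bound m (L o\<^sub>C R)"
proof -
  obtain C where C: "0 < C" "\<And>x. norm ((capp L ^^ m) x) \<le> C * norm (capp L ((capp L ^^ m) x))"
    using ascent_boundE[OF L] by blast
  obtain D where D: "\<And>x. norm ((capp R ^^ m) x) \<le> D * norm (capp R ((capp R ^^ m) x))"
    using ascent_boundE[OF R] by blast
  have LR: "(capp L ^^ j) ((capp R ^^ k) x) = (capp R ^^ k) ((capp L ^^ j) x)" for j k x
  proof -
    have *: "(capp R ^^ k) (capp L x) = capp L ((capp R ^^ k) x)" for k x
      by (induction k) (simp_all add: capp_commute[OF comm])
    show ?thesis by (induction j) (simp_all add: *)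
  qed
  have "norm ((capp (L o\<^sub>C R) ^^ m) x) \<le> (C * D) * norm ((capp (L o\<^sub>C R) ^^ Suc m) x)" for x
  proof -
    have "norm ((capp (L o\<^sub>C R) ^^ m) x) \<le> C * norm ((capp L ^^ Suc m) ((capp R ^^ m) x))"
      using C(2) by (simp add: funpow_ccompose[OF comm])
    also have "\<dots> = C * norm ((capp R ^^ m) ((capp L ^^ Suc m) x))"
      unfolding LR ..
    also have "\<dots> \<le> C * (D * norm ((capp R ^^ Suc m) ((capp L ^^ Suc m) x)))"
      using C(1) D by (intro mult_left_mono) auto
    also have "\<dots> = (C * D) * norm ((capp (L o\<^sub>C R) ^^ Suc m) x)"
      unfolding funpow_ccompose[OF comm] LR by (simp only: mult.assoc)
    finally show ?thesis .
  qed
  then show ?thesis unfolding ascent_bound_def by (intro exI[of _ "C * D"]) simp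
qed

lemma dual_op_commute:
  assumes "L o\<^sub>C R = R o\<^sub>C L"
  shows "dual_op (L o\<^sub>C R) = dual_op L o\<^sub>C dual_op R" "dual_op L o\<^sub>C dual_op R = dual_op R o\<^sub>C dual_op L"
  using capp_commute[OF assms] by (auto intro!: cblinfun_eqI simp: capp_dual_op)

lemma drazin_invertible_ccompose:
  fixes L R :: "('a::complex_banach, 'a) cblinfun"
  assumes comm: "L o\<^sub>C R = R o\<^sub>C L" and "drazin_invertible L" "drazin_invertible R"
  shows "drazin_invertible (L o\<^sub>C R)"
proof -
  obtain m n where "ascent_bound m L" "ascent_bound m (dual_op L)"
    "ascent_bound n R" "ascent_bound n (dual_op R)"
    using assms by (auto simp: drazin_invertible_iff_ascent_bound)
  then have "ascent_bound (max m n) L" "ascent_bound (max m n) (dual_op L)"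
    "ascent_bound (max m n) R" "ascent_bound (max m n) (dual_op R)"
    by (auto intro: ascent_bound_mono)
  then show ?thesis
    unfolding drazin_invertible_iff_ascent_bound dual_op_commute(1)[OF comm]
    by (intro exI[of _ "max m n"] conjI ascent_bound_ccompose comm dual_op_commute(2)[OF comm])
qed

text \<open>In the expanded power every term has at least \<open>p\<close> factors \<open>U\<close>
  or at least \<open>q\<close> factors \<open>V\<close>; the induction on \<open>p + q\<close>
  spends one factor at a time.\<close>

lemma funpow_nilpotent_add:
  assumes comm: "U o\<^sub>C V = V o\<^sub>C U"
  shows "(capp U ^^ p) x = 0 \<Longrightarrow> (capp V ^^ q) x = 0 \<Longrightarrow> (capp (U + V) ^^ (p + q)) x = 0"
proof (induction "p + q" arbitrary: p q x)
  case 0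
  then show ?case by simp
next
  case (Suc k)
  show ?case
  proof (cases "p = 0 \<or> q = 0")
    case True
    then have "x = 0" using Suc.prems by auto
    then show ?thesis by (simp add: funpow_capp_zero)
  next
    case False
    have cU: "(capp V ^^ n) (capp U y) = capp U ((capp V ^^ n) y)" for n y
      by (induction n) (simp_all add: capp_commute[OF comm])
    have cV: "(capp U ^^ n) (capp V y) = capp V ((capp U ^^ n) y)" for n y
      by (induction n) (simp_all add: capp_commute[OF comm])
    obtain p' q' where pq: "p = Suc p'" "q = Suc q'" using False by (meson not0_implies_Suc)
    have 1: "(capp (U + V) ^^ (p' + q)) (capp U x) = 0"
    proof (rule Suc.hyps(1))
      show "(capp U ^^ p') (capp U x) = 0" using Suc.prems(1) by (simp add: pq funpow_swap1)
      show "(capp V ^^ q) (capp U x) = 0" by (simp only: cU Suc.prems(2) capp_zero)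
    qed (use Suc.hyps(2) pq in simp)
    have 2: "(capp (U + V) ^^ (p + q')) (capp V x) = 0"
    proof (rule Suc.hyps(1))
      show "(capp U ^^ p) (capp V x) = 0" by (simp only: cV Suc.prems(1) capp_zero)
      show "(capp V ^^ q') (capp V x) = 0" using Suc.prems(2) by (simp add: pq funpow_swap1)
    qed (use Suc.hyps(2) pq in simp)
    have "(capp (U + V) ^^ (p + q)) x = (capp (U + V) ^^ (p' + q)) (capp (U + V) x)"
      by (simp add: pq(1) funpow_swap1)
    also have "\<dots> = (capp (U + V) ^^ (p + q')) (capp V x)"
      unfolding capp_add funpow_capp_add 1 by (simp add: pq)
    also have "\<dots> = 0" by (rule 2)
    finally show ?thesis .
  qed
qed

text \<open>Modulo the final ideal \<open>L\<close> is \<open>\<alpha>\<close> and \<open>R\<close>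
  is \<open>\<beta>\<close>, so \<open>L R - \<mu>\<close> is the scalar
  \<open>\<alpha> * \<beta> - \<mu>\<close>; a proper ideal contains no nonzero scalar.\<close>

lemma (in commutative_algebra) ideal_of_extend_pair:
  assumes J: "ideal_of J" "cid \<notin> J" and L: "L \<in> \<A>" and R: "R \<in> \<A>"
    and t: "L o\<^sub>C R - \<mu> *\<^sub>C cid \<in> J"
  obtains \<alpha> \<beta> J' where "ideal_of J'" "cid \<notin> J'" "J \<subseteq> J'"
    "L - \<alpha> *\<^sub>C cid \<in> J'" "R - \<beta> *\<^sub>C cid \<in> J'"
    "\<alpha> \<in> spectrum L" "\<beta> \<in> spectrum R" "\<alpha> * \<beta> = \<mu>"
proof -
  obtain \<alpha> J1 where 1: "ideal_of J1" "cid \<notin> J1" "J \<subseteq> J1" "L - \<alpha> *\<^sub>C cid \<in> J1" "\<alpha> \<in> spectrum L"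
    using ideal_of_extend[OF J L] by blast
  obtain \<beta> J2 where 2: "ideal_of J2" "cid \<notin> J2" "J1 \<subseteq> J2" "R - \<beta> *\<^sub>C cid \<in> J2" "\<beta> \<in> spectrum R"
    using ideal_of_extend[OF 1(1,2) R] by blast
  have mem: "L o\<^sub>C R - \<mu> *\<^sub>C cid \<in> J2" "L - \<alpha> *\<^sub>C cid \<in> J2" using t 1(3,4) 2(3) by blast+
  have "L o\<^sub>C R - \<mu> *\<^sub>C cid - R o\<^sub>C (L - \<alpha> *\<^sub>C cid) - \<alpha> *\<^sub>C (R - \<beta> *\<^sub>C cid) \<in> J2"
    by (intro ideal_of_diff[OF 2(1)] ideal_ofD(4)[OF 2(1)] ideal_of_scaleC[OF 2(1)] R mem 2(4))
  also have "L o\<^sub>C R - \<mu> *\<^sub>C cid - R o\<^sub>C (L - \<alpha> *\<^sub>C cid) - \<alpha> *\<^sub>C (R - \<beta> *\<^sub>C cid)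
      = (\<alpha> * \<beta> - \<mu>) *\<^sub>C cid"
    by (intro cblinfun_eqI)
      (simp add: capp_simps capp_left_commute[OF L R] complex_vector.scale_right_diff_distrib
        complex_vector.scale_left_diff_distrib scaleC_scaleC)
  finally have "\<alpha> * \<beta> - \<mu> = 0" using ideal_of_scalar[OF 2(1,2)] by blast
  then show ?thesis using that[OF 2(1,2) _ mem(2) 2(4) 1(5) 2(5)] 1(3) 2(3) by simp
qed

lemma commutative_algebra_bicommutant_pair:
  fixes L R :: "('a::complex_banach, 'a) cblinfun"
  assumes "L o\<^sub>C R = R o\<^sub>C L"
  shows "commutative_algebra (bicommutant {L, R})"
  using assms by (intro commutative_algebra_bicommutant) auto

text \<open>The ideal to extend is the principal one generated by \<open>L R - \<mu>\<close>, proper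
  because this operator is not invertible.\<close>

lemma spectrum_ccompose:
  fixes L R :: "('a::complex_banach, 'a) cblinfun"
  assumes comm: "L o\<^sub>C R = R o\<^sub>C L" and \<mu>: "\<mu> \<in> spectrum (L o\<^sub>C R)"
  obtains \<alpha> \<beta> where "\<alpha> \<in> spectrum L" "\<beta> \<in> spectrum R" "\<alpha> * \<beta> = \<mu>"
proof -
  interpret commutative_algebra "bicommutant {L, R}"
    using comm by (rule commutative_algebra_bicommutant_pair)
  let ?\<A> = "bicommutant {L, R}"
  let ?t = "L o\<^sub>C R - \<mu> *\<^sub>C cid"
  have L: "L \<in> ?\<A>" and R: "R \<in> ?\<A>" by (simp_all add: bicommutant_superset)
  have t: "?t \<in> ?\<A>" by (intro mem_rules L R)
  define J where "J = (\<lambda>s. s o\<^sub>C ?t) ` ?\<A>"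
  have J: "ideal_of J"
    unfolding ideal_of_def J_def
  proof (intro conjI ballI; (elim imageE)?)
    show "(\<lambda>s. s o\<^sub>C ?t) ` ?\<A> \<subseteq> ?\<A>" using comp_mem t by blast
    show "0 \<in> (\<lambda>s. s o\<^sub>C ?t) ` ?\<A>"
      by (rule image_eqI[OF _ zero_mem]) (auto intro: cblinfun_eqI)
    fix x s assume s: "x = s o\<^sub>C ?t" "s \<in> ?\<A>"
    show "x + y \<in> (\<lambda>s. s o\<^sub>C ?t) ` ?\<A>" if "y = s' o\<^sub>C ?t" "s' \<in> ?\<A>" for y s'
      using s that by (intro image_eqI[of _ _ "s + s'"] add_mem) (auto intro!: cblinfun_eqI simp: capp_add)
    show "r o\<^sub>C x \<in> (\<lambda>s. s o\<^sub>C ?t) ` ?\<A>" if "r \<in> ?\<A>" for r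
      using s that by (intro image_eqI[of _ _ "r o\<^sub>C s"] comp_mem) (auto intro!: cblinfun_eqI)
  qed
  have proper: "cid \<notin> J"
  proof
    assume "cid \<in> J"
    then obtain s where s: "s \<in> ?\<A>" "cid = s o\<^sub>C ?t" by (auto simp: J_def)
    then have "invertible_op ?t"
      using commute[OF s(1) t] by (auto simp: invertible_op_def)
    then show False using \<mu> by (simp add: spectrum_def)
  qed
  have "?t \<in> J"
    unfolding J_def by (rule image_eqI[OF _ cid_mem]) (auto intro: cblinfun_eqI)
  show ?thesis using ideal_of_extend_pair[OF J proper L R \<open>?t \<in> J\<close>] that by metis
qed

text \<open>Splits \<open>cid\<close>, inside the algebra, into \<open>S V\<close>, which lies in
  every ideal containing \<open>V\<close>, and a complement that a power of \<open>V\<close>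
  annihilates.\<close>

lemma drazin_idempotent:
  fixes V :: "('a::complex_banach, 'a) cblinfun"
  assumes V: "V \<in> bicommutant \<S>" and "drazin_invertible V"
  obtains m S where "S \<in> bicommutant \<S>" "\<And>x. (capp V ^^ m) (x - capp S (capp V x)) = 0"
proof -
  obtain S m where S: "V ^\<^sub>C m = V ^\<^sub>C m o\<^sub>C S o\<^sub>C V" "S o\<^sub>C V o\<^sub>C S = S" "V o\<^sub>C S = S o\<^sub>C V"
    using assms(2) by (auto simp: drazin_invertible_def)
  have "S \<in> bicommutant \<S>" by (rule drazin_inverse_bicommutant[OF V S])
  moreover have "(capp V ^^ m) (x - capp S (capp V x)) = 0" for x
    using arg_cong[OF S(1), of "\<lambda>T. capp T x"] by (simp add: capp_cpower funpow_capp_diff)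
  ultimately show ?thesis using that by blast
qed

text \<open>The elements \<open>x\<close> with \<open>xt\<^sup>m \<in> t\<^sup>m\<^sup>+\<^sup>1\<A>\<close> for some \<open>m\<close> form an ideal containing \<open>t = LR - \<mu>\<close>.
  A proper extension of it by some \<open>L - \<alpha>\<close> and \<open>R - \<beta>\<close> would force \<open>\<alpha>\<beta> = \<mu>\<close>; but then the
  product of the spectral idempotents at \<open>\<alpha>\<close> and \<open>\<beta>\<close>, on which \<open>t\<close> is nilpotent, lies in the
  ideal, while their complements lie in the extension.\<close>

lemma drazin_invertible_product_minus:
  fixes L R :: "('a::complex_banach, 'a) cblinfun"
  assumes comm: "L o\<^sub>C R = R o\<^sub>C L"
    and drazin: "\<And>\<alpha> \<beta>. \<alpha> \<in> spectrum L \<Longrightarrow> \<beta> \<in> spectrum R \<Longrightarrow> \<alpha> * \<beta> = \<mu> \<Longrightarrow>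
      drazin_invertible (L - \<alpha> *\<^sub>C cid) \<and> drazin_invertible (R - \<beta> *\<^sub>C cid)"
  shows "drazin_invertible (L o\<^sub>C R - \<mu> *\<^sub>C cid)"
proof (rule ccontr)
  interpret commutative_algebra "bicommutant {L, R}"
    using comm by (rule commutative_algebra_bicommutant_pair)
  let ?\<A> = "bicommutant {L, R}"
  let ?t = "L o\<^sub>C R - \<mu> *\<^sub>C cid"
  assume not_drazin: "\<not> drazin_invertible ?t"
  have L: "L \<in> ?\<A>" and R: "R \<in> ?\<A>" by (simp_all add: bicommutant_superset)
  have t: "?t \<in> ?\<A>" by (intro mem_rules L R)
  have tn: "capp s ((capp ?t ^^ n) x) = (capp ?t ^^ n) (capp s x)" if "s \<in> ?\<A>" for s n x
    by (induction n) (simp_all add: capp_left_commute[OF that t])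
  define K where "K m x \<longleftrightarrow> (\<exists>s\<in>?\<A>. \<forall>v. (capp ?t ^^ m) (capp x v) = (capp ?t ^^ Suc m) (capp s v))" for m x
  \<comment> \<open>Raising the exponent brings the witnesses of two elements to a common one, so
    that they can be added.\<close>
  have K_mono: "K (k + m) x" if "K m x" for k m x
  proof -
    obtain s where s: "s \<in> ?\<A>" "\<And>v. (capp ?t ^^ m) (capp x v) = (capp ?t ^^ Suc m) (capp s v)"
      using \<open>K m x\<close> by (auto simp: K_def)
    have "(capp ?t ^^ (k + m)) (capp x v) = (capp ?t ^^ Suc (k + m)) (capp s v)" for v
    proof -
      have "(capp ?t ^^ (k + m)) (capp x v) = (capp ?t ^^ k) ((capp ?t ^^ Suc m) (capp s v))"
        unfolding funpow_add o_apply s(2) ..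
      also have "\<dots> = (capp ?t ^^ (k + Suc m)) (capp s v)" unfolding funpow_add o_apply ..
      finally show ?thesis unfolding add_Suc_right .
    qed
    with s(1) show ?thesis unfolding K_def by blast
  qed
  define J where "J = {x \<in> ?\<A>. \<exists>m. K m x}"
  have J: "ideal_of J"
    unfolding ideal_of_def
  proof (intro conjI ballI)
    show "J \<subseteq> ?\<A>" by (auto simp: J_def)
    show "0 \<in> J"
      unfolding J_def K_def using zero_mem
      by (auto simp: funpow_capp_zero intro!: exI[of _ 0] bexI[of _ 0])
    fix x assume x: "x \<in> J"
    then obtain m where m: "K m x" by (auto simp: J_def)
    show "x + y \<in> J" if y: "y \<in> J" for y
    proof -
      obtain n where n: "K n y" using y by (auto simp: J_def)
      obtain s where s: "s \<in> ?\<A>" "\<And>v. (capp ?t ^^ (n + m)) (capp x v) = (capp ?t ^^ Suc (n + m)) (capp s v)"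
        using K_mono[OF m, of n] by (auto simp: K_def)
      obtain s' where s': "s' \<in> ?\<A>" "\<And>v. (capp ?t ^^ (n + m)) (capp y v) = (capp ?t ^^ Suc (n + m)) (capp s' v)"
        using K_mono[OF n, of m] unfolding add.commute[of m] by (auto simp: K_def)
      have "K (n + m) (x + y)"
        unfolding K_def
      proof (intro bexI allI)
        show "(capp ?t ^^ (n + m)) (capp (x + y) v) = (capp ?t ^^ Suc (n + m)) (capp (s + s') v)" for v
          unfolding capp_add funpow_capp_add s(2) s'(2) ..
      qed (intro add_mem s s')
      then show ?thesis using x y add_mem by (auto simp: J_def)
    qed
    show "r o\<^sub>C x \<in> J" if r: "r \<in> ?\<A>" for r
    proof -
      obtain s where s: "s \<in> ?\<A>" "\<And>v. (capp ?t ^^ m) (capp x v) = (capp ?t ^^ Suc m) (capp s v)"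
        using m by (auto simp: K_def)
      have "K m (r o\<^sub>C x)"
        unfolding K_def
      proof (intro bexI allI)
        show "(capp ?t ^^ m) (capp (r o\<^sub>C x) v) = (capp ?t ^^ Suc m) (capp (r o\<^sub>C s) v)" for v
          unfolding capp_ccompose tn[OF r, symmetric] s(2) ..
      qed (intro comp_mem s r)
      then show ?thesis using x r comp_mem by (auto simp: J_def)
    qed
  qed
  have proper: "cid \<notin> J"
  proof
    assume "cid \<in> J"
    then obtain m s where s: "s \<in> ?\<A>" "\<And>v. (capp ?t ^^ m) v = (capp ?t ^^ Suc m) (capp s v)"
      by (auto simp: J_def K_def)
    have "?t ^\<^sub>C m = ?t ^\<^sub>C m o\<^sub>C s o\<^sub>C ?t"
    proof (rule cblinfun_eqI)
      fix v
      have "(capp ?t ^^ m) v = (capp ?t ^^ m) (capp ?t (capp s v))"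
        using s(2)[of v] by (simp only: funpow_Suc_right o_apply)
      then show "capp (?t ^\<^sub>C m) v = capp (?t ^\<^sub>C m o\<^sub>C s o\<^sub>C ?t) v"
        unfolding capp_ccompose capp_cpower capp_left_commute[OF s(1) t] .
    qed
    then have "drazin_invertible ?t"
      unfolding drazin_invertible_iff_ascent_bound
      using commuting_imp_ascent_bound[of ?t m s] commute[OF t s(1)] by blast
    with not_drazin show False ..
  qed
  have "?t \<in> J"
    unfolding J_def K_def using t cid_mem by (auto intro!: exI[of _ 0] bexI[of _ cid])
  obtain \<alpha> \<beta> J' where J': "ideal_of J'" "cid \<notin> J'" "J \<subseteq> J'"
    and mem: "L - \<alpha> *\<^sub>C cid \<in> J'" "R - \<beta> *\<^sub>C cid \<in> J'"
    and spec: "\<alpha> \<in> spectrum L" "\<beta> \<in> spectrum R" and \<alpha>\<beta>: "\<alpha> * \<beta> = \<mu>"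
    using ideal_of_extend_pair[OF J proper L R \<open>?t \<in> J\<close>] by metis
  define V where "V = L - \<alpha> *\<^sub>C cid"
  define W where "W = R - \<beta> *\<^sub>C cid"
  have V: "V \<in> J'" "V \<in> ?\<A>" and W: "W \<in> J'" "W \<in> ?\<A>"
    using mem ideal_ofD(1)[OF J'(1)] unfolding V_def W_def by blast+
  have "drazin_invertible V" "drazin_invertible W"
    using drazin[OF spec \<alpha>\<beta>] by (simp_all add: V_def W_def)
  then obtain p S q S' where S: "S \<in> ?\<A>" "\<And>x. (capp V ^^ p) (x - capp S (capp V x)) = 0"
    and S': "S' \<in> ?\<A>" "\<And>x. (capp W ^^ q) (x - capp S' (capp W x)) = 0"
    using drazin_idempotent[OF V(2)] drazin_idempotent[OF W(2)] by metis
  define E where "E = cid - S o\<^sub>C V"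
  define F where "F = cid - S' o\<^sub>C W"
  have E: "E \<in> ?\<A>" and F: "F \<in> ?\<A>"
    unfolding E_def F_def by (intro mem_rules S S' V W)+
  \<comment> \<open>As \<open>\<mu> = \<alpha> * \<beta>\<close>, the operator is a sum of two
    commuting terms. A power of the first annihilates the range of \<open>E\<close> and a power of
    the second that of \<open>F\<close>, so their sum is nilpotent on the range of
    \<open>E F\<close>.\<close>
  have t_eq: "?t = R o\<^sub>C V + \<alpha> *\<^sub>C W"
    by (intro cblinfun_eqI) (simp add: V_def W_def capp_simps capp_left_commute[OF L R]
        complex_vector.scale_right_diff_distrib scaleC_scaleC \<alpha>\<beta>)
  have "K (p + q) (E o\<^sub>C F)"
    unfolding K_def
  proof (intro bexI allI)
    fix v
    have Rp: "(capp (R o\<^sub>C V) ^^ p) (capp E w) = 0" for w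
      unfolding funpow_ccompose[OF commute[OF R V(2)]] E_def
      by (simp add: capp_diff S(2) funpow_capp_zero)
    have Wq: "(capp (\<alpha> *\<^sub>C W) ^^ q) (capp F w) = 0" for w
    proof -
      have "\<alpha> *\<^sub>C W = (\<alpha> *\<^sub>C cid) o\<^sub>C W" by (intro cblinfun_eqI) (simp add: capp_simps)
      then show ?thesis
        using funpow_ccompose[OF commute[OF scaleC_mem[OF cid_mem] W(2)]]
        by (simp add: F_def capp_diff S'(2) funpow_capp_zero)
    qed
    have "(capp ?t ^^ (p + q)) (capp (E o\<^sub>C F) v) = 0"
      unfolding t_eq
    proof (rule funpow_nilpotent_add)
      show "R o\<^sub>C V o\<^sub>C (\<alpha> *\<^sub>C W) = (\<alpha> *\<^sub>C W) o\<^sub>C (R o\<^sub>C V)"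
        by (intro commute mem_rules R V W)
      show "(capp (R o\<^sub>C V) ^^ p) (capp (E o\<^sub>C F) v) = 0" using Rp by simp
      show "(capp (\<alpha> *\<^sub>C W) ^^ q) (capp (E o\<^sub>C F) v) = 0"
        using Wq by (simp add: capp_left_commute[OF E F])
    qed
    then show "(capp ?t ^^ (p + q)) (capp (E o\<^sub>C F) v) = (capp ?t ^^ Suc (p + q)) (capp 0 v)"
      by (simp only: capp_zero_left funpow_capp_zero)
  qed (rule zero_mem)
  then have EF: "E o\<^sub>C F \<in> J'"
    using J'(3) comp_mem[OF E F] by (auto simp: J_def)
  \<comment> \<open>The identity is \<open>E F + S V + E S' W\<close>: the first term is in the
    ideal by nilpotency, the others because of their factors \<open>V\<close> and
    \<open>W\<close>.\<close>
  have "E o\<^sub>C F + (S o\<^sub>C V + E o\<^sub>C (S' o\<^sub>C W)) \<in> J'"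
    by (intro ideal_ofD(3)[OF J'(1)] ideal_ofD(4)[OF J'(1)] EF S(1) S'(1) V(1) W(1) E)
  also have "E o\<^sub>C F + (S o\<^sub>C V + E o\<^sub>C (S' o\<^sub>C W)) = cid"
    by (intro cblinfun_eqI) (simp add: E_def F_def capp_simps)
  finally show False using J'(2) by blast
qed

section \<open>Polynomials in an operator\<close>

lemma capp_sum: "capp (\<Sum>i\<in>I. f i) x = (\<Sum>i\<in>I. capp (f i) x)"
  by (induction I rule: infinite_finite_induct) (simp_all add: capp_add)

lemma capp_sum_right: "capp T (\<Sum>i\<in>I. f i) = (\<Sum>i\<in>I. capp T (f i))"
  by (induction I rule: infinite_finite_induct) (simp_all add: capp_add_right)

lemma capp_poly_op:
  assumes "degree P \<le> n"
  shows "capp (poly_op P T) x = (\<Sum>i\<le>n. coeff P i *\<^sub>C (capp T ^^ i) x)"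
proof -
  have "capp (poly_op P T) x = (\<Sum>i\<le>degree P. coeff P i *\<^sub>C (capp T ^^ i) x)"
    by (simp add: poly_op_def capp_sum capp_scaleC capp_cpower)
  also have "\<dots> = (\<Sum>i\<le>n. coeff P i *\<^sub>C (capp T ^^ i) x)"
    using assms by (intro sum.mono_neutral_left) (auto simp: coeff_eq_0)
  finally show ?thesis .
qed

lemma poly_op_zero: "poly_op 0 T = 0"
  by (simp add: poly_op_def)

lemma poly_op_add: "poly_op (P + Q) T = poly_op P T + poly_op Q T"
proof (rule cblinfun_eqI)
  fix x
  let ?n = "max (degree P) (degree Q)"
  show "capp (poly_op (P + Q) T) x = capp (poly_op P T + poly_op Q T) x"
    by (simp add: capp_poly_op[of P ?n] capp_poly_op[of Q ?n] capp_poly_op[of "P + Q" ?n]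
        capp_add degree_add_le scaleC_add_left sum.distrib)
qed

lemma poly_op_smult: "poly_op (smult c P) T = c *\<^sub>C poly_op P T"
  by (rule cblinfun_eqI)
    (simp add: capp_poly_op[of P "degree P"] capp_poly_op[of "smult c P" "degree P"] capp_scaleC
      degree_smult_le complex_vector.scale_sum_right scaleC_scaleC)

lemma poly_op_pCons: "poly_op (pCons a P) T = a *\<^sub>C cid + T o\<^sub>C poly_op P T"
proof (rule cblinfun_eqI)
  fix x
  have "capp (poly_op (pCons a P) T) x = (\<Sum>i\<le>Suc (degree P). coeff (pCons a P) i *\<^sub>C (capp T ^^ i) x)"
    by (rule capp_poly_op[OF degree_pCons_le])
  also have "\<dots> = a *\<^sub>C x + (\<Sum>i\<le>degree P. coeff P i *\<^sub>C capp T ((capp T ^^ i) x))"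
    by (simp add: sum.atMost_Suc_shift del: sum.atMost_Suc)
  also have "\<dots> = capp (a *\<^sub>C cid + T o\<^sub>C poly_op P T) x"
    by (simp add: capp_add capp_scaleC capp_poly_op[OF order_refl] capp_sum_right capp_scaleC_right)
  finally show "capp (poly_op (pCons a P) T) x = capp (a *\<^sub>C cid + T o\<^sub>C poly_op P T) x" .
qed

lemma poly_op_mult: "poly_op (P * Q) T = poly_op P T o\<^sub>C poly_op Q T"
proof (induction P)
  case 0
  show ?case by (rule cblinfun_eqI) (simp add: poly_op_zero)
next
  case (pCons a P)
  then show ?case
    by (intro cblinfun_eqI)
      (simp add: mult_pCons_left poly_op_add poly_op_smult poly_op_pCons capp_simps)
qed

lemma poly_op_linear_power:
  "capp (poly_op ([:- \<alpha>, 1:] ^ m) T) x = (capp (T - \<alpha> *\<^sub>C cid) ^^ m) x"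
proof (induction m)
  case 0
  show ?case by (simp add: one_pCons poly_op_pCons poly_op_zero capp_simps scaleC_one)
next
  case (Suc m)
  have "poly_op [:- \<alpha>, 1:] T = T - \<alpha> *\<^sub>C cid"
    by (rule cblinfun_eqI) (simp add: poly_op_pCons poly_op_zero capp_simps scaleC_one)
  with Suc show ?case by (simp only: power_Suc poly_op_mult capp_ccompose funpow.simps o_apply)
qed

text \<open>Multiplying by the variable makes the degree positive, so that nonzero constants are
  covered too.\<close>

lemma not_algebraic_poly_op:
  assumes "\<not> algebraic_op T" "P \<noteq> 0"
  shows "poly_op P T \<noteq> 0"
proof
  assume 0: "poly_op P T = 0"
  have "poly_op ([:0, 1:] * P) T = 0"
    unfolding poly_op_mult 0 by (rule cblinfun_eqI) simp
  moreover have "degree ([:0, 1:] * P) > 0" using assms(2) by simp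
  ultimately show False using assms(1) unfolding algebraic_op_def by blast
qed

lemma not_algebraic_funpow:
  assumes "\<not> algebraic_op T"
  obtains x where "(capp T ^^ m) x \<noteq> 0"
proof -
  have "poly_op ([:- 0, 1:] ^ m) T \<noteq> 0"
    by (rule not_algebraic_poly_op[OF assms]) simp
  then obtain x where "capp (poly_op ([:- 0, 1:] ^ m) T) x \<noteq> 0"
    by (metis capp_zero_left cblinfun_eqI)
  then show ?thesis using that unfolding poly_op_linear_power by simp
qed

text \<open>The elements annihilated by a nonzero polynomial in \<open>T\<close> form an ideal,
  proper because \<open>T\<close> is not algebraic; it is extended by some
  \<open>V = T - \<alpha>\<close>. If \<open>V\<close> had a Drazin inverse \<open>S\<close>, a
  power of \<open>V\<close> would annihilate \<open>cid - S V\<close>, so both this and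
  \<open>S V\<close> would lie in the extension.\<close>

lemma not_algebraic_spectrum:
  fixes T :: "('a::complex_banach, 'a) cblinfun"
  assumes "\<not> algebraic_op T"
  obtains \<alpha> where "\<alpha> \<in> spectrum T" "\<not> drazin_invertible (T - \<alpha> *\<^sub>C cid)"
proof -
  interpret commutative_algebra "bicommutant {T}"
    by (rule commutative_algebra_bicommutant) auto
  let ?\<A> = "bicommutant {T}"
  have T: "T \<in> ?\<A>" by (simp add: bicommutant_superset)
  have poly: "poly_op P T \<in> ?\<A>" for P
    by (induction P) (auto simp: poly_op_zero poly_op_pCons intro!: mem_rules T)
  define J where "J = {x \<in> ?\<A>. \<exists>P. P \<noteq> 0 \<and> poly_op P T o\<^sub>C x = 0}"
  have J: "ideal_of J"
    unfolding ideal_of_def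
  proof (intro conjI ballI)
    show "J \<subseteq> ?\<A>" by (auto simp: J_def)
    show "0 \<in> J"
      unfolding J_def using zero_mem by (auto intro!: exI[of _ 1] cblinfun_eqI)
    fix x assume x: "x \<in> J"
    then obtain P where P: "P \<noteq> 0" "poly_op P T o\<^sub>C x = 0" by (auto simp: J_def)
    have Px: "capp (poly_op P T) (capp x v) = 0" for v using P(2) by (metis capp_ccompose capp_zero_left)
    show "x + y \<in> J" if y: "y \<in> J" for y
    proof -
      obtain Q where Q: "Q \<noteq> 0" "poly_op Q T o\<^sub>C y = 0" using y by (auto simp: J_def)
      have Qy: "capp (poly_op Q T) (capp y v) = 0" for v using Q(2) by (metis capp_ccompose capp_zero_left)
      have "poly_op (P * Q) T o\<^sub>C (x + y) = 0"
        by (intro cblinfun_eqI)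
          (simp add: poly_op_mult capp_add capp_add_right Qy Px capp_left_commute[OF poly poly, of P Q])
      then show ?thesis using P(1) Q(1) x y add_mem unfolding J_def by (auto intro!: exI[of _ "P * Q"])
    qed
    show "r o\<^sub>C x \<in> J" if r: "r \<in> ?\<A>" for r
    proof -
      have "poly_op P T o\<^sub>C (r o\<^sub>C x) = 0"
        by (intro cblinfun_eqI) (simp add: capp_left_commute[OF poly r] Px)
      then show ?thesis using P(1) x r comp_mem by (auto simp: J_def)
    qed
  qed
  have proper: "cid \<notin> J"
  proof
    assume "cid \<in> J"
    then obtain P where P: "P \<noteq> 0" "poly_op P T o\<^sub>C cid = 0" by (auto simp: J_def)
    have "poly_op P T = poly_op P T o\<^sub>C cid" by (rule cblinfun_eqI) simp
    then show False using not_algebraic_poly_op[OF assms P(1)] P(2) by simp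
  qed
  obtain \<alpha> J' where J': "ideal_of J'" "cid \<notin> J'" "J \<subseteq> J'" "T - \<alpha> *\<^sub>C cid \<in> J'" "\<alpha> \<in> spectrum T"
    using ideal_of_extend[OF J proper T] by blast
  show ?thesis
  proof (rule that[OF J'(5)], rule notI)
    let ?V = "T - \<alpha> *\<^sub>C cid"
    have V: "?V \<in> ?\<A>" by (intro mem_rules T)
    assume "drazin_invertible ?V"
    then obtain m S where S: "S \<in> ?\<A>" "\<And>x. (capp ?V ^^ m) (x - capp S (capp ?V x)) = 0"
      using drazin_idempotent[OF V] by blast
    have "poly_op ([:- \<alpha>, 1:] ^ m) T o\<^sub>C (cid - S o\<^sub>C ?V) = 0"
      using S(2) by (intro cblinfun_eqI) (simp add: poly_op_linear_power capp_diff[of cid])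
    moreover have "cid - S o\<^sub>C ?V \<in> ?\<A>" by (intro mem_rules S V)
    ultimately have "cid - S o\<^sub>C ?V \<in> J"
      unfolding J_def by (auto intro!: exI[of _ "[:- \<alpha>, 1:] ^ m"])
    then have "(cid - S o\<^sub>C ?V) + S o\<^sub>C ?V \<in> J'"
      using J' S(1) by (intro ideal_ofD(3,4)[OF J'(1)]) auto
    then show False using J'(2) by simp
  qed
qed

section \<open>Operators that factor along a bilinear map\<close>

text \<open>Abstracts from elementary tensors \<open>j p q\<close> with their cross-norm property.
  The instances are elementary tensors of vectors, products of functionals, rank-one operators, and
  the functionals sending \<open>U\<close> to \<open>\<phi> (U y)\<close>.\<close>

definition factors_along ::
  "('z::complex_normed_vector, 'z) cblinfun \<Rightarrow> ('p::complex_normed_vector, 'p) cblinfun \<Rightarrow>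
   ('q::complex_normed_vector, 'q) cblinfun \<Rightarrow> ('p \<Rightarrow> 'q \<Rightarrow> 'z) \<Rightarrow> bool"
  where "factors_along T F G j \<longleftrightarrow>
    (\<forall>p p' q. j (p + p') q = j p q + j p' q) \<and> (\<forall>p q q'. j p (q + q') = j p q + j p q') \<and>
    (\<forall>c p q. j (c *\<^sub>C p) q = c *\<^sub>C j p q) \<and> (\<forall>c p q. j p (c *\<^sub>C q) = c *\<^sub>C j p q) \<and>
    (\<forall>p q. norm (j p q) = norm p * norm q) \<and>
    (\<forall>p q. capp T (j p q) = j (capp F p) (capp G q))"

lemma factors_alongI:
  assumes "\<And>p p' q. j (p + p') q = j p q + j p' q" "\<And>p q q'. j p (q + q') = j p q + j p q'"
    "\<And>c p q. j (c *\<^sub>C p) q = c *\<^sub>C j p q" "\<And>c p q. j p (c *\<^sub>C q) = c *\<^sub>C j p q"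
    "\<And>p q. norm (j p q) = norm p * norm q" "\<And>p q. capp T (j p q) = j (capp F p) (capp G q)"
  shows "factors_along T F G j"
  using assms by (simp add: factors_along_def)

lemma factors_along_swap: "factors_along T F G j \<Longrightarrow> factors_along T G F (\<lambda>q p. j p q)"
  by (simp add: factors_along_def mult.commute)

lemma not_bounded_below_sequence:
  assumes "\<not> ascent_bound 0 V"
  obtains y where "\<And>n. norm (y n) = 1" "(\<lambda>n. capp V (y n)) \<longlonglongrightarrow> 0"
proof -
  have "\<exists>y. norm y = 1 \<and> norm (capp V y) \<le> inverse (real (Suc n))" for n
  proof -
    obtain x where x: "real (Suc n) * norm (capp V x) < norm x"
      using assms ascent_bound_0I[of "real (Suc n)" V] by (meson not_le)
    have "0 \<le> real (Suc n) * norm (capp V x)" by simp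
    with x have pos: "0 < norm x" by linarith
    define y where "y = complex_of_real (inverse (norm x)) *\<^sub>C x"
    have "norm y = 1" using pos by (simp add: y_def norm_scaleC norm_inverse norm_divide)
    moreover have "norm (capp V y) = inverse (norm x) * norm (capp V x)"
      by (simp add: y_def capp_scaleC_right norm_scaleC norm_inverse norm_divide)
    moreover have "inverse (norm x) * norm (capp V x) \<le> inverse (real (Suc n))"
      using x pos by (simp add: field_simps)
    ultimately show ?thesis by (intro exI[of _ y]) simp
  qed
  then obtain y where y: "\<And>n. norm (y n) = 1" "\<And>n. norm (capp V (y n)) \<le> inverse (real (Suc n))"
    by metis
  have "(\<lambda>n. capp V (y n)) \<longlonglongrightarrow> 0"
    by (rule Lim_null_comparison[OF always_eventually LIMSEQ_inverse_real_of_nat]) (rule allI, rule y(2))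
  with y(1) show ?thesis by (rule that)
qed

text \<open>If \<open>y\<close> is an approximate eigenvector of \<open>G\<close> for \<open>b\<close>, then on \<open>j p y\<close> the operator
  \<open>T - ab\<close> acts approximately as \<open>b (F - a)\<close> on \<open>p\<close>.\<close>

lemma ascent_bound_factor:
  assumes j: "factors_along T F G j" and G: "\<not> ascent_bound 0 (G - b *\<^sub>C cid)"
    and T: "ascent_bound m (T - (a * b) *\<^sub>C cid)" and bm: "b \<noteq> 0 \<or> m = 0"
  shows "ascent_bound m (F - a *\<^sub>C cid)"
proof -
  have add1: "j (p + p') q = j p q + j p' q" and add2: "j p (q + q') = j p q + j p q'"
    and scale1: "j (c *\<^sub>C p) q = c *\<^sub>C j p q" and scale2: "j p (c *\<^sub>C q) = c *\<^sub>C j p q"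
    and norm_j: "norm (j p q) = norm p * norm q"
    and Tj: "capp T (j p q) = j (capp F p) (capp G q)" for p p' q q' c
    using j by (simp_all add: factors_along_def)
  have diff1: "j (p - p') q = j p q - j p' q" for p p' q
    using add1[of "p - p'" p' q] by simp
  have diff2: "j p (q - q') = j p q - j p q'" for p q q'
    using add2[of p "q - q'" q'] by simp
  obtain y where y: "\<And>n. norm (y n) = 1" "(\<lambda>n. capp (G - b *\<^sub>C cid) (y n)) \<longlonglongrightarrow> 0"
    using not_bounded_below_sequence[OF G] by blast
  let ?D = "T - (a * b) *\<^sub>C cid" and ?E = "F - a *\<^sub>C cid"
  \<comment> \<open>The right side is the error term; it tends to 0 along the approximate
    eigenvectors because norms multiply under \<open>j\<close>.\<close>
  have D: "capp ?D (j p q) - j (b *\<^sub>C capp ?E p) q = j (capp F p) (capp (G - b *\<^sub>C cid) q)" for p q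
    by (simp add: capp_simps Tj diff1 diff2 scale1 scale2 scaleC_scaleC mult.commute
        complex_vector.scale_right_diff_distrib)
  have lim: "(\<lambda>n. (capp ?D ^^ k) (j x (y n)) - j (b ^ k *\<^sub>C (capp ?E ^^ k) x) (y n)) \<longlonglongrightarrow> 0" for k x
  proof (induction k)
    case 0
    then show ?case by (simp add: scaleC_one)
  next
    case (Suc k)
    let ?x = "b ^ k *\<^sub>C (capp ?E ^^ k) x"
    have "(\<lambda>n. capp ?D ((capp ?D ^^ k) (j x (y n)) - j ?x (y n)) + j (capp F ?x) (capp (G - b *\<^sub>C cid) (y n)))
        \<longlonglongrightarrow> capp ?D 0 + 0"
    proof (intro tendsto_add tendsto_capp Suc)
      show "(\<lambda>n. j (capp F ?x) (capp (G - b *\<^sub>C cid) (y n))) \<longlonglongrightarrow> 0"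
        unfolding tendsto_norm_zero_iff[symmetric, of "\<lambda>n. j _ (_ n)"] norm_j
        by (intro tendsto_mult_right_zero tendsto_norm_zero y(2))
    qed
    moreover have "capp ?D ((capp ?D ^^ k) (j x (y n)) - j ?x (y n)) + j (capp F ?x) (capp (G - b *\<^sub>C cid) (y n))
        = (capp ?D ^^ Suc k) (j x (y n)) - j (b ^ Suc k *\<^sub>C (capp ?E ^^ Suc k) x) (y n)" for n
    proof -
      have "b ^ Suc k *\<^sub>C (capp ?E ^^ Suc k) x = b *\<^sub>C capp ?E ?x"
        by (simp add: capp_scaleC_right scaleC_scaleC)
      then show ?thesis unfolding D[symmetric] by (simp add: capp_diff_right[of ?D])
    qed
    ultimately show ?case by simp
  qed
  have norm_lim: "(\<lambda>n. norm ((capp ?D ^^ k) (j x (y n)))) \<longlonglongrightarrow> cmod b ^ k * norm ((capp ?E ^^ k) x)" for k x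
  proof -
    have "(\<lambda>n. norm ((capp ?D ^^ k) (j x (y n))) - norm (j (b ^ k *\<^sub>C (capp ?E ^^ k) x) (y n))) \<longlonglongrightarrow> 0"
      by (rule Lim_null_comparison[OF always_eventually tendsto_norm_zero[OF lim[of k x]]])
        (auto intro: norm_triangle_ineq3)
    then show ?thesis
      by (simp add: norm_j y(1) norm_scaleC norm_power LIM_zero_iff)
  qed
  obtain C where C: "\<And>u. norm ((capp ?D ^^ m) u) \<le> C * norm ((capp ?D ^^ Suc m) u)"
    using T by (auto simp: ascent_bound_def)
  have "norm ((capp ?E ^^ m) x) \<le> (C * cmod b) * norm ((capp ?E ^^ Suc m) x)" for x
  proof -
    have "cmod b ^ m * norm ((capp ?E ^^ m) x) \<le> C * (cmod b ^ Suc m * norm ((capp ?E ^^ Suc m) x))"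
      by (rule LIMSEQ_le[OF norm_lim tendsto_mult_left[OF norm_lim]]) (use C in auto)
    then have "cmod b ^ m * norm ((capp ?E ^^ m) x) \<le> cmod b ^ m * ((C * cmod b) * norm ((capp ?E ^^ Suc m) x))"
      by (simp add: mult_ac)
    \<comment> \<open>Cancelling \<open>cmod b ^ m\<close> is where
      \<open>b \<noteq> 0 \<or> m = 0\<close> enters.\<close>
    then show ?thesis using bm by (auto simp: mult_le_cancel_left)
  qed
  then show ?thesis unfolding ascent_bound_def by (intro exI[of _ "C * cmod b"]) simp
qed

text \<open>Powers of \<open>T\<close> act factorwise on \<open>j p q\<close>, so one fixed
  \<open>q\<close> with \<open>G^m q\<close> nonzero replaces the approximate eigenvectors.\<close>

lemma ascent_bound_factor_0:
  assumes j: "factors_along T F G j" and q: "(capp G ^^ m) q \<noteq> 0" and T: "ascent_bound m T"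
  shows "ascent_bound m F"
proof -
  have norm_j: "norm (j p q) = norm p * norm q"
    and Tj: "capp T (j p q) = j (capp F p) (capp G q)" for p q
    using j by (simp_all add: factors_along_def)
  have Tn: "(capp T ^^ k) (j p q) = j ((capp F ^^ k) p) ((capp G ^^ k) q)" for k p q
    by (induction k) (simp_all add: Tj)
  obtain C where C: "\<And>u. norm ((capp T ^^ m) u) \<le> C * norm ((capp T ^^ Suc m) u)"
    using T by (auto simp: ascent_bound_def)
  have "norm ((capp F ^^ m) p)
      \<le> (C * norm ((capp G ^^ Suc m) q) / norm ((capp G ^^ m) q)) * norm ((capp F ^^ Suc m) p)" for p
    using C[of "j p q"] q by (simp add: Tn Tj norm_j field_simps)
  then show ?thesis unfolding ascent_bound_def funpow.simps o_apply by blast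
qed

lemma dual_op_funpow_nonzero:
  assumes "(capp V ^^ m) x \<noteq> 0"
  shows "\<exists>\<phi>. (capp (dual_op V) ^^ m) \<phi> \<noteq> 0"
proof -
  obtain \<phi> :: "('a, complex) cblinfun" where "capp \<phi> ((capp V ^^ m) x) = 1"
    using exists_functional_norming[OF assms] by blast
  then have "capp ((capp (dual_op V) ^^ m) \<phi>) x = 1" by (simp add: capp_funpow_dual_op)
  then show ?thesis by (intro exI[of _ \<phi>]) auto
qed

text \<open>A nonempty closed set other than the whole plane is not open, and the spectrum omits
  \<open>norm V + 1\<close>.\<close>

lemma spectrum_boundary_exists:
  fixes V :: "('a::complex_banach, 'a) cblinfun"
  assumes "spectrum V \<noteq> {}"
  obtains c where "c \<in> spectrum V" "c \<notin> interior (spectrum V)"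
proof -
  have "complex_of_real (norm V + 1) \<notin> spectrum V"
    using spectrum_le_norm[of "complex_of_real (norm V + 1)" V] by (auto simp del: of_real_add)
  then have "\<not> open (spectrum V)"
    using assms closed_spectrum[of V] clopen[of "spectrum V"] by blast
  then show ?thesis using that interior_open interior_subset by (metis open_interior subsetI subset_antisym)
qed

text \<open>The data common to \<open>T = A \<otimes> B\<close> and \<open>T = \<tau>\<^sub>A\<^sub>B\<close>. The pair \<open>G\<close>, \<open>G'\<close> stands for \<open>B\<close> and its
  adjoint, in this order for the tensor product and in the opposite order for \<open>\<tau>\<^sub>A\<^sub>B\<close>.\<close>

locale product_operator =
  fixes A :: "('x::complex_banach, 'x) cblinfun" and B :: "('y::complex_banach, 'y) cblinfun"
    and T L R :: "('z::complex_banach, 'z) cblinfun"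
    and G :: "('p::complex_normed_vector, 'p) cblinfun" and G' :: "('q::complex_normed_vector, 'q) cblinfun"
    and j :: "'x \<Rightarrow> 'p \<Rightarrow> 'z" and j' :: "('x, complex) cblinfun \<Rightarrow> 'q \<Rightarrow> ('z, complex) cblinfun"
  assumes T_eq: "T = L o\<^sub>C R" and comm: "L o\<^sub>C R = R o\<^sub>C L"
    and spectrum_L: "spectrum L \<subseteq> spectrum A" and spectrum_R: "spectrum R \<subseteq> spectrum B"
    and drazin_L: "drazin_invertible (A - c *\<^sub>C cid) \<Longrightarrow> drazin_invertible (L - c *\<^sub>C cid)"
    and drazin_R: "drazin_invertible (B - c *\<^sub>C cid) \<Longrightarrow> drazin_invertible (R - c *\<^sub>C cid)"
    and j: "factors_along T A G j" and j': "factors_along (dual_op T) (dual_op A) G' j'"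
    and GG': "(\<forall>m b. (ascent_bound m (G - b *\<^sub>C cid) \<longleftrightarrow> ascent_bound m (B - b *\<^sub>C cid)) \<and>
        (ascent_bound m (G' - b *\<^sub>C cid) \<longleftrightarrow> ascent_bound m (dual_op B - b *\<^sub>C cid))) \<or>
      (\<forall>m b. (ascent_bound m (G' - b *\<^sub>C cid) \<longleftrightarrow> ascent_bound m (B - b *\<^sub>C cid)) \<and>
        (ascent_bound m (G - b *\<^sub>C cid) \<longleftrightarrow> ascent_bound m (dual_op B - b *\<^sub>C cid)))"
    and not_nilpotent_G: "\<exists>q. (capp G ^^ m) q \<noteq> 0" and not_nilpotent_G': "\<exists>q. (capp G' ^^ m) q \<noteq> 0"
    and not_algebraic_A: "\<not> algebraic_op A" and not_algebraic_B: "\<not> algebraic_op B"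
begin

lemma GG'_both: "ascent_bound m (G - b *\<^sub>C cid) \<and> ascent_bound m (G' - b *\<^sub>C cid) \<longleftrightarrow>
    ascent_bound m (B - b *\<^sub>C cid) \<and> ascent_bound m (dual_op B - b *\<^sub>C cid)"
  using GG' by blast

lemma boundary_A:
  assumes a: "a \<in> spectrum A" "a \<notin> interior (spectrum A)"
    and T: "ascent_bound m (T - (a * b) *\<^sub>C cid)" "ascent_bound m (dual_op T - (a * b) *\<^sub>C cid)"
    and am: "a \<noteq> 0 \<or> m = 0"
  shows "ascent_bound m (B - b *\<^sub>C cid)" "ascent_bound m (dual_op B - b *\<^sub>C cid)"
proof -
  have "ascent_bound m (G - b *\<^sub>C cid)"
    using ascent_bound_factor[OF factors_along_swap[OF j] spectrum_boundary(1)[OF a]] T(1) am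
    by (simp add: mult.commute)
  moreover have "ascent_bound m (G' - b *\<^sub>C cid)"
    using ascent_bound_factor[OF factors_along_swap[OF j'] spectrum_boundary(2)[OF a]] T(2) am
    by (simp add: mult.commute)
  ultimately show "ascent_bound m (B - b *\<^sub>C cid)" "ascent_bound m (dual_op B - b *\<^sub>C cid)"
    using GG'_both by blast+
qed

lemma boundary_B:
  assumes b: "b \<in> spectrum B" "b \<notin> interior (spectrum B)"
    and T: "ascent_bound m (T - (a * b) *\<^sub>C cid)" "ascent_bound m (dual_op T - (a * b) *\<^sub>C cid)"
    and bm: "b \<noteq> 0 \<or> m = 0"
  shows "ascent_bound m (A - a *\<^sub>C cid)" "ascent_bound m (dual_op A - a *\<^sub>C cid)"
proof -
  have G: "\<not> ascent_bound 0 (G - b *\<^sub>C cid)" "\<not> ascent_bound 0 (G' - b *\<^sub>C cid)"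
    using spectrum_boundary[OF b] GG' by blast+
  show "ascent_bound m (A - a *\<^sub>C cid)" by (rule ascent_bound_factor[OF j G(1) T(1) bm])
  show "ascent_bound m (dual_op A - a *\<^sub>C cid)" by (rule ascent_bound_factor[OF j' G(2) T(2) bm])
qed

text \<open>If \<open>a * b\<close> were outside the spectrum of \<open>T\<close>, the bounds with
  exponent 0 would pass, through approximate eigenvectors at the boundary entry, to the other factor
  and put the other entry outside its spectrum.\<close>

lemma boundary_product:
  assumes "a \<in> spectrum A" "b \<in> spectrum B"
    and "a \<notin> interior (spectrum A) \<or> b \<notin> interior (spectrum B)"
  shows "a * b \<in> spectrum T"
proof (rule ccontr)
  assume "a * b \<notin> spectrum T"
  then have T: "ascent_bound 0 (T - (a * b) *\<^sub>C cid)" "ascent_bound 0 (dual_op T - (a * b) *\<^sub>C cid)"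
    by (simp_all add: not_in_spectrum_iff)
  from assms(3) show False
  proof
    assume "a \<notin> interior (spectrum A)"
    then have "b \<notin> spectrum B"
      unfolding not_in_spectrum_iff using boundary_A[OF assms(1) _ T] by simp
    then show False using assms(2) by simp
  next
    assume "b \<notin> interior (spectrum B)"
    then have "a \<notin> spectrum A"
      unfolding not_in_spectrum_iff using boundary_B[OF assms(2) _ T] by simp
    then show False using assms(1) by simp
  qed
qed

text \<open>Move \<open>(a, b)\<close> to \<open>(ta, b/t)\<close> with \<open>t\<close> as large as possible: one of the two entries is then a
  boundary point of its spectrum.\<close>

lemma spectrum_T: "spectrum T = spectrum A * spectrum B"
proof (rule antisym; rule subsetI)
  fix c assume "c \<in> spectrum T"
  then obtain a b where "a \<in> spectrum L" "b \<in> spectrum R" "a * b = c"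
    unfolding T_eq by (rule spectrum_ccompose[OF comm])
  then show "c \<in> spectrum A * spectrum B"
    using spectrum_L spectrum_R by (auto intro!: set_times_intro)
next
  fix c assume "c \<in> spectrum A * spectrum B"
  then obtain a b where ab: "a \<in> spectrum A" "b \<in> spectrum B" "c = a * b"
    by (rule set_times_elim)
  show "c \<in> spectrum T"
  proof (cases "a = 0")
    case True
    \<comment> \<open>The product is 0 whatever the second entry is, so a boundary point may replace
      it.\<close>
    obtain b' where "b' \<in> spectrum B" "b' \<notin> interior (spectrum B)"
      using spectrum_boundary_exists ab(2) by blast
    then show ?thesis using boundary_product[of a b'] ab True by simp
  next
    case False
    let ?I = "{1..norm A / cmod a}"
    \<comment> \<open>The upper limit excludes no admissible \<open>t\<close>, since spectral values
      of \<open>A\<close> have modulus at most \<open>norm A\<close>; it makes \<open>K\<close>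
      compact.\<close>
    define K where "K = (?I \<inter> (\<lambda>t. complex_of_real t * a) -` spectrum A) \<inter>
      (?I \<inter> (\<lambda>t. b / complex_of_real t) -` spectrum B)"
    have "closed K"
      unfolding K_def
      by (intro closed_Int[OF continuous_closed_preimage continuous_closed_preimage] closed_spectrum
          continuous_intros) auto
    moreover have "bounded K"
      by (rule bounded_subset[OF bounded_closed_interval[of 1 "norm A / cmod a"]]) (auto simp: K_def)
    ultimately have "compact K" by (simp add: compact_eq_bounded_closed)
    moreover have "1 \<in> K"
      using ab spectrum_le_norm[OF ab(1)] False by (simp add: K_def field_simps)
    ultimately obtain t where t: "t \<in> K" "\<And>s. s \<in> K \<Longrightarrow> s \<le> t"
      using compact_attains_sup[of K] by blast
    then have t1: "1 \<le> t" "complex_of_real t * a \<in> spectrum A" "b / complex_of_real t \<in> spectrum B"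
      by (auto simp: K_def)
    have "\<not> (complex_of_real t * a \<in> interior (spectrum A) \<and> b / complex_of_real t \<in> interior (spectrum B))"
    proof
      assume int: "complex_of_real t * a \<in> interior (spectrum A) \<and> b / complex_of_real t \<in> interior (spectrum B)"
      have "((\<lambda>s. complex_of_real s * a) \<longlongrightarrow> complex_of_real t * a) (at_right t)"
        by (intro tendsto_intros)
      then have "\<forall>\<^sub>F s in at_right t. complex_of_real s * a \<in> interior (spectrum A)"
        using int by (intro topological_tendstoD[OF _ open_interior]) auto
      moreover have "((\<lambda>s. b / complex_of_real s) \<longlongrightarrow> b / complex_of_real t) (at_right t)"
        using t1(1) by (intro tendsto_intros) auto
      then have "\<forall>\<^sub>F s in at_right t. b / complex_of_real s \<in> interior (spectrum B)"
        using int by (intro topological_tendstoD[OF _ open_interior]) auto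
      moreover have "\<forall>\<^sub>F s in at_right t. s > t" by (rule eventually_at_right_less)
      ultimately have "\<forall>\<^sub>F s in at_right t. complex_of_real s * a \<in> interior (spectrum A) \<and>
          b / complex_of_real s \<in> interior (spectrum B) \<and> s > t"
        by eventually_elim simp
      then obtain s where s: "complex_of_real s * a \<in> interior (spectrum A)"
          "b / complex_of_real s \<in> interior (spectrum B)" "t < s"
        using eventually_happens' trivial_limit_at_right_real by (metis (no_types, lifting))
      have sA: "complex_of_real s * a \<in> spectrum A" using s(1) interior_subset by blast
      then have "s \<le> norm A / cmod a"
        using spectrum_le_norm[OF sA] s(3) t1(1) False by (simp add: norm_mult field_simps)
      then have "s \<in> K" using sA s interior_subset t1(1) by (auto simp: K_def)
      then show False using t(2) s(3) by fastforce
    qed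
    then have "(complex_of_real t * a) * (b / complex_of_real t) \<in> spectrum T"
      using t1 by (intro boundary_product) auto
    then show ?thesis using t1(1) ab(3) by simp
  qed
qed

text \<open>An interior entry of a factorization could be moved, and the product with it, through
  spectral values near \<open>c\<close>; but \<open>c\<close> is isolated. So both entries have
  approximate eigenvectors, and each carries the bounds over to the other factor.\<close>

lemma drazin_factors:
  assumes c: "c \<noteq> 0" and T: "drazin_invertible (T - c *\<^sub>C cid)"
    and ab: "a \<in> spectrum A" "b \<in> spectrum B" "a * b = c"
  shows "drazin_invertible (A - a *\<^sub>C cid)" "drazin_invertible (B - b *\<^sub>C cid)"
proof -
  obtain e where e: "0 < e" "\<And>d. d \<noteq> c \<Longrightarrow> dist d c < e \<Longrightarrow> d \<notin> spectrum T"
    using drazin_invertible_isolated[OF T] by blast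
  have isolated: "s \<notin> interior S" if S: "\<And>d. d \<in> S \<Longrightarrow> d * r \<in> spectrum T" and s: "s * r = c" for S s r
  proof
    assume "s \<in> interior S"
    then obtain \<delta> where \<delta>: "0 < \<delta>" "ball s \<delta> \<subseteq> S" by (auto simp: mem_interior)
    have r: "r \<noteq> 0" using s c by auto
    \<comment> \<open>Keeps \<open>s + h\<close> in the ball and moves the product by less than
      \<open>e\<close>, though not by 0, as \<open>r\<close> is nonzero.\<close>
    define h where "h = min (\<delta> / 2) (e / (2 * cmod r))"
    have h: "0 < h" "h < \<delta>" "h * cmod r < e"
    proof -
      show "0 < h" using \<delta>(1) e(1) r by (simp add: h_def)
      show "h < \<delta>" using \<delta>(1) by (simp add: h_def)
      have "h * cmod r \<le> e / (2 * cmod r) * cmod r" by (intro mult_right_mono) (auto simp: h_def)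
      also have "\<dots> < e" using e(1) r by simp
      finally show "h * cmod r < e" .
    qed
    have "s + h \<in> S" using h \<delta>(2) by (auto simp: dist_norm)
    then have "(s + h) * r \<in> spectrum T" by (rule S)
    moreover have "(s + h) * r \<noteq> c" "dist ((s + h) * r) c < e"
      using h r s by (auto simp: dist_norm distrib_right norm_mult)
    ultimately show False using e(2) by blast
  qed
  have a: "a \<notin> interior (spectrum A)"
    by (rule isolated[OF _ ab(3)]) (use ab(2) in \<open>auto simp: spectrum_T intro: set_times_intro\<close>)
  have b: "b \<notin> interior (spectrum B)"
  proof (rule isolated)
    show "d * a \<in> spectrum T" if "d \<in> spectrum B" for d
      using set_times_intro[OF ab(1) that] by (simp add: spectrum_T mult.commute)
    show "b * a = c" using ab(3) by (simp add: mult.commute)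
  qed
  obtain m where m: "ascent_bound m (T - (a * b) *\<^sub>C cid)" "ascent_bound m (dual_op T - (a * b) *\<^sub>C cid)"
    using T unfolding drazin_invertible_iff_ascent_bound dual_op_diff_scaleC ab(3) by blast
  have ab0: "a \<noteq> 0 \<or> m = 0" "b \<noteq> 0 \<or> m = 0" using c ab(3) by auto
  show "drazin_invertible (A - a *\<^sub>C cid)"
    unfolding drazin_invertible_iff_ascent_bound dual_op_diff_scaleC
    using boundary_B[OF ab(2) b m ab0(2)] by blast
  show "drazin_invertible (B - b *\<^sub>C cid)"
    unfolding drazin_invertible_iff_ascent_bound dual_op_diff_scaleC
    using boundary_A[OF ab(1) a m ab0(1)] by blast
qed

lemma drazin_T_minus:
  assumes "c \<noteq> 0"
  shows "drazin_invertible (T - c *\<^sub>C cid) \<longleftrightarrow> (\<forall>a\<in>spectrum A. \<forall>b\<in>spectrum B. a * b = c \<longrightarrow>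
    drazin_invertible (A - a *\<^sub>C cid) \<and> drazin_invertible (B - b *\<^sub>C cid))"
proof
  assume "drazin_invertible (T - c *\<^sub>C cid)"
  then show "\<forall>a\<in>spectrum A. \<forall>b\<in>spectrum B. a * b = c \<longrightarrow>
    drazin_invertible (A - a *\<^sub>C cid) \<and> drazin_invertible (B - b *\<^sub>C cid)"
    using drazin_factors[OF assms] by blast
next
  assume "\<forall>a\<in>spectrum A. \<forall>b\<in>spectrum B. a * b = c \<longrightarrow>
    drazin_invertible (A - a *\<^sub>C cid) \<and> drazin_invertible (B - b *\<^sub>C cid)"
  then show "drazin_invertible (T - c *\<^sub>C cid)"
    unfolding T_eq using spectrum_L spectrum_R drazin_L drazin_R
    by (intro drazin_invertible_product_minus[OF comm]) blast
qed

text \<open>At 0 the method of approximate eigenvectors would divide by a power of 0. Instead powers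
  of \<open>T\<close> are evaluated factorwise, on vectors not annihilated by the relevant power of
  the other factor.\<close>

lemma drazin_T: "drazin_invertible T \<longleftrightarrow> drazin_invertible A \<and> drazin_invertible B"
proof
  assume "drazin_invertible T"
  then obtain m where m: "ascent_bound m T" "ascent_bound m (dual_op T)"
    by (auto simp: drazin_invertible_iff_ascent_bound)
  obtain q q' where q: "(capp G ^^ m) q \<noteq> 0" "(capp G' ^^ m) q' \<noteq> 0"
    using not_nilpotent_G not_nilpotent_G' by blast
  obtain x where x: "(capp A ^^ m) x \<noteq> 0" using not_algebraic_funpow[OF not_algebraic_A] by blast
  obtain \<phi> where \<phi>: "(capp (dual_op A) ^^ m) \<phi> \<noteq> 0" using dual_op_funpow_nonzero[OF x] by blast
  have "ascent_bound m A" "ascent_bound m (dual_op A)"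
    by (rule ascent_bound_factor_0[OF j q(1) m(1)] ascent_bound_factor_0[OF j' q(2) m(2)])+
  moreover have "ascent_bound m G" "ascent_bound m G'"
    by (rule ascent_bound_factor_0[OF factors_along_swap[OF j] x m(1)]
        ascent_bound_factor_0[OF factors_along_swap[OF j'] \<phi> m(2)])+
  then have "ascent_bound m B" "ascent_bound m (dual_op B)"
    using GG'_both[of m 0] by simp_all
  ultimately show "drazin_invertible A \<and> drazin_invertible B"
    by (auto simp: drazin_invertible_iff_ascent_bound)
next
  assume "drazin_invertible A \<and> drazin_invertible B"
  then have "drazin_invertible L" "drazin_invertible R"
    using drazin_L[of 0] drazin_R[of 0] by simp_all
  then show "drazin_invertible T" unfolding T_eq by (rule drazin_invertible_ccompose[OF comm])
qed

lemma poles_T_0: "0 \<in> poles T \<longleftrightarrow> 0 \<in> spectrum A * spectrum B \<and> drazin_invertible A \<and> drazin_invertible B"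
  by (simp add: poles_eq spectrum_T drazin_T)

lemma poles_T_nonzero:
  assumes "c \<noteq> 0"
  shows "c \<in> poles T \<longleftrightarrow> c \<in> spectrum A * spectrum B \<and>
    (\<forall>a\<in>spectrum A. \<forall>b\<in>spectrum B. a * b = c \<longrightarrow> a \<in> poles A \<and> b \<in> poles B)"
  by (auto simp: poles_eq spectrum_T drazin_T_minus[OF assms])

lemma invertible_T: "invertible_op T \<longleftrightarrow> 0 \<notin> spectrum T"
  by (simp add: spectrum_def)

text \<open>A point is in \<open>S\<close> iff one of its factorizations in the two spectra has an
  entry that is not a pole; for nonzero points this negates the criterion for poles of
  \<open>T\<close>.\<close>

theorem b_weyl_spectrum_product:
  assumes A: "generalized_browder A" and B: "generalized_browder B" and T: "generalized_browder T"
    and S: "S = spectrum A * b_weyl_spectrum B \<union> b_weyl_spectrum A * spectrum B"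
  shows "S \<subseteq> b_weyl_spectrum T \<longleftrightarrow> 0 \<notin> poles T"
    and "0 \<notin> poles T \<longleftrightarrow> invertible_op T \<or> \<not> drazin_invertible T"
    and "S \<subseteq> b_weyl_spectrum T \<Longrightarrow> S = b_weyl_spectrum T"
    and "\<not> S \<subseteq> b_weyl_spectrum T \<Longrightarrow> S = b_weyl_spectrum T \<union> {0}"
proof -
  have bA: "b_weyl_spectrum A = spectrum A - poles A" and bB: "b_weyl_spectrum B = spectrum B - poles B"
    and bT: "b_weyl_spectrum T = spectrum T - poles T"
    using A B T by (simp_all add: generalized_browder_def)
  have times: "c \<in> X * Y \<longleftrightarrow> (\<exists>a\<in>X. \<exists>b\<in>Y. a * b = c)" for c :: complex and X Y
    by (auto simp: set_times_def)
  have mem: "c \<in> S \<longleftrightarrow> (\<exists>a\<in>spectrum A. \<exists>b\<in>spectrum B. a * b = c \<and> \<not> (a \<in> poles A \<and> b \<in> poles B))" for c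
    unfolding S bA bB Un_iff times by blast
  have nonzero: "c \<in> S \<longleftrightarrow> c \<in> b_weyl_spectrum T" if "c \<noteq> 0" for c
    unfolding mem bT spectrum_T Diff_iff poles_T_nonzero[OF that] times by blast
  obtain a where a: "a \<in> spectrum A" "a \<notin> poles A"
    using not_algebraic_spectrum[OF not_algebraic_A] by (auto simp: poles_eq)
  obtain b where b: "b \<in> spectrum B" "b \<notin> poles B"
    using not_algebraic_spectrum[OF not_algebraic_B] by (auto simp: poles_eq)
  \<comment> \<open>A spectral value that is not a pole, paired with 0 from the other spectrum,
    gives a factorization that puts 0 into \<open>S\<close>.\<close>
  have zero: "0 \<in> S \<longleftrightarrow> 0 \<in> spectrum T"
  proof
    assume "0 \<in> S"
    then show "0 \<in> spectrum T" unfolding mem spectrum_T times by blast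
  next
    assume "0 \<in> spectrum T"
    then have "0 \<in> spectrum A \<or> 0 \<in> spectrum B" unfolding spectrum_T by (auto elim!: set_times_elim)
    then show "0 \<in> S"
    proof
      assume "0 \<in> spectrum A"
      then show ?thesis unfolding mem using b by (intro bexI[of _ 0] bexI[of _ b]) auto
    next
      assume "0 \<in> spectrum B"
      then show ?thesis unfolding mem using a by (intro bexI[of _ a] bexI[of _ 0]) auto
    qed
  qed
  have poles_sub: "poles T \<subseteq> spectrum T" by (auto simp: poles_def)
  have iff: "S \<subseteq> b_weyl_spectrum T \<longleftrightarrow> 0 \<notin> poles T"
    using nonzero zero bT poles_sub by (metis Diff_iff subset_iff)
  show "S \<subseteq> b_weyl_spectrum T \<longleftrightarrow> 0 \<notin> poles T" by (rule iff)
  show "0 \<notin> poles T \<longleftrightarrow> invertible_op T \<or> \<not> drazin_invertible T"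
    by (simp add: poles_eq invertible_T)
  show "S = b_weyl_spectrum T" if sub: "S \<subseteq> b_weyl_spectrum T"
  proof (rule antisym[OF sub subsetI])
    fix c assume c: "c \<in> b_weyl_spectrum T"
    show "c \<in> S"
    proof (cases "c = 0")
      case True
      then show ?thesis using c zero bT by simp
    qed (use c nonzero in simp)
  qed
  show "S = b_weyl_spectrum T \<union> {0}" if "\<not> S \<subseteq> b_weyl_spectrum T"
  proof (rule set_eqI)
    have "0 \<in> S" using that iff poles_sub zero by blast
    then show "c \<in> S \<longleftrightarrow> c \<in> b_weyl_spectrum T \<union> {0}" for c
      by (cases "c = 0") (simp_all add: nonzero)
  qed
qed

end

section \<open>The multiplication operator\<close>

text \<open>The maps \<open>A \<mapsto> A \<otimes> I\<close>, \<open>B \<mapsto> I \<otimes> B\<close> and \<open>A \<mapsto> \<tau>\<^sub>A\<^sub>I\<close> are multiplicative while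
  \<open>B \<mapsto> \<tau>\<^sub>I\<^sub>B\<close> reverses products; on commuting operators there is no difference.\<close>

lemma
  fixes h :: "('a::complex_normed_vector, 'a) cblinfun \<Rightarrow> ('b::complex_normed_vector, 'b) cblinfun"
  assumes cid: "h cid = cid" and diff: "\<And>V c. h (V - c *\<^sub>C cid) = h V - c *\<^sub>C cid"
    and comp: "\<And>S T. S o\<^sub>C T = T o\<^sub>C S \<Longrightarrow> h (S o\<^sub>C T) = h S o\<^sub>C h T"
  shows spectrum_hom: "spectrum (h V) \<subseteq> spectrum V"
    and drazin_invertible_hom: "drazin_invertible (V - c *\<^sub>C cid) \<Longrightarrow> drazin_invertible (h V - c *\<^sub>C cid)"
proof -
  have inv: "invertible_op (h W)" if "invertible_op W" for W
    using that comp cid unfolding invertible_op_def by metis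
  show "spectrum (h V) \<subseteq> spectrum V"
    unfolding spectrum_def diff[symmetric] using inv by blast
  assume "drazin_invertible (V - c *\<^sub>C cid)"
  then obtain S m where S: "(V - c *\<^sub>C cid) ^\<^sub>C m = (V - c *\<^sub>C cid) ^\<^sub>C m o\<^sub>C S o\<^sub>C (V - c *\<^sub>C cid)"
    "S o\<^sub>C (V - c *\<^sub>C cid) o\<^sub>C S = S" "(V - c *\<^sub>C cid) o\<^sub>C S = S o\<^sub>C (V - c *\<^sub>C cid)"
    by (auto simp: drazin_invertible_def)
  define W where "W = V - c *\<^sub>C cid"
  note S = S[folded W_def]
  have WS: "capp W (capp S x) = capp S (capp W x)" for x by (rule capp_commute[OF S(3)])
  have WWn: "W ^\<^sub>C n o\<^sub>C W = W o\<^sub>C W ^\<^sub>C n" for n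
    by (rule cblinfun_eqI) (simp add: capp_cpower funpow_swap1)
  have WnS: "W ^\<^sub>C n o\<^sub>C S = S o\<^sub>C W ^\<^sub>C n" for n
  proof (rule cblinfun_eqI)
    show "capp (W ^\<^sub>C n o\<^sub>C S) x = capp (S o\<^sub>C W ^\<^sub>C n) x" for x
      by (induction n) (simp_all add: WS)
  qed
  have hn: "h (W ^\<^sub>C n) = h W ^\<^sub>C n" for n
    by (induction n) (simp_all add: cid comp WWn)
  \<comment> \<open>Splitting a product under \<open>h\<close> requires commuting factors, so each
    splitting comes with a commutation argument.\<close>
  have "h W ^\<^sub>C m = h (W ^\<^sub>C m o\<^sub>C S o\<^sub>C W)" unfolding S(1)[symmetric] hn ..
  also have "\<dots> = h (W ^\<^sub>C m o\<^sub>C S) o\<^sub>C h W"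
    by (rule comp) (rule cblinfun_eqI, simp add: WS capp_commute[OF WWn] capp_commute[OF WnS])
  also have "h (W ^\<^sub>C m o\<^sub>C S) = h W ^\<^sub>C m o\<^sub>C h S" unfolding comp[OF WnS] hn ..
  finally have 1: "h W ^\<^sub>C m = h W ^\<^sub>C m o\<^sub>C h S o\<^sub>C h W" .
  have "h S o\<^sub>C h W o\<^sub>C h S = h (S o\<^sub>C W) o\<^sub>C h S" unfolding comp[OF S(3)[symmetric]] ..
  also have "\<dots> = h (S o\<^sub>C W o\<^sub>C S)"
    by (rule comp[symmetric]) (rule cblinfun_eqI, simp add: WS)
  finally have 2: "h S o\<^sub>C h W o\<^sub>C h S = h S" unfolding S(2) .
  have 3: "h W o\<^sub>C h S = h S o\<^sub>C h W"
    using comp[OF S(3)] comp[OF S(3)[symmetric]] S(3) by simp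
  show "drazin_invertible (h V - c *\<^sub>C cid)"
    unfolding drazin_invertible_def diff[symmetric] W_def[symmetric] using 1 2 3 by blast
qed

text \<open>The elementary tensors for the multiplication operator, which sends
  \<open>rank_one x \<psi>\<close> to the rank-one operator of \<open>A x\<close> and
  \<open>\<psi> o\<^sub>C B\<close>: the adjoint of \<open>B\<close> acts on the second
  entry.\<close>

definition rank_one :: "'a::complex_normed_vector \<Rightarrow> ('b::complex_normed_vector, complex) cblinfun \<Rightarrow> ('b, 'a) cblinfun"
  where "rank_one x \<psi> = mk_cblinfun (\<lambda>y. capp \<psi> y *\<^sub>C x)"

lemma capp_rank_one: "capp (rank_one x \<psi>) y = capp \<psi> y *\<^sub>C x"
proof -
  have "norm (capp \<psi> y *\<^sub>C x) \<le> norm y * (norm \<psi> * norm x)" for y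
    using mult_right_mono[OF norm_capp[of \<psi> y], of "norm x"] by (simp add: norm_scaleC mult_ac)
  then show ?thesis
    unfolding rank_one_def
    by (subst capp_mk_cblinfun)
      (auto intro!: clinearI simp: capp_add_right capp_scaleC_right scaleC_add_left scaleC_scaleC scaleC_complex_def)
qed

lemma norm_rank_one: "norm (rank_one x \<psi>) = norm x * norm \<psi>"
proof (rule antisym)
  show "norm (rank_one x \<psi>) \<le> norm x * norm \<psi>"
  proof (rule norm_cblinfun_bound)
    show "norm (capp (rank_one x \<psi>) y) \<le> norm x * norm \<psi> * norm y" for y
      using mult_right_mono[OF norm_capp[of \<psi> y], of "norm x"]
      by (simp add: capp_rank_one norm_scaleC mult_ac)
  qed simp
  show "norm x * norm \<psi> \<le> norm (rank_one x \<psi>)"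
  proof (cases "x = 0")
    case False
    have "norm \<psi> \<le> norm (rank_one x \<psi>) / norm x"
    proof (rule norm_cblinfun_bound)
      show "norm (capp \<psi> y) \<le> norm (rank_one x \<psi>) / norm x * norm y" for y
        using norm_capp[of "rank_one x \<psi>" y] False by (simp add: capp_rank_one norm_scaleC field_simps)
    qed simp
    then show ?thesis using False by (simp add: field_simps)
  qed simp
qed

text \<open>The elementary tensors for the adjoint of the multiplication operator; on their second
  entry \<open>B\<close> itself acts.\<close>

definition vector_functional ::
  "('a::complex_normed_vector, complex) cblinfun \<Rightarrow> 'b::complex_normed_vector \<Rightarrow> (('b, 'a) cblinfun, complex) cblinfun"
  where "vector_functional \<phi> y = mk_cblinfun (\<lambda>U. capp \<phi> (capp U y))"

lemma norm_vector_functional_le: "norm (capp \<phi> (capp U y)) \<le> norm U * (norm \<phi> * norm y)"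
  using order_trans[OF norm_capp[of \<phi>] mult_left_mono[OF norm_capp[of U y] norm_ge_zero[of \<phi>]]]
  by (simp add: mult_ac)

lemma capp_vector_functional: "capp (vector_functional \<phi> y) U = capp \<phi> (capp U y)"
  unfolding vector_functional_def
  by (subst capp_mk_cblinfun[OF _ norm_vector_functional_le])
    (auto intro!: clinearI simp: capp_add capp_scaleC capp_add_right capp_scaleC_right)

text \<open>For the lower estimate the functional is evaluated at rank-one operators built from a
  functional that norms \<open>y\<close>.\<close>

lemma norm_vector_functional:
  fixes \<phi> :: "('a::complex_normed_vector, complex) cblinfun" and y :: "'b::complex_normed_vector"
  shows "norm (vector_functional \<phi> y) = norm \<phi> * norm y"
proof (rule antisym)
  show "norm (vector_functional \<phi> y) \<le> norm \<phi> * norm y"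
    using norm_vector_functional_le[of \<phi> _ y]
    by (intro norm_cblinfun_bound) (auto simp: capp_vector_functional mult_ac)
  show "norm \<phi> * norm y \<le> norm (vector_functional \<phi> y)"
  proof (cases "y = 0")
    case False
    obtain \<psi> :: "('b, complex) cblinfun" where \<psi>: "capp \<psi> y = 1" "norm \<psi> \<le> 1 / norm y"
      using exists_functional_norming[OF False] by blast
    have "norm \<phi> \<le> norm (vector_functional \<phi> y) / norm y"
    proof (rule norm_cblinfun_bound)
      fix x
      have "norm (capp \<phi> x) \<le> norm (vector_functional \<phi> y) * (norm x * norm \<psi>)"
        using norm_capp[of "vector_functional \<phi> y" "rank_one x \<psi>"]
        by (simp add: capp_vector_functional capp_rank_one \<psi>(1) scaleC_one norm_rank_one)
      also have "\<dots> \<le> norm (vector_functional \<phi> y) * (norm x * (1 / norm y))"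
        using \<psi>(2) by (intro mult_left_mono) auto
      finally show "norm (capp \<phi> x) \<le> norm (vector_functional \<phi> y) / norm y * norm x"
        by (simp add: mult_ac)
    qed simp
    then show ?thesis using False by (simp add: field_simps)
  qed simp
qed

lemma product_operator_mult_op:
  fixes A :: "('x::complex_banach, 'x) cblinfun" and B :: "('y::complex_banach, 'y) cblinfun"
  assumes A: "\<not> algebraic_op A" and B: "\<not> algebraic_op B"
  shows "product_operator A B (mult_op A B) (mult_op A cid) (mult_op cid B) (dual_op B) B
    rank_one vector_functional"
proof
  show "mult_op A B = mult_op A cid o\<^sub>C mult_op cid B"
    "mult_op A cid o\<^sub>C mult_op cid B = mult_op cid B o\<^sub>C mult_op A cid"
    by (intro cblinfun_eqI; simp add: capp_mult_op)+
  let ?l = "\<lambda>V :: ('x, 'x) cblinfun. mult_op V (cid :: ('y, 'y) cblinfun)"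
  let ?r = "\<lambda>V :: ('y, 'y) cblinfun. mult_op (cid :: ('x, 'x) cblinfun) V"
  have l: "?l cid = cid" "?l (V - c *\<^sub>C cid) = ?l V - c *\<^sub>C cid" "?l (S o\<^sub>C S') = ?l S o\<^sub>C ?l S'" for V S S' c
    by (intro cblinfun_eqI; simp add: capp_mult_op capp_simps)+
  have r: "?r cid = cid" "?r (V - c *\<^sub>C cid) = ?r V - c *\<^sub>C cid" "?r (S o\<^sub>C S') = ?r S' o\<^sub>C ?r S" for V S S' c
    by (intro cblinfun_eqI; simp add: capp_mult_op capp_simps)+
  have r': "?r (S o\<^sub>C S') = ?r S o\<^sub>C ?r S'" if "S o\<^sub>C S' = S' o\<^sub>C S" for S S'
    unfolding that by (rule r(3))
  show "spectrum (?l A) \<subseteq> spectrum A" by (rule spectrum_hom[where h = ?l, OF l])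
  show "spectrum (?r B) \<subseteq> spectrum B" by (rule spectrum_hom[where h = ?r, OF r(1,2) r'])
  show "drazin_invertible (?l A - c *\<^sub>C cid)" if "drazin_invertible (A - c *\<^sub>C cid)" for c
    by (rule drazin_invertible_hom[where h = ?l, OF l that])
  show "drazin_invertible (?r B - c *\<^sub>C cid)" if "drazin_invertible (B - c *\<^sub>C cid)" for c
    by (rule drazin_invertible_hom[where h = ?r, OF r(1,2) r' that])
  show "factors_along (mult_op A B) A (dual_op B) rank_one"
  proof (rule factors_alongI)
    show "norm (rank_one x \<psi>) = norm x * norm \<psi>" for x :: 'x and \<psi> :: "('y, complex) cblinfun"
      by (rule norm_rank_one)
  qed (intro cblinfun_eqI; simp add: capp_rank_one capp_mult_op capp_dual_op capp_simps
      scaleC_add_right scaleC_add_left scaleC_scaleC scaleC_complex_def mult.commute)+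
  show "factors_along (dual_op (mult_op A B)) (dual_op A) B vector_functional"
  proof (rule factors_alongI)
    show "norm (vector_functional \<phi> y) = norm \<phi> * norm y" for \<phi> :: "('x, complex) cblinfun" and y :: 'y
      by (rule norm_vector_functional)
  qed (intro cblinfun_eqI; simp add: capp_vector_functional capp_mult_op capp_dual_op capp_simps)+
  fix m
  obtain y where y: "(capp B ^^ m) y \<noteq> 0" using not_algebraic_funpow[OF B] by blast
  then show "\<exists>y. (capp B ^^ m) y \<noteq> 0" by blast
  show "\<exists>\<psi>. (capp (dual_op B) ^^ m) \<psi> \<noteq> 0" by (rule dual_op_funpow_nonzero[OF y])
qed (use A B in auto)

section \<open>The tensor product operator\<close>

lemma pure_tensor_add_left: "(x + x') \<otimes>\<^sub>t y = x \<otimes>\<^sub>t y + x' \<otimes>\<^sub>t y"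
  and pure_tensor_add_right: "x \<otimes>\<^sub>t (y + y') = x \<otimes>\<^sub>t y + x \<otimes>\<^sub>t y'"
  and pure_tensor_scaleC_left: "(c *\<^sub>C x) \<otimes>\<^sub>t y = c *\<^sub>C (x \<otimes>\<^sub>t y)"
  and pure_tensor_scaleC_right: "x \<otimes>\<^sub>t (c *\<^sub>C y) = c *\<^sub>C (x \<otimes>\<^sub>t y)"
  by (transfer; auto simp: eval_forms_def fun_eq_iff cbilinear_simps)+

text \<open>Every tensor is evaluation along a finite list of pairs; the induction runs over this
  list.\<close>

lemma atensor_induct [case_names zero add]:
  assumes zero: "P 0" and add: "\<And>x y u. P u \<Longrightarrow> P (x \<otimes>\<^sub>t y + u)"
  shows "P u"
proof -
  have "P u" if "tensor_eval u = eval_forms ps" for ps u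
    using that
  proof (induction ps arbitrary: u)
    case Nil
    then have "tensor_eval u = tensor_eval 0"
      by (simp add: zero_atensor.rep_eq eval_forms_def fun_eq_iff)
    then show ?case using zero by (simp add: tensor_eval_inject)
  next
    case (Cons p ps)
    obtain x y where p: "p = (x, y)" by (cases p)
    define v where "v = Abs_atensor (eval_forms ps)"
    have v: "tensor_eval v = eval_forms ps" unfolding v_def by (rule Abs_atensor_inverse) simp
    have "tensor_eval u = tensor_eval (x \<otimes>\<^sub>t y + v)"
      using Cons.prems eval_forms_append[of "[p]" ps]
      by (simp add: plus_atensor.rep_eq pure_tensor.rep_eq v p)
    then show ?case using add[OF Cons.IH[OF v]] by (simp add: tensor_eval_inject)
  qed
  then show ?thesis using tensor_eval[of u] by blast
qed

locale tensor_space =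
  fixes \<alpha> :: "('x::complex_banach, 'y::complex_banach) atensor \<Rightarrow> real"
    and \<iota> :: "('x, 'y) atensor \<Rightarrow> 'z::complex_banach"
  assumes \<alpha>: "reasonable_uniform_crossnorm \<alpha>" and \<iota>: "tensor_completion \<alpha> \<iota>"
begin

definition elementary :: "'x \<Rightarrow> 'y \<Rightarrow> 'z"
  where "elementary x y = \<iota> (x \<otimes>\<^sub>t y)"

lemma elementary_add_left: "elementary (x + x') y = elementary x y + elementary x' y"
  and elementary_add_right: "elementary x (y + y') = elementary x y + elementary x y'"
  and elementary_scaleC_left: "elementary (c *\<^sub>C x) y = c *\<^sub>C elementary x y"
  and elementary_scaleC_right: "elementary x (c *\<^sub>C y) = c *\<^sub>C elementary x y"
proof -
  interpret \<iota>: Vector_Spaces.linear scaleC scaleC \<iota> using \<iota> by (simp add: tensor_completion_def)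
  show "elementary (x + x') y = elementary x y + elementary x' y"
    "elementary x (y + y') = elementary x y + elementary x y'"
    "elementary (c *\<^sub>C x) y = c *\<^sub>C elementary x y" "elementary x (c *\<^sub>C y) = c *\<^sub>C elementary x y"
    by (simp_all add: elementary_def pure_tensor_add_left pure_tensor_add_right
        pure_tensor_scaleC_left pure_tensor_scaleC_right \<iota>.add \<iota>.scale)
qed

lemma elementary_diff_left: "elementary (x - x') y = elementary x y - elementary x' y"
  using elementary_add_left[of "x - x'" x' y] by simp

lemma elementary_diff_right: "elementary x (y - y') = elementary x y - elementary x y'"
  using elementary_add_right[of x "y - y'" y'] by simp

lemma norm_elementary: "norm (elementary x y) = norm x * norm y"
  using \<alpha> \<iota> by (simp add: elementary_def tensor_completion_def reasonable_uniform_crossnorm_def)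

lemma capp_tensor_op_elementary:
  "capp (tensor_op \<iota> A B) (elementary x y) = elementary (capp A x) (capp B y)"
  unfolding elementary_def by (rule capp_tensor_op[OF \<alpha> \<iota>])

lemma dense: "closure (range \<iota>) = UNIV"
  using \<iota> by (simp add: tensor_completion_def)

text \<open>Finite sums of elementary tensors are dense, so operator identities need checking on
  these only.\<close>

lemma cblinfun_eqI_elementary:
  fixes P Q :: "('z, 'w::complex_normed_vector) cblinfun"
  assumes "\<And>x y. capp P (elementary x y) = capp Q (elementary x y)"
  shows "P = Q"
proof (rule cblinfun_eqI)
  interpret \<iota>: Vector_Spaces.linear scaleC scaleC \<iota> using \<iota> by (simp add: tensor_completion_def)
  have "capp P (\<iota> u) = capp Q (\<iota> u)" for u
    by (induction u rule: atensor_induct)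
      (use assms in \<open>simp_all add: \<iota>.zero \<iota>.add capp_add_right elementary_def\<close>)
  then have "range \<iota> \<subseteq> {z. capp P z = capp Q z}" by auto
  moreover have "closed {z. capp P z = capp Q z}"
    by (intro closed_Collect_eq continuous_on_capp)
  ultimately have "closure (range \<iota>) \<subseteq> {z. capp P z = capp Q z}" by (rule closure_minimal)
  then show "capp P z = capp Q z" for z by (auto simp: dense)
qed

lemma norm_tensor_op: "norm (tensor_op \<iota> A B) \<le> norm A * norm B"
proof (rule norm_cblinfun_bound)
  fix z
  have T: "capp (tensor_op \<iota> A B) (\<iota> u) = \<iota> (tensor_map A B u)" for u
    using theI'[OF tensor_op_ex1[OF \<alpha> \<iota>, of A B]] by (simp add: tensor_op_def)
  have "norm (capp (tensor_op \<iota> A B) (\<iota> u)) \<le> norm A * norm B * norm (\<iota> u)" for u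
    using \<alpha> \<iota> by (simp add: T tensor_completion_def reasonable_uniform_crossnorm_def)
  then have "range \<iota> \<subseteq> {z. norm (capp (tensor_op \<iota> A B) z) \<le> norm A * norm B * norm z}" by auto
  moreover have "closed {z. norm (capp (tensor_op \<iota> A B) z) \<le> norm A * norm B * norm z}"
    by (intro closed_Collect_le continuous_intros continuous_on_capp)
  ultimately have "closure (range \<iota>) \<subseteq> {z. norm (capp (tensor_op \<iota> A B) z) \<le> norm A * norm B * norm z}"
    by (rule closure_minimal)
  then show "norm (capp (tensor_op \<iota> A B) z) \<le> norm A * norm B * norm z" by (auto simp: dense)
qed simp

text \<open>The continuous extension of \<open>\<phi> \<otimes> \<psi>\<close> to the completion is obtained from the operator
  \<open>(x \<otimes> \<phi>) \<otimes> (y \<otimes> \<psi>)\<close> with rank-one factors and a functional that norms \<open>x \<otimes> y\<close>.\<close>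

lemma exists_functional_product:
  fixes x\<^sub>0 :: 'x and y\<^sub>0 :: 'y
  assumes "x\<^sub>0 \<noteq> 0" "y\<^sub>0 \<noteq> 0"
  obtains j :: "('x, complex) cblinfun \<Rightarrow> ('y, complex) cblinfun \<Rightarrow> ('z, complex) cblinfun"
  where "\<And>\<phi> \<psi> x y. capp (j \<phi> \<psi>) (elementary x y) = capp \<phi> x * capp \<psi> y"
    and "\<And>\<phi> \<psi>. norm (j \<phi> \<psi>) = norm \<phi> * norm \<psi>"
proof -
  have "elementary x\<^sub>0 y\<^sub>0 \<noteq> 0" using assms norm_elementary[of x\<^sub>0 y\<^sub>0] by fastforce
  then obtain \<theta> :: "('z, complex) cblinfun"
    where \<theta>: "capp \<theta> (elementary x\<^sub>0 y\<^sub>0) = 1" "norm \<theta> \<le> 1 / norm (elementary x\<^sub>0 y\<^sub>0)"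
    using exists_functional_norming by blast
  define j where "j \<phi> \<psi> = \<theta> o\<^sub>C tensor_op \<iota> (rank_one x\<^sub>0 \<phi>) (rank_one y\<^sub>0 \<psi>)" for \<phi> \<psi>
  have app: "capp (j \<phi> \<psi>) (elementary x y) = capp \<phi> x * capp \<psi> y" for \<phi> \<psi> x y
    by (simp add: j_def capp_tensor_op_elementary capp_rank_one elementary_scaleC_left
        elementary_scaleC_right capp_scaleC_right \<theta>(1) scaleC_complex_def)
  have "norm (j \<phi> \<psi>) = norm \<phi> * norm \<psi>" for \<phi> \<psi>
  proof (rule antisym)
    have "norm (j \<phi> \<psi>) \<le> norm \<theta> * (norm (rank_one x\<^sub>0 \<phi>) * norm (rank_one y\<^sub>0 \<psi>))"
      unfolding j_def by (rule order_trans[OF norm_ccompose mult_left_mono[OF norm_tensor_op norm_ge_zero]])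
    also have "\<dots> \<le> 1 / norm (elementary x\<^sub>0 y\<^sub>0) * (norm (rank_one x\<^sub>0 \<phi>) * norm (rank_one y\<^sub>0 \<psi>))"
      using \<theta>(2) by (intro mult_right_mono) auto
    also have "\<dots> = norm \<phi> * norm \<psi>" using assms by (simp add: norm_rank_one norm_elementary)
    finally show "norm (j \<phi> \<psi>) \<le> norm \<phi> * norm \<psi>" .
    \<comment> \<open>The lower estimate frees one variable at a time: letting \<open>x\<close> vary
      produces \<open>norm \<phi>\<close>, then letting \<open>y\<close> vary produces
      \<open>norm \<psi>\<close>.\<close>
    have "norm (capp \<psi> y *\<^sub>C \<phi>) \<le> norm (j \<phi> \<psi>) * norm y" for y
    proof (rule norm_cblinfun_bound)
      show "norm (capp (capp \<psi> y *\<^sub>C \<phi>) x) \<le> norm (j \<phi> \<psi>) * norm y * norm x" for x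
        using norm_capp[of "j \<phi> \<psi>" "elementary x y"]
        by (simp add: app norm_elementary capp_scaleC norm_scaleC norm_mult mult_ac)
    qed simp
    then have "norm (complex_of_real (norm \<phi>) *\<^sub>C \<psi>) \<le> norm (j \<phi> \<psi>)"
      by (intro norm_cblinfun_bound) (simp_all add: capp_scaleC norm_scaleC norm_mult mult_ac)
    then show "norm \<phi> * norm \<psi> \<le> norm (j \<phi> \<psi>)" by (simp add: norm_scaleC)
  qed
  with app show ?thesis by (rule that)
qed

lemma product_operator_tensor_op:
  assumes A: "\<not> algebraic_op A" and B: "\<not> algebraic_op B"
  shows "\<exists>j. product_operator A B (tensor_op \<iota> A B) (tensor_op \<iota> A cid) (tensor_op \<iota> cid B) B (dual_op B)
    elementary j"
proof -
  obtain x\<^sub>0 y\<^sub>0 where "(capp A ^^ 0) x\<^sub>0 \<noteq> 0" "(capp B ^^ 0) y\<^sub>0 \<noteq> 0"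
    using not_algebraic_funpow[OF A] not_algebraic_funpow[OF B] by metis
  then have "x\<^sub>0 \<noteq> 0" "y\<^sub>0 \<noteq> 0" by simp_all
  then obtain j :: "('x, complex) cblinfun \<Rightarrow> ('y, complex) cblinfun \<Rightarrow> ('z, complex) cblinfun"
    where j: "\<And>\<phi> \<psi> x y. capp (j \<phi> \<psi>) (elementary x y) = capp \<phi> x * capp \<psi> y"
      "\<And>\<phi> \<psi>. norm (j \<phi> \<psi>) = norm \<phi> * norm \<psi>"
    using exists_functional_product by blast
  have "product_operator A B (tensor_op \<iota> A B) (tensor_op \<iota> A cid) (tensor_op \<iota> cid B) B (dual_op B)
    elementary j"
  proof
    show "tensor_op \<iota> A B = tensor_op \<iota> A cid o\<^sub>C tensor_op \<iota> cid B"
      "tensor_op \<iota> A cid o\<^sub>C tensor_op \<iota> cid B = tensor_op \<iota> cid B o\<^sub>C tensor_op \<iota> A cid"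
      by (rule cblinfun_eqI_elementary; simp add: capp_tensor_op_elementary)+
    let ?l = "\<lambda>V. tensor_op \<iota> V cid" and ?r = "\<lambda>V. tensor_op \<iota> cid V"
    have l: "?l cid = cid" "?l (V - c *\<^sub>C cid) = ?l V - c *\<^sub>C cid" "?l (S o\<^sub>C S') = ?l S o\<^sub>C ?l S'" for V S S' c
      by (rule cblinfun_eqI_elementary; simp add: capp_tensor_op_elementary capp_simps
          elementary_diff_left elementary_scaleC_left)+
    have r: "?r cid = cid" "?r (V - c *\<^sub>C cid) = ?r V - c *\<^sub>C cid" "?r (S o\<^sub>C S') = ?r S o\<^sub>C ?r S'" for V S S' c
      by (rule cblinfun_eqI_elementary; simp add: capp_tensor_op_elementary capp_simps
          elementary_diff_right elementary_scaleC_right)+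
    show "spectrum (?l A) \<subseteq> spectrum A" by (rule spectrum_hom[where h = ?l, OF l])
    show "spectrum (?r B) \<subseteq> spectrum B" by (rule spectrum_hom[where h = ?r, OF r])
    show "drazin_invertible (?l A - c *\<^sub>C cid)" if "drazin_invertible (A - c *\<^sub>C cid)" for c
      by (rule drazin_invertible_hom[where h = ?l, OF l that])
    show "drazin_invertible (?r B - c *\<^sub>C cid)" if "drazin_invertible (B - c *\<^sub>C cid)" for c
      by (rule drazin_invertible_hom[where h = ?r, OF r that])
    show "factors_along (tensor_op \<iota> A B) A B elementary"
      by (rule factors_alongI elementary_add_left elementary_add_right elementary_scaleC_left
          elementary_scaleC_right norm_elementary capp_tensor_op_elementary)+
    show "factors_along (dual_op (tensor_op \<iota> A B)) (dual_op A) (dual_op B) j"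
      by (rule factors_alongI; (rule j(2))?; rule cblinfun_eqI_elementary;
          simp add: j(1) capp_simps capp_dual_op capp_tensor_op_elementary scaleC_complex_def algebra_simps)
    fix m
    obtain y where y: "(capp B ^^ m) y \<noteq> 0" using not_algebraic_funpow[OF B] by blast
    then show "\<exists>y. (capp B ^^ m) y \<noteq> 0" by blast
    show "\<exists>\<psi>. (capp (dual_op B) ^^ m) \<psi> \<noteq> 0" by (rule dual_op_funpow_nonzero[OF y])
  qed (use A B in auto)
  then show ?thesis by blast
qed

end

theorem theorem4p5:
  fixes A :: "('x::complex_banach, 'x) cblinfun"
    and B :: "('y::complex_banach, 'y) cblinfun"
    and \<alpha> :: "('x, 'y) atensor \<Rightarrow> real"
    and \<iota> :: "('x, 'y) atensor \<Rightarrow> 'z::complex_banach"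
    and S :: "complex set"
  assumes "\<not> fin_dim (UNIV :: 'x set)" and "\<not> fin_dim (UNIV :: 'y set)"
    and "reasonable_uniform_crossnorm \<alpha>" and "tensor_completion \<alpha> \<iota>"
    and "\<not> algebraic_op A" and "\<not> algebraic_op B"
    and "generalized_browder A" and "generalized_browder B"
    and "S = spectrum A * b_weyl_spectrum B \<union> b_weyl_spectrum A * spectrum B"
  shows
    "(generalized_browder (tensor_op \<iota> A B) \<longrightarrow>
       poles (tensor_op \<iota> A B) = poles (mult_op A B) \<and>
       (S \<subseteq> b_weyl_spectrum (tensor_op \<iota> A B) \<longleftrightarrow> 0 \<notin> poles (tensor_op \<iota> A B)) \<and>
       (0 \<notin> poles (tensor_op \<iota> A B) \<longleftrightarrow>
          invertible_op (tensor_op \<iota> A B) \<or> \<not> drazin_invertible (tensor_op \<iota> A B)) \<and>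
       (S \<subseteq> b_weyl_spectrum (tensor_op \<iota> A B) \<longrightarrow>
          S = b_weyl_spectrum (tensor_op \<iota> A B)) \<and>
       (\<not> S \<subseteq> b_weyl_spectrum (tensor_op \<iota> A B) \<longrightarrow>
          S = b_weyl_spectrum (tensor_op \<iota> A B) \<union> {0})) \<and>
     (generalized_browder (mult_op A B) \<longrightarrow>
       poles (tensor_op \<iota> A B) = poles (mult_op A B) \<and>
       (S \<subseteq> b_weyl_spectrum (mult_op A B) \<longleftrightarrow> 0 \<notin> poles (tensor_op \<iota> A B)) \<and>
       (0 \<notin> poles (tensor_op \<iota> A B) \<longleftrightarrow>
          invertible_op (mult_op A B) \<or> \<not> drazin_invertible (mult_op A B)) \<and>
       (S \<subseteq> b_weyl_spectrum (mult_op A B) \<longrightarrow>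
          S = b_weyl_spectrum (mult_op A B)) \<and>
       (\<not> S \<subseteq> b_weyl_spectrum (mult_op A B) \<longrightarrow>
          S = b_weyl_spectrum (mult_op A B) \<union> {0}))"
proof -
  interpret tensor_space \<alpha> \<iota> by unfold_locales fact+
  obtain j where j: "product_operator A B (tensor_op \<iota> A B) (tensor_op \<iota> A cid) (tensor_op \<iota> cid B)
      B (dual_op B) elementary j"
    using product_operator_tensor_op[OF assms(5,6)] by blast
  interpret tensor: product_operator A B "tensor_op \<iota> A B" "tensor_op \<iota> A cid" "tensor_op \<iota> cid B"
      B "dual_op B" elementary j
    by (rule j)
  interpret mult: product_operator A B "mult_op A B" "mult_op A cid" "mult_op cid B"
      "dual_op B" B rank_one vector_functional
    by (rule product_operator_mult_op[OF assms(5,6)])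
  \<comment> \<open>Both instances describe the poles through \<open>A\<close> and \<open>B\<close>
    alone, so the two operators share them.\<close>
  have poles: "poles (tensor_op \<iota> A B) = poles (mult_op A B)"
  proof (rule set_eqI)
    show "c \<in> poles (tensor_op \<iota> A B) \<longleftrightarrow> c \<in> poles (mult_op A B)" for c
      by (cases "c = 0") (simp_all add: tensor.poles_T_0 mult.poles_T_0
          tensor.poles_T_nonzero mult.poles_T_nonzero)
  qed
  show ?thesis
    using tensor.b_weyl_spectrum_product[OF assms(7,8) _ assms(9)]
      mult.b_weyl_spectrum_product[OF assms(7,8) _ assms(9)] poles
    by simp
qed

end
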